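(* Let $1\le p<\infty$. For a Banach lattice $E$, consider the following conditions: (a) $E$ has the strong $p$-GP property. (b) $E$ is a discrete KB-space. (c) $E$ has the strong DP$_{rc}$P. Then (a)$\Rightarrow$(b)$\Rightarrow$(c). Moreover, (c)$\Rightarrow$(a) whenever $p\ge2$.
   Context: A KB-space is a Banach lattice in which every increasing norm bounded sequence of positive elements is norm convergent. A Banach lattice is discrete if for every $x>0$ there is an atom $a$ (an element $a>0$ such that $0\le y\le a$ implies $y=\lambda a$ for some scalar $\lambda$) with $0<a\le x$. A sequence $(x_n^* )_n\subset E^*$ is weak* $p$-summable if $(x_n^*(x))_n\in\ell_p$ for every $x\in E$. A subset $A$ of $E$ is almost $p$-limited if for each pairwise disjoint weak* $p$-summable sequence $(x_n^* )_n\subset E^*$ there is $(a_n)_n\in\ell_p$ such that $|x_n^*(x)|\le a_n$ for every $x\in A$ and $n\in\mathbb{N}$. $E$ has the strong $p$-GP property if every almost $p$-limited set in $E$ is relatively compact. A (norm bounded) subset $A$ of $E$ is almost Dunford-Pettis if every disjoint weakly null sequence in $E^*$ converges uniformly to zero on $A$. $E$ has the strong DP$_{rc}$P if every almost Dunford-Pettis set in $E$ is relatively compact. *)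

theory Defs
  imports "HOL-Analysis.Analysis" "HOL-Library.Lattice_Algebras"
begin

section \<open>Banach lattices\<close>

text \<open>A (real) Banach lattice: a complete normed vector lattice whose norm is a lattice norm.
  In \<^class>\<open>lattice_ab_group_add_abs\<close> the absolute value is \<open>\<bar>x\<bar> = sup x (- x)\<close>.\<close>

class banach_lattice = banach + ordered_real_vector + lattice_ab_group_add_abs +
  assumes lattice_norm: "\<bar>x\<bar> \<le> \<bar>y\<bar> \<Longrightarrow> norm x \<le> norm y"

instance real :: banach_lattice
  by standard simp

text \<open>Properties of the whole space \<open>E\<close> take the type as an argument, as in \<open>TYPE('a)\<close>.\<close>

definition KB_space :: "'a::banach_lattice itself \<Rightarrow> bool" where
  "KB_space E \<longleftrightarrow>
    (\<forall>x :: nat \<Rightarrow> 'a. (\<forall>n. 0 \<le> x n) \<longrightarrow> incseq x \<longrightarrow> bounded (range x) \<longrightarrow> convergent x)"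

definition lattice_atom :: "'a::banach_lattice \<Rightarrow> bool" where
  "lattice_atom a \<longleftrightarrow> 0 < a \<and> (\<forall>y. 0 \<le> y \<and> y \<le> a \<longrightarrow> (\<exists>c :: real. y = c *\<^sub>R a))"

definition discrete_lattice :: "'a::banach_lattice itself \<Rightarrow> bool" where
  "discrete_lattice E \<longleftrightarrow> (\<forall>x :: 'a. 0 < x \<longrightarrow> (\<exists>a. lattice_atom a \<and> a \<le> x))"

definition relatively_compact :: "'a::topological_space set \<Rightarrow> bool" where
  "relatively_compact A \<longleftrightarrow> compact (closure A)"


section \<open>Disjointness in the topological dual\<close>

text \<open>The dual is the type \<^typ>\<open>'a \<Rightarrow>\<^sub>L real\<close>, ordered by \<open>dual_le\<close>. The dual of a Banach lattice
  is a vector lattice in this order; its lattice operations are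
  least upper and greatest lower bounds in the order (not pointwise ones), and are
  expressed as such. The relation \<open>dual_modulus f u\<close> reads \<open>u = \<bar>f\<bar> = sup f (- f)\<close>, and
  \<open>dual_disjoint f g\<close> reads \<open>inf \<bar>f\<bar> \<bar>g\<bar> = 0\<close>.\<close>

definition dual_le :: "('a::banach_lattice \<Rightarrow>\<^sub>L real) \<Rightarrow> ('a \<Rightarrow>\<^sub>L real) \<Rightarrow> bool" where
  "dual_le f g \<longleftrightarrow> (\<forall>x. 0 \<le> x \<longrightarrow> blinfun_apply f x \<le> blinfun_apply g x)"

definition dual_sup :: "('a::banach_lattice \<Rightarrow>\<^sub>L real) \<Rightarrow> ('a \<Rightarrow>\<^sub>L real) \<Rightarrow> ('a \<Rightarrow>\<^sub>L real) \<Rightarrow> bool" where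
  "dual_sup f g u \<longleftrightarrow> dual_le f u \<and> dual_le g u \<and>
     (\<forall>h. dual_le f h \<and> dual_le g h \<longrightarrow> dual_le u h)"

definition dual_inf :: "('a::banach_lattice \<Rightarrow>\<^sub>L real) \<Rightarrow> ('a \<Rightarrow>\<^sub>L real) \<Rightarrow> ('a \<Rightarrow>\<^sub>L real) \<Rightarrow> bool" where
  "dual_inf f g u \<longleftrightarrow> dual_le u f \<and> dual_le u g \<and>
     (\<forall>h. dual_le h f \<and> dual_le h g \<longrightarrow> dual_le h u)"

definition dual_modulus :: "('a::banach_lattice \<Rightarrow>\<^sub>L real) \<Rightarrow> ('a \<Rightarrow>\<^sub>L real) \<Rightarrow> bool" where
  "dual_modulus f u \<longleftrightarrow> dual_sup f (- f) u"

definition dual_disjoint :: "('a::banach_lattice \<Rightarrow>\<^sub>L real) \<Rightarrow> ('a \<Rightarrow>\<^sub>L real) \<Rightarrow> bool" where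
  "dual_disjoint f g \<longleftrightarrow> (\<exists>u v. dual_modulus f u \<and> dual_modulus g v \<and> dual_inf u v 0)"

definition disjoint_sequence :: "(nat \<Rightarrow> ('a::banach_lattice \<Rightarrow>\<^sub>L real)) \<Rightarrow> bool" where
  "disjoint_sequence f \<longleftrightarrow> (\<forall>m n. m \<noteq> n \<longrightarrow> dual_disjoint (f m) (f n))"


section \<open>Almost \<open>p\<close>-limited sets and the strong \<open>p\<close>-GP property\<close>

definition in_ell :: "real \<Rightarrow> (nat \<Rightarrow> real) \<Rightarrow> bool" where
  "in_ell p a \<longleftrightarrow> summable (\<lambda>n. \<bar>a n\<bar> powr p)"

definition weak_star_p_summable ::
    "real \<Rightarrow> (nat \<Rightarrow> ('a::real_normed_vector \<Rightarrow>\<^sub>L real)) \<Rightarrow> bool" where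
  "weak_star_p_summable p f \<longleftrightarrow> (\<forall>x. in_ell p (\<lambda>n. blinfun_apply (f n) x))"

definition almost_p_limited :: "real \<Rightarrow> 'a::banach_lattice set \<Rightarrow> bool" where
  "almost_p_limited p A \<longleftrightarrow>
    (\<forall>f :: nat \<Rightarrow> ('a \<Rightarrow>\<^sub>L real). disjoint_sequence f \<longrightarrow> weak_star_p_summable p f \<longrightarrow>
      (\<exists>a. in_ell p a \<and> (\<forall>x\<in>A. \<forall>n. \<bar>blinfun_apply (f n) x\<bar> \<le> a n)))"

definition strong_p_GP :: "real \<Rightarrow> 'a::banach_lattice itself \<Rightarrow> bool" where
  "strong_p_GP p E \<longleftrightarrow> (\<forall>A :: 'a set. almost_p_limited p A \<longrightarrow> relatively_compact A)"


section \<open>Almost Dunford-Pettis sets and the strong relatively compact Dunford-Pettis property\<close>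

definition weakly_null :: "(nat \<Rightarrow> 'b::real_normed_vector) \<Rightarrow> bool" where
  "weakly_null x \<longleftrightarrow> (\<forall>\<phi> :: 'b \<Rightarrow>\<^sub>L real. (\<lambda>n. blinfun_apply \<phi> (x n)) \<longlonglongrightarrow> 0)"

definition almost_Dunford_Pettis :: "'a::banach_lattice set \<Rightarrow> bool" where
  "almost_Dunford_Pettis A \<longleftrightarrow> bounded A \<and>
    (\<forall>f :: nat \<Rightarrow> ('a \<Rightarrow>\<^sub>L real). disjoint_sequence f \<longrightarrow> weakly_null f \<longrightarrow>
      uniform_limit A (\<lambda>n. blinfun_apply (f n)) (\<lambda>_. 0) sequentially)"

definition strong_DPrcP :: "'a::banach_lattice itself \<Rightarrow> bool" where
  "strong_DPrcP E \<longleftrightarrow> (\<forall>A :: 'a set. almost_Dunford_Pettis A \<longrightarrow> relatively_compact A)"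

end

theory Submission
  imports Defs
begin

text \<open>
  All three implications pass through disjoint sequences in the dual, and through one fact
  about them: finitely many disjoint functionals attain their moduli at \<open>x \<ge> 0\<close> almost simultaneously, at
  a single \<open>y\<close> with \<open>\<bar>y\<bar> \<le> x\<close> (\<open>disjoint_simultaneous_approx\<close>, by the Riesz--Kantorovich formulas).

  From the Gelfand--Phillips property to discrete KB-spaces. If \<open>f n\<close> is disjoint and weak*
  \<open>p\<close>-summable, uniform boundedness and simultaneous approximation bound the sums of
  \<open>(\<bar>f n\<bar> x)\<^sup>p\<close>, uniformly over positive \<open>x\<close> in the ball. So order intervals and
  norm bounded increasing positive sequences are almost \<open>p\<close>-limited, hence relatively compact. For the
  sequences this is the KB property. For the intervals it gives atoms: take a positive functional \<open>\<phi>\<close>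
  with \<open>\<phi> x > 0\<close>. If \<open>x\<close> could be cut into disjoint pieces of arbitrarily small \<open>\<phi>\<close>-mass, then
  keeping each piece with probability one half would give a point of \<open>[0, x]\<close> far from any prescribed finite
  set, against compactness (\<open>compact_interval_not_fine_split\<close>). Otherwise, by Zorn's lemma, there is a
  minimal component of \<open>x\<close> that cannot be cut in this way, and it is an atom (\<open>not_fine_split_imp_atom\<close>).

  From discrete KB-spaces to the Dunford--Pettis property. Every element is approximated by its projections
  onto finitely many atoms. If this is not uniform on \<open>A\<close>, a sliding hump gives elements of \<open>A\<close> that are
  large on disjoint finite blocks of atoms, and norming functionals supported on those blocks. These are
  disjoint, and they are weakly null (\<open>KB_atom_blocks_weakly_null\<close>): an element of the bidual restricts to
  a vector on each block, the moduli of these vectors have bounded increasing partial sums, and the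
  KB property makes the sums converge. So \<open>A\<close> is not almost Dunford--Pettis.

  From the Dunford--Pettis property to the Gelfand--Phillips property. It suffices that almost \<open>p\<close>-limited
  sets are almost Dunford--Pettis. If a disjoint weakly null sequence \<open>g n\<close> stays away from zero on \<open>A\<close>,
  then Mazur's theorem yields coefficients \<open>\<alpha> n \<ge> 0\<close> that are not summable although the partial sums of
  \<open>\<alpha> n \<bar>g n\<bar>\<close> are bounded (\<open>nonsummable_coefficients\<close>). The multiples of \<open>g n\<close> by the
  \<open>p\<close>-th roots of \<open>\<alpha> n\<close> are then weak* \<open>p\<close>-summable, but admit no \<open>p\<close>-summable bound on \<open>A\<close>.
\<close>

section \<open>The Hahn--Banach theorem\<close>

definition sublinear :: "('v::real_vector \<Rightarrow> real) \<Rightarrow> bool" where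
  "sublinear q \<longleftrightarrow> (\<forall>x y. q (x + y) \<le> q x + q y) \<and> (\<forall>r x. 0 \<le> r \<longrightarrow> q (r *\<^sub>R x) = r * q x)"

lemma sublinear_add: "sublinear q \<Longrightarrow> q (x + y) \<le> q x + q y"
  and sublinear_scale: "sublinear q \<Longrightarrow> 0 \<le> r \<Longrightarrow> q (r *\<^sub>R x) = r * q x"
  by (auto simp: sublinear_def)

lemma sublinear_zero: "sublinear q \<Longrightarrow> q 0 = 0"
  using sublinear_scale[of q 0 0] by simp

lemma sublinear_minus: "sublinear q \<Longrightarrow> - q (- x) \<le> q x"
  using sublinear_add[of q x "- x"] sublinear_zero[of q] by simp

lemma sublinearI_pos:
  assumes "\<And>x y. q (x + y) \<le> q x + q y"
    and "q 0 = 0"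
    and le: "\<And>r x. 0 < r \<Longrightarrow> q (r *\<^sub>R x) \<le> r * q x"
  shows "sublinear q"
proof -
  have "q (r *\<^sub>R x) = r * q x" if "0 < r" for r x
  proof (rule antisym)
    show "q (r *\<^sub>R x) \<le> r * q x" by (rule le[OF that])
    have "q (inverse r *\<^sub>R (r *\<^sub>R x)) \<le> inverse r * q (r *\<^sub>R x)"
      using that by (intro le) simp
    with that show "r * q x \<le> q (r *\<^sub>R x)" by (simp add: field_simps)
  qed
  then have "q (r *\<^sub>R x) = r * q x" if "0 \<le> r" for r x
    using that assms(2) by (cases "r = 0") auto
  with assms(1) show ?thesis by (simp add: sublinear_def)
qed

text \<open>The infimal convolution of \<open>q\<close> with the cone over \<open>- S\<close>, on which \<open>- s\<close> is given the
  value \<open>- d\<close>. It is the device behind both steps of the Hahn--Banach theorem: with a general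
  \<open>S\<close> it builds in the required lower bound, and with a singleton it shows that a
  minimal sublinear functional is linear.\<close>

lemma sublinear_lowering:
  fixes q :: "'v::real_vector \<Rightarrow> real"
  assumes q: "sublinear q" and S: "convex S" "S \<noteq> {}" and d: "\<And>s. s \<in> S \<Longrightarrow> d \<le> q s"
  obtains q' where "sublinear q'" "\<And>y. q' y \<le> q y" "\<And>s. s \<in> S \<Longrightarrow> q' (- s) \<le> - d"
proof -
  define V where "V y = {q (y + t *\<^sub>R s) - t * d | t s. 0 \<le> t \<and> s \<in> S}" for y
  define q' where "q' y = Inf (V y)" for y
  obtain s0 where s0: "s0 \<in> S" using S by auto
  have VI: "q (y + t *\<^sub>R s) - t * d \<in> V y" if "0 \<le> t" "s \<in> S" for y t s
    using that by (auto simp: V_def)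
  have q_in: "q y \<in> V y" for y
    using VI[of 0 s0 y] s0 by simp
  have lower: "- q (- y) \<le> v" if mem: "v \<in> V y" for v y
  proof -
    obtain t s where v: "v = q (y + t *\<^sub>R s) - t * d" "0 \<le> t" "s \<in> S"
      using mem unfolding V_def by blast
    have "t * d \<le> t * q s" using v d by (intro mult_left_mono) auto
    also have "\<dots> = q ((y + t *\<^sub>R s) + (- y))" using v by (simp add: sublinear_scale[OF q])
    also have "\<dots> \<le> q (y + t *\<^sub>R s) + q (- y)" by (rule sublinear_add[OF q])
    finally show ?thesis using v by simp
  qed
  have bdd: "bdd_below (V y)" for y using lower by (meson bdd_below.I)
  have le: "q' y \<le> v" if "v \<in> V y" for v y
    unfolding q'_def using bdd that by (intro cInf_lower)
  have ge: "c \<le> q' y" if "\<And>v. v \<in> V y \<Longrightarrow> c \<le> v" for c y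
    unfolding q'_def using q_in that by (intro cInf_greatest) auto
  have comb: "q' (x + y) \<le> v + w" if mem: "v \<in> V x" "w \<in> V y" for x y v w
  proof -
    obtain t s where v: "v = q (x + t *\<^sub>R s) - t * d" "0 \<le> t" "s \<in> S"
      using mem(1) unfolding V_def by blast
    obtain t' s' where w: "w = q (y + t' *\<^sub>R s') - t' * d" "0 \<le> t'" "s' \<in> S"
      using mem(2) unfolding V_def by blast
    obtain s'' where s'': "s'' \<in> S" "t *\<^sub>R s + t' *\<^sub>R s' = (t + t') *\<^sub>R s''"
    proof (cases "t + t' = 0")
      case True
      then have "t = 0" "t' = 0" using v w by auto
      then show ?thesis using that s0 by auto
    next
      case False
      then have pos: "t + t' > 0" using v w by auto
      have "(t / (t + t')) *\<^sub>R s + (t' / (t + t')) *\<^sub>R s' \<in> S"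
        using v w pos by (intro convexD[OF S(1)]) (auto simp: add_divide_distrib[symmetric])
      moreover have "t *\<^sub>R s + t' *\<^sub>R s' = (t + t') *\<^sub>R ((t / (t + t')) *\<^sub>R s + (t' / (t + t')) *\<^sub>R s')"
        using pos by (simp add: scaleR_right_distrib)
      ultimately show ?thesis using that by blast
    qed
    have "q' (x + y) \<le> q ((x + y) + (t + t') *\<^sub>R s'') - (t + t') * d"
      using v w s'' by (intro le VI) auto
    also have "(x + y) + (t + t') *\<^sub>R s'' = (x + t *\<^sub>R s) + (y + t' *\<^sub>R s')"
      unfolding s''(2)[symmetric] by (simp add: algebra_simps)
    finally have "q' (x + y) \<le> q ((x + t *\<^sub>R s) + (y + t' *\<^sub>R s')) - (t + t') * d" .
    also have "\<dots> \<le> v + w"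
      unfolding v w using sublinear_add[OF q, of "x + t *\<^sub>R s" "y + t' *\<^sub>R s'"]
      by (simp add: algebra_simps)
    finally show ?thesis .
  qed
  have "sublinear q'"
  proof (rule sublinearI_pos)
    show "q' (x + y) \<le> q' x + q' y" for x y
    proof -
      have "q' (x + y) - w \<le> q' x" if "w \<in> V y" for w
        using comb[OF _ that] by (intro ge) (simp add: algebra_simps)
      then have "q' (x + y) - q' x \<le> q' y"
        by (intro ge) (simp add: algebra_simps)
      then show ?thesis by simp
    qed
    show "q' 0 = 0"
      using le[OF q_in, of 0] ge[of 0 "- q (- 0)", OF lower] by (simp add: sublinear_zero[OF q])
    show "q' (r *\<^sub>R x) \<le> r * q' x" if r: "0 < r" for r x
    proof -
      have "inverse r * q' (r *\<^sub>R x) \<le> q' x"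
      proof (rule ge)
        fix v assume "v \<in> V x"
        then obtain t s where v: "v = q (x + t *\<^sub>R s) - t * d" "0 \<le> t" "s \<in> S"
          unfolding V_def by blast
        have "q' (r *\<^sub>R x) \<le> q (r *\<^sub>R x + (r * t) *\<^sub>R s) - (r * t) * d"
          using v r by (intro le VI) auto
        also have "\<dots> = r * v"
          unfolding v(1) using r sublinear_scale[OF q, of r "x + t *\<^sub>R s"] by (simp add: algebra_simps)
        finally show "inverse r * q' (r *\<^sub>R x) \<le> v" using r by (simp add: field_simps)
      qed
      then show ?thesis using r by (simp add: field_simps)
    qed
  qed
  moreover have "q' y \<le> q y" for y by (rule le[OF q_in])
  moreover have "q' (- s) \<le> - d" if "s \<in> S" for s
    using le[OF VI[of 1 s "- s"]] that by (simp add: sublinear_zero[OF q])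
  ultimately show ?thesis by (rule that)
qed

text \<open>Lowering \<open>q\<close> along \<open>x\<close> cannot change a minimal \<open>q\<close>, which forces \<open>q (- x) = - q x\<close>.\<close>

lemma minimal_sublinear_linear:
  fixes q :: "'v::real_vector \<Rightarrow> real"
  assumes q: "sublinear q" and min: "\<And>q'. sublinear q' \<Longrightarrow> (\<And>y. q' y \<le> q y) \<Longrightarrow> q' = q"
  shows "linear q"
proof -
  have neg: "q (- x) = - q x" for x
  proof -
    obtain q' where q': "sublinear q'" "\<And>y. q' y \<le> q y" "\<And>s. s \<in> {x} \<Longrightarrow> q' (- s) \<le> - q x"
      using sublinear_lowering[OF q, of "{x}" "q x"] by auto
    then have "q (- x) \<le> - q x" using min by auto
    then show ?thesis using sublinear_minus[OF q, of x] by simp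
  qed
  have "q (x + y) = q x + q y" for x y
    using sublinear_add[OF q, of x y] sublinear_add[OF q, of "- x" "- y"] neg[of x] neg[of y] neg[of "x + y"]
    by simp
  moreover have "q (r *\<^sub>R x) = r * q x" for r x
    using sublinear_scale[OF q, of r x] sublinear_scale[OF q, of "- r" x] neg[of "r *\<^sub>R x"]
    by (cases "0 \<le> r") auto
  ultimately show ?thesis by (intro linearI) auto
qed

lemma sublinear_chain_Inf:
  fixes q :: "'v::real_vector \<Rightarrow> real"
  assumes sub: "\<And>p. p \<in> C \<Longrightarrow> sublinear p" and bound: "\<And>p y. p \<in> C \<Longrightarrow> p y \<le> q y"
    and ne: "C \<noteq> {}" and chain: "\<And>p p'. p \<in> C \<Longrightarrow> p' \<in> C \<Longrightarrow> p \<le> p' \<or> p' \<le> p"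
  obtains u where "sublinear u" "\<And>p y. p \<in> C \<Longrightarrow> u y \<le> p y"
proof -
  define u where "u y = (INF p\<in>C. p y)" for y
  have bdd: "bdd_below ((\<lambda>p. p y) ` C)" for y
    using bound[of _ "- y"] sublinear_minus[OF sub, of _ y]
    by (intro bdd_belowI[of _ "- q (- y)"]) force
  have le: "u y \<le> p y" if "p \<in> C" for p y
    unfolding u_def using bdd that by (rule cINF_lower)
  have ge: "c \<le> u y" if "\<And>p. p \<in> C \<Longrightarrow> c \<le> p y" for c y
    unfolding u_def using ne that by (rule cINF_greatest)
  have "sublinear u"
  proof (rule sublinearI_pos)
    show "u (x + y) \<le> u x + u y" for x y
    proof -
      have *: "u (x + y) \<le> p x + p' y" if p: "p \<in> C" and p': "p' \<in> C" for p p'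
        using chain[OF p p']
      proof
        assume "p \<le> p'"
        then have "p y \<le> p' y" by (simp add: le_fun_def)
        then show ?thesis
          using le[OF p, of "x + y"] sublinear_add[OF sub[OF p], of x y] by linarith
      next
        assume "p' \<le> p"
        then have "p' x \<le> p x" by (simp add: le_fun_def)
        then show ?thesis
          using le[OF p', of "x + y"] sublinear_add[OF sub[OF p'], of x y] by linarith
      qed
      have "u (x + y) - p' y \<le> u x" if "p' \<in> C" for p'
        using *[OF _ that] by (intro ge) (simp add: algebra_simps)
      then have "u (x + y) - u x \<le> u y"
        by (intro ge) (simp add: algebra_simps)
      then show ?thesis by simp
    qed
    obtain p0 where p0: "p0 \<in> C" using ne by auto
    show "u 0 = 0"
      using le[OF p0, of 0] ge[of 0 0] sublinear_zero[OF sub] p0 by fastforce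
    show "u (r *\<^sub>R x) \<le> r * u x" if r: "0 < r" for r x
    proof -
      have "inverse r * u (r *\<^sub>R x) \<le> u x"
      proof (rule ge)
        fix p assume p: "p \<in> C"
        show "inverse r * u (r *\<^sub>R x) \<le> p x"
          using le[OF p, of "r *\<^sub>R x"] sublinear_scale[OF sub[OF p], of r x] r
          by (simp add: field_simps)
      qed
      then show ?thesis using r by (simp add: field_simps)
    qed
  qed
  then show ?thesis using le that by blast
qed

text \<open>The set \<open>S\<close> allows a convex hull to be separated from the origin; with a singleton \<open>S\<close> the
  result is the usual extension theorem.\<close>

theorem hahn_banach_convex:
  fixes q :: "'v::real_vector \<Rightarrow> real"
  assumes q: "sublinear q" and S: "convex S" "S \<noteq> {}" and d: "\<And>s. s \<in> S \<Longrightarrow> d \<le> q s"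
  obtains \<phi> where "linear \<phi>" "\<And>y. \<phi> y \<le> q y" "\<And>s. s \<in> S \<Longrightarrow> d \<le> \<phi> s"
proof -
  obtain q' where q': "sublinear q'" "\<And>y. q' y \<le> q y" "\<And>s. s \<in> S \<Longrightarrow> q' (- s) \<le> - d"
    using sublinear_lowering[OF q S d] by metis
  define A where "A = {p. sublinear p \<and> (\<forall>y. p y \<le> q' y)}"
  have "\<exists>m\<in>A. \<forall>a\<in>A. a \<le> m \<longrightarrow> a = m"
  proof (rule predicate_Zorn)
    show "partial_order_on A (relation_of (\<lambda>x y. y \<le> x) A)"
      by (rule partial_order_on_relation_ofI) auto
    fix C assume C: "C \<in> Chains (relation_of (\<lambda>x y. y \<le> x) A)"
    then have CA: "C \<subseteq> A" and ch: "\<And>p p'. p \<in> C \<Longrightarrow> p' \<in> C \<Longrightarrow> p \<le> p' \<or> p' \<le> p"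
      by (auto simp: Chains_def relation_of_def)
    show "\<exists>u\<in>A. \<forall>a\<in>C. u \<le> a"
    proof (cases "C = {}")
      case True
      then show ?thesis using q' by (auto simp: A_def)
    next
      case False
      then obtain p0 where p0: "p0 \<in> C" by auto
      have "\<And>p. p \<in> C \<Longrightarrow> sublinear p" "\<And>p y. p \<in> C \<Longrightarrow> p y \<le> q' y"
        using CA by (auto simp: A_def)
      then obtain u where u: "sublinear u" "\<And>p y. p \<in> C \<Longrightarrow> u y \<le> p y"
        using sublinear_chain_Inf[of C q', OF _ _ False ch] by metis
      have "u y \<le> q' y" for y
        using u(2)[OF p0, of y] \<open>\<And>p y. p \<in> C \<Longrightarrow> p y \<le> q' y\<close>[OF p0, of y] by linarith
      then show ?thesis using u by (intro bexI[of _ u]) (auto simp: A_def le_fun_def)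
    qed
  qed
  then obtain m where m: "m \<in> A" "\<And>a. a \<in> A \<Longrightarrow> a \<le> m \<Longrightarrow> a = m" by blast
  have "linear m"
  proof (rule minimal_sublinear_linear)
    show "sublinear m" using m by (simp add: A_def)
    fix p assume "sublinear p" "\<And>y. p y \<le> m y"
    then show "p = m"
      using m by (intro m(2)) (auto simp: A_def le_fun_def intro: order_trans)
  qed
  moreover have "m y \<le> q y" for y
    using m(1) q'(2)[of y] unfolding A_def by (auto intro: order_trans)
  moreover have "d \<le> m s" if "s \<in> S" for s
  proof -
    have "m (- s) \<le> - d" using m(1) q'(3)[OF that] unfolding A_def by (auto intro: order_trans)
    then show ?thesis using linear_neg[OF \<open>linear m\<close>] by auto
  qed
  ultimately show ?thesis by (rule that)
qed

lemma sublinear_norm: "sublinear (norm :: 'v::real_normed_vector \<Rightarrow> real)"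
  by (auto simp: sublinear_def norm_triangle_ineq)

lemma linear_le_norm_blinfun:
  fixes \<phi> :: "'v::real_normed_vector \<Rightarrow> real"
  assumes lin: "linear \<phi>" and le: "\<And>y. \<phi> y \<le> norm y"
  obtains f :: "'v \<Rightarrow>\<^sub>L real" where "blinfun_apply f = \<phi>" "norm f \<le> 1"
proof -
  have abs: "\<bar>\<phi> y\<bar> \<le> norm y" for y
    using le[of y] le[of "- y"] linear_neg[OF lin, of y] by simp
  have bl: "bounded_linear \<phi>"
    using lin abs by (intro bounded_linear_intro[where K = 1]) (auto simp: linear_add linear_scale)
  have "norm (Blinfun \<phi>) \<le> 1"
    using abs bl by (intro norm_blinfun_bound) (auto simp: bounded_linear_Blinfun_apply)
  then show ?thesis using that bl bounded_linear_Blinfun_apply by metis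
qed

lemma norming_functional:
  fixes x :: "'v::real_normed_vector"
  obtains f :: "'v \<Rightarrow>\<^sub>L real" where "norm f \<le> 1" "blinfun_apply f x = norm x"
proof -
  obtain \<phi> where \<phi>: "linear \<phi>" "\<And>y. \<phi> y \<le> norm y" "norm x \<le> \<phi> x"
    using hahn_banach_convex[OF sublinear_norm, of "{x}" "norm x"] by auto
  obtain f :: "'v \<Rightarrow>\<^sub>L real" where "blinfun_apply f = \<phi>" "norm f \<le> 1"
    using linear_le_norm_blinfun[OF \<phi>(1,2)] by metis
  then show ?thesis using that[of f] \<phi>(2)[of x] \<phi>(3) by simp
qed

text \<open>Mazur's theorem: if the convex hull stayed away from the origin, a functional would be bounded
  below by a positive constant along the sequence.\<close>

lemma weakly_null_small_convex_combination:
  fixes f :: "nat \<Rightarrow> 'v::real_normed_vector"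
  assumes wn: "weakly_null f" and "0 < \<epsilon>"
  obtains s where "s \<in> convex hull (range f)" "norm s < \<epsilon>"
proof (rule ccontr)
  assume "\<not> thesis"
  then have "\<And>s. s \<in> convex hull (range f) \<Longrightarrow> \<epsilon> \<le> norm s" using that by force
  then obtain \<phi> where \<phi>: "linear \<phi>" "\<And>y. \<phi> y \<le> norm y" "\<And>s. s \<in> convex hull (range f) \<Longrightarrow> \<epsilon> \<le> \<phi> s"
    using hahn_banach_convex[OF sublinear_norm, of "convex hull (range f)" \<epsilon>] by auto
  obtain F :: "'v \<Rightarrow>\<^sub>L real" where F: "blinfun_apply F = \<phi>"
    using linear_le_norm_blinfun[OF \<phi>(1,2)] by metis
  have "(\<lambda>n. \<phi> (f n)) \<longlonglongrightarrow> 0" using wn F by (auto simp: weakly_null_def)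
  moreover have "\<epsilon> \<le> \<phi> (f n)" for n by (intro \<phi>(3) hull_inc) simp
  ultimately have "\<epsilon> \<le> 0" by (intro LIMSEQ_le_const) auto
  then show False using \<open>0 < \<epsilon>\<close> by simp
qed

section \<open>Uniform boundedness\<close>

text \<open>The weak subadditivity in \<open>quasi\<close> holds for \<open>\<bar>\<cdot>\<bar>\<close> with \<open>K = 1\<close> and for its \<open>p\<close>-th power
  with \<open>K = 2\<^sup>p\<close>; it transports a bound on some ball to a ball around the origin.\<close>

lemma uniform_boundedness:
  fixes q :: "'i \<Rightarrow> 'v::banach \<Rightarrow> real"
  assumes cont: "\<And>i. i \<in> I \<Longrightarrow> continuous_on UNIV (q i)"
    and quasi: "\<And>i x y. i \<in> I \<Longrightarrow> q i (x - y) \<le> K * (q i x + q i y)" and "0 \<le> K"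
    and pt: "\<And>x. \<exists>M. \<forall>i\<in>I. q i x \<le> M"
  obtains r M where "0 < r" "\<And>i z. i \<in> I \<Longrightarrow> norm z \<le> r \<Longrightarrow> q i z \<le> M"
proof -
  define B where "B m = (\<Inter>i\<in>I. {x. q i x \<le> real m})" for m :: nat
  have closed: "closed (B m)" for m
    unfolding B_def using cont by (intro closed_INT ballI closed_Collect_le) auto
  have "(\<Union>m. B m) = UNIV"
  proof (rule set_eqI, simp)
    fix x
    obtain M where M: "\<And>i. i \<in> I \<Longrightarrow> q i x \<le> M" using pt by blast
    obtain m :: nat where "M \<le> real m" using real_arch_simple by blast
    then show "\<exists>m. x \<in> B m" using M by (intro exI[of _ m]) (auto simp: B_def intro: order_trans)
  qed
  \<comment> \<open>Baire's theorem: countably many closed sets with empty interior do not cover the space.\<close>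
  have "\<exists>m. interior (B m) \<noteq> {}"
  proof (rule ccontr)
    assume "\<not> ?thesis"
    then have "(euclidean :: 'v topology) interior_of \<Union>(range B) = {}"
      using closed by (intro Baire_category_alt) (auto simp: completely_metrizable_space_euclidean)
    then show False using \<open>(\<Union>m. B m) = UNIV\<close> by simp
  qed
  then obtain m x0 e where e: "0 < e" "ball x0 e \<subseteq> B m"
    by (metis all_not_in_conv mem_interior)
  have "q i z \<le> K * (real m + real m)" if i: "i \<in> I" and z: "norm z \<le> e / 2" for i z
  proof -
    have "x0 + z \<in> B m" "x0 \<in> B m" using z e by (auto simp: dist_norm intro!: subsetD[OF e(2)])
    then have "q i (x0 + z) \<le> real m" "q i x0 \<le> real m" using i by (auto simp: B_def)
    then have "K * (q i (x0 + z) + q i x0) \<le> K * (real m + real m)"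
      using \<open>0 \<le> K\<close> by (intro mult_left_mono add_mono) auto
    then show ?thesis using quasi[OF i, of "x0 + z" x0] by simp
  qed
  then show ?thesis using that[of "e / 2"] e by auto
qed

text \<open>The elements of \<open>A\<close> act on the dual, which is complete, by evaluation.\<close>

lemma weakly_bounded_imp_bounded:
  fixes A :: "'v::real_normed_vector set"
  assumes "\<And>f :: 'v \<Rightarrow>\<^sub>L real. \<exists>M. \<forall>x\<in>A. \<bar>blinfun_apply f x\<bar> \<le> M"
  shows "bounded A"
proof -
  obtain r M where r: "0 < r"
    and M: "\<And>x f. x \<in> A \<Longrightarrow> norm (f :: 'v \<Rightarrow>\<^sub>L real) \<le> r \<Longrightarrow> \<bar>blinfun_apply f x\<bar> \<le> M"
  proof (rule uniform_boundedness[where I = A and K = 1 and q = "\<lambda>x f. \<bar>blinfun_apply f x\<bar>"])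
    show "continuous_on UNIV (\<lambda>f :: 'v \<Rightarrow>\<^sub>L real. \<bar>blinfun_apply f x\<bar>)" for x
      by (intro continuous_intros)
    show "\<bar>blinfun_apply (f - g) x\<bar> \<le> 1 * (\<bar>blinfun_apply f x\<bar> + \<bar>blinfun_apply g x\<bar>)" for x and f g :: "'v \<Rightarrow>\<^sub>L real"
      by (simp add: blinfun.diff_left abs_triangle_ineq4)
  qed (use assms in auto)
  have "norm x \<le> M / r" if "x \<in> A" for x
  proof -
    obtain f :: "'v \<Rightarrow>\<^sub>L real" where f: "norm f \<le> 1" "blinfun_apply f x = norm x"
      by (rule norming_functional)
    have "\<bar>blinfun_apply (r *\<^sub>R f) x\<bar> \<le> M" using f r by (intro M that) (simp add: mult_left_le)
    then show ?thesis using r f by (simp add: blinfun.scaleR_left field_simps)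
  qed
  then show ?thesis by (auto simp: bounded_iff)
qed

section \<open>Banach lattices\<close>

lemma norm_abs_lattice [simp]: "norm \<bar>x\<bar> = norm (x::'a::banach_lattice)"
  by (intro antisym lattice_norm) auto

lemma norm_le_of_abs_le: "\<bar>x\<bar> \<le> y \<Longrightarrow> norm x \<le> norm (y::'a::banach_lattice)"
  by (rule lattice_norm) (meson abs_ge_self order_trans)

lemma norm_mono_nonneg: "0 \<le> x \<Longrightarrow> x \<le> y \<Longrightarrow> norm x \<le> norm (y::'a::banach_lattice)"
  by (rule norm_le_of_abs_le) simp

lemma sup_minus_inf: "sup x y - inf x y = \<bar>x - (y::'a::banach_lattice)\<bar>"
proof -
  have "\<bar>x - y\<bar> = sup (x - y) (y - x)" by (simp add: abs_lattice)
  also have "\<dots> = sup x y - inf x y"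
  proof (rule antisym)
    have "x - y \<le> sup x y - inf x y" "y - x \<le> sup x y - inf x y"
      by (intro diff_mono; simp)+
    then show "sup (x - y) (y - x) \<le> sup x y - inf x y" by simp
    define d where "d = sup (x - y) (y - x)"
    have "0 \<le> d" using abs_ge_zero[of "x - y"] by (simp add: d_def abs_lattice)
    moreover have "x \<le> y + d" "y \<le> x + d"
      by (simp_all add: d_def diff_le_eq[symmetric] add.commute[of _ "sup _ _"])
    ultimately have "sup x y \<le> inf (x + d) (y + d)" by simp
    then have "sup x y \<le> inf x y + sup (x - y) (y - x)"
      by (simp add: d_def add_inf_distrib_right)
    then show "sup x y - inf x y \<le> sup (x - y) (y - x)"
      by (simp only: diff_le_eq add.commute)
  qed
  finally show ?thesis by simp
qed

lemma inf_eq_abs: "inf x y = (1/2) *\<^sub>R (x + y - \<bar>x - (y::'a::banach_lattice)\<bar>)"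
proof -
  have "x + y - \<bar>x - y\<bar> = 2 *\<^sub>R inf x y"
    unfolding sup_minus_inf[symmetric] add_eq_inf_sup[of x y] by (simp add: scaleR_2)
  then show ?thesis by simp
qed

lemma tendsto_abs_lattice:
  assumes "(f \<longlongrightarrow> (l::'a::banach_lattice)) F"
  shows "((\<lambda>n. \<bar>f n\<bar>) \<longlongrightarrow> \<bar>l\<bar>) F"
proof -
  have "((\<lambda>n. norm (f n - l)) \<longlongrightarrow> 0) F" using assms by (simp add: LIM_zero tendsto_norm_zero)
  moreover have "norm (\<bar>f n\<bar> - \<bar>l\<bar>) \<le> norm (f n - l)" for n
    by (intro lattice_norm abs_triangle_ineq3)
  ultimately have "((\<lambda>n. \<bar>f n\<bar> - \<bar>l\<bar>) \<longlongrightarrow> 0) F"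
    by (rule Lim_null_comparison[OF always_eventually, OF allI, rotated])
  then show ?thesis by (rule LIM_zero_cancel)
qed

lemma tendsto_inf_lattice:
  assumes "(f \<longlongrightarrow> (l::'a::banach_lattice)) F" "(g \<longlongrightarrow> m) F"
  shows "((\<lambda>n. inf (f n) (g n)) \<longlongrightarrow> inf l m) F"
  unfolding inf_eq_abs by (intro tendsto_intros tendsto_abs_lattice assms)

text \<open>The positive cone is the fixed point set of the continuous map \<open>x \<mapsto> \<bar>x\<bar>\<close>.\<close>

lemma closed_nonneg: "closed {x::'a::banach_lattice. 0 \<le> x}"
proof -
  have "continuous_on UNIV (\<lambda>x::'a. \<bar>x\<bar>)"
    unfolding continuous_on by (auto intro!: tendsto_abs_lattice tendsto_ident_at)
  then have "closed {x::'a. \<bar>x\<bar> = x}"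
    by (intro closed_Collect_eq continuous_on_id)
  moreover have "{x::'a. \<bar>x\<bar> = x} = {x. 0 \<le> x}"
    by (metis abs_ge_zero abs_of_nonneg)
  ultimately show ?thesis by simp
qed

lemma limit_le_lattice:
  fixes l m :: "'a::banach_lattice"
  assumes "f \<longlonglongrightarrow> l" "g \<longlonglongrightarrow> m" "\<forall>\<^sub>F n in sequentially. f n \<le> g n"
  shows "l \<le> m"
proof -
  have "m - l \<in> {x. 0 \<le> x}"
    using assms by (intro Lim_in_closed_set[OF closed_nonneg _ _ tendsto_diff[OF assms(2,1)]]) auto
  then show ?thesis by simp
qed

lemma closed_order_interval: "closed {a..b::'a::banach_lattice}"
proof -
  have "{a..b} = (\<lambda>x. x - a) -` {x. 0 \<le> x} \<inter> (\<lambda>x. b - x) -` {x. 0 \<le> x}"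
    by auto
  also have "closed \<dots>"
    by (intro closed_Int closed_vimage closed_nonneg continuous_intros)
  finally show ?thesis .
qed

lemma abs_scaleR_lattice: "\<bar>r *\<^sub>R x\<bar> = \<bar>r\<bar> *\<^sub>R \<bar>x::'a::banach_lattice\<bar>"
proof -
  have pos: "\<bar>r *\<^sub>R x\<bar> \<le> r *\<^sub>R \<bar>x\<bar>" if "0 \<le> r" for r and x :: 'a
  proof (rule abs_leI)
    show "r *\<^sub>R x \<le> r *\<^sub>R \<bar>x\<bar>" using that by (intro scaleR_left_mono abs_ge_self)
    show "- (r *\<^sub>R x) \<le> r *\<^sub>R \<bar>x\<bar>"
      using scaleR_left_mono[OF abs_ge_minus_self that, of x] by simp
  qed
  have eq: "\<bar>r *\<^sub>R x\<bar> = r *\<^sub>R \<bar>x\<bar>" if r: "0 < r" for r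
  proof (rule antisym)
    show "\<bar>r *\<^sub>R x\<bar> \<le> r *\<^sub>R \<bar>x\<bar>" using pos r by simp
    have "\<bar>x\<bar> \<le> inverse r *\<^sub>R \<bar>r *\<^sub>R x\<bar>" using pos[of "inverse r" "r *\<^sub>R x"] r by simp
    then show "r *\<^sub>R \<bar>x\<bar> \<le> \<bar>r *\<^sub>R x\<bar>" using r scaleR_left_mono[of "\<bar>x\<bar>" "inverse r *\<^sub>R \<bar>r *\<^sub>R x\<bar>" r] by simp
  qed
  consider "r = 0" | "0 < r" | "0 < - r" by linarith
  then show ?thesis
  proof cases
    case 3
    then show ?thesis using eq[of "- r"] by simp
  qed (use eq in auto)
qed

lemma inf_scaleR: "0 \<le> r \<Longrightarrow> inf (r *\<^sub>R x) (r *\<^sub>R y) = r *\<^sub>R inf x (y::'a::banach_lattice)"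
  unfolding inf_eq_abs scaleR_diff_right[symmetric] abs_scaleR_lattice
  by (simp add: scaleR_right_diff_distrib scaleR_right_distrib)

lemma riesz_decomposition:
  fixes x y z :: "'a::banach_lattice"
  assumes "0 \<le> x" "0 \<le> y" "0 \<le> z" "z \<le> x + y"
  obtains u v where "0 \<le> u" "u \<le> x" "0 \<le> v" "v \<le> y" "z = u + v"
proof
  show "0 \<le> inf z x" "inf z x \<le> x" using assms by auto
  show "0 \<le> z - inf z x" by (simp only: diff_ge_0_iff_ge inf_le1)
  show "z = inf z x + (z - inf z x)" by (simp only: add_diff_eq add_diff_cancel_left')
  have "z - inf z x = sup 0 (z - x)" by (simp add: diff_inf_eq_sup add_sup_distrib_left)
  also have "\<dots> \<le> y" using assms by (simp add: algebra_simps)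
  finally show "z - inf z x \<le> y" .
qed

lemma inf_mono_zero:
  fixes a b :: "'a::banach_lattice"
  assumes "inf a b = 0" "0 \<le> c" "c \<le> a" "0 \<le> d" "d \<le> b"
  shows "inf c d = 0"
  using assms inf_mono[of c a d b] by (intro antisym) auto

lemma inf_sum_le:
  fixes a b c :: "'a::banach_lattice"
  assumes "0 \<le> a" "0 \<le> b" "0 \<le> c"
  shows "inf a (b + c) \<le> inf a b + inf a c"
proof -
  obtain u v where uv: "0 \<le> u" "u \<le> b" "0 \<le> v" "v \<le> c" "inf a (b + c) = u + v"
    using assms riesz_decomposition[of b c "inf a (b + c)"] by auto
  have "u + v \<le> a" using uv(5) by (metis inf_le1)
  moreover have "u \<le> u + v" "v \<le> u + v" using uv by auto
  ultimately have "u \<le> a" "v \<le> a" by (blast intro: order_trans)+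
  then show ?thesis unfolding uv(5) using uv by (intro add_mono) auto
qed

lemma inf_add_zero:
  fixes a b c :: "'a::banach_lattice"
  assumes "inf a b = 0" "inf a c = 0" "0 \<le> b" "0 \<le> c"
  shows "inf a (b + c) = 0"
proof -
  have "0 \<le> a" using assms(1) by (metis inf_le1)
  then show ?thesis using inf_sum_le[of a b c] assms by (intro antisym) auto
qed

text \<open>Disjointness gives \<open>\<bar>s\<bar> + \<bar>t\<bar> = \<bar>\<bar>s\<bar> - \<bar>t\<bar>\<bar>\<close>, which is at most \<open>\<bar>s + t\<bar>\<close>.\<close>

lemma abs_add_disjoint:
  fixes s t :: "'a::banach_lattice"
  assumes "inf \<bar>s\<bar> \<bar>t\<bar> = 0"
  shows "\<bar>s + t\<bar> = \<bar>s\<bar> + \<bar>t\<bar>"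
proof (rule antisym)
  show "\<bar>s + t\<bar> \<le> \<bar>s\<bar> + \<bar>t\<bar>" by (rule abs_triangle_ineq)
  have "\<bar>s\<bar> + \<bar>t\<bar> = sup \<bar>s\<bar> \<bar>t\<bar> - inf \<bar>s\<bar> \<bar>t\<bar>"
    unfolding assms add_eq_inf_sup[of "\<bar>s\<bar>"] by simp
  also have "\<dots> = \<bar>\<bar>s\<bar> - \<bar>- t\<bar>\<bar>" by (simp only: sup_minus_inf abs_minus_cancel)
  also have "\<dots> \<le> \<bar>s + t\<bar>" using abs_triangle_ineq3[of s "- t"] by simp
  finally show "\<bar>s\<bar> + \<bar>t\<bar> \<le> \<bar>s + t\<bar>" .
qed

lemma incseq_convergent_subseq:
  fixes x :: "nat \<Rightarrow> 'a::banach_lattice"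
  assumes inc: "incseq x" and r: "strict_mono r" and lim: "(x \<circ> r) \<longlonglongrightarrow> l"
  shows "x \<longlonglongrightarrow> l" "x n \<le> l"
proof -
  have le: "x n \<le> l" for n
  proof (rule limit_le_lattice[OF tendsto_const lim])
    have "x n \<le> (x \<circ> r) m" if "n \<le> m" for m
      using inc seq_suble[OF r, of m] that by (auto simp: incseq_def)
    then show "\<forall>\<^sub>F m in sequentially. x n \<le> (x \<circ> r) m"
      by (auto simp: eventually_sequentially)
  qed
  then show "x n \<le> l" .
  show "x \<longlonglongrightarrow> l"
  proof (rule LIMSEQ_I)
    fix e :: real assume "0 < e"
    then obtain k where k: "norm ((x \<circ> r) k - l) < e" using LIMSEQ_D[OF lim] by blast
    have "norm (x n - l) < e" if "r k \<le> n" for n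
    proof -
      have "norm (l - x n) \<le> norm (l - x (r k))"
        using le inc that by (intro norm_mono_nonneg) (auto simp: incseq_def)
      then show ?thesis using k by (simp add: norm_minus_commute)
    qed
    then show "\<exists>no. \<forall>n\<ge>no. norm (x n - l) < e" by blast
  qed
qed

section \<open>The dual of a Banach lattice\<close>

text \<open>Kantorovich's extension: \<open>f (u - v) = s u - s v\<close> does not depend on the representation of a vector
  as a difference of positive elements.\<close>

lemma positive_additive_extension:
  fixes s :: "'a::banach_lattice \<Rightarrow> real"
  assumes add: "\<And>x y. 0 \<le> x \<Longrightarrow> 0 \<le> y \<Longrightarrow> s (x + y) = s x + s y"
    and scale: "\<And>r x. 0 \<le> r \<Longrightarrow> 0 \<le> x \<Longrightarrow> s (r *\<^sub>R x) = r * s x"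
    and bounds: "\<And>x. 0 \<le> x \<Longrightarrow> 0 \<le> s x" "\<And>x. 0 \<le> x \<Longrightarrow> s x \<le> K * norm x"
    and "0 \<le> K"
  obtains f :: "'a \<Rightarrow>\<^sub>L real" where "\<And>x. 0 \<le> x \<Longrightarrow> blinfun_apply f x = s x"
proof -
  define F where "F x = s (pprt x) - s (- nprt x)" for x
  have diff: "F (u - v) = s u - s v" if "0 \<le> u" "0 \<le> v" for u v
  proof -
    have "pprt (u - v) + v = u + (- nprt (u - v))"
      using prts[of "u - v"] by (simp add: algebra_simps)
    then have "s (pprt (u - v)) + s v = s u + s (- nprt (u - v))"
      using add[of "pprt (u - v)" v] add[of u "- nprt (u - v)"] that by simp
    then show ?thesis by (simp add: F_def)
  qed
  have dec: "x = pprt x - (- nprt x)" "0 \<le> pprt x" "0 \<le> - nprt x" for x :: 'a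
    using prts[of x] by auto
  have F_add: "F (x + y) = F x + F y" for x y
  proof -
    have "x + y = (pprt x + pprt y) - (- nprt x + - nprt y)"
      by (subst dec(1)[of x], subst dec(1)[of y]) (simp add: algebra_simps)
    moreover have "F \<dots> = s (pprt x + pprt y) - s (- nprt x + - nprt y)"
      by (intro diff add_nonneg_nonneg dec)
    moreover have "\<dots> = F x + F y"
      unfolding F_def add[OF dec(2) dec(2)] add[OF dec(3) dec(3)] by simp
    ultimately show ?thesis by simp
  qed
  have F_pos: "F (r *\<^sub>R x) = r * F x" if r: "0 \<le> r" for r x
  proof -
    have "r *\<^sub>R x = r *\<^sub>R pprt x - r *\<^sub>R (- nprt x)"
      using dec(1)[of x] by (metis scaleR_diff_right)
    then have "F (r *\<^sub>R x) = s (r *\<^sub>R pprt x) - s (r *\<^sub>R (- nprt x))"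
      using diff[of "r *\<^sub>R pprt x" "r *\<^sub>R (- nprt x)"] dec(2,3)[of x] r
      by (simp add: scaleR_nonneg_nonneg del: neg_0_le_iff_le scaleR_minus_right)
    then show ?thesis using scale[OF r dec(2)[of x]] scale[OF r dec(3)[of x]]
      by (simp add: F_def algebra_simps)
  qed
  have F_neg: "F (- x) = - F x" for x
    using F_add[of x "- x"] diff[of 0 0] by simp
  have F_scale: "F (r *\<^sub>R x) = r * F x" for r x
    using F_pos[of r x] F_pos[of "- r" x] F_neg[of "r *\<^sub>R x"] by (cases "0 \<le> r") auto
  have F_bound: "\<bar>F x\<bar> \<le> norm x * K" for x
  proof -
    have "norm (pprt x) \<le> norm x" "norm (- nprt x) \<le> norm x"
      using dec[of x] by (auto intro!: norm_le_of_abs_le[of _ "\<bar>x\<bar>", simplified] simp: abs_prts)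
    then have "K * norm (pprt x) \<le> K * norm x" "K * norm (- nprt x) \<le> K * norm x"
      using \<open>0 \<le> K\<close> by (auto intro: mult_left_mono)
    then have "s (pprt x) \<le> norm x * K" "s (- nprt x) \<le> norm x * K" "0 \<le> s (pprt x)" "0 \<le> s (- nprt x)"
      using bounds(2)[OF dec(2)[of x]] bounds(2)[OF dec(3)[of x]] bounds(1)[OF dec(2)[of x]] bounds(1)[OF dec(3)[of x]]
      by (auto simp: mult.commute)
    then show ?thesis unfolding F_def by linarith
  qed
  have bl: "bounded_linear F"
    using F_add F_scale F_bound by (intro bounded_linear_intro[where K = K]) auto
  show ?thesis
  proof
    fix x :: 'a assume "0 \<le> x"
    then show "blinfun_apply (Blinfun F) x = s x"
      using diff[of x 0] diff[of 0 0] by (simp add: bounded_linear_Blinfun_apply[OF bl] diff[of x 0, simplified] F_def)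
        (use add[of 0 0] in simp)
  qed
qed

text \<open>The Riesz--Kantorovich formula \<open>f\<^sup>+ x = sup f [0, x]\<close>. Additivity of the supremum is the Riesz
  decomposition property.\<close>

lemma dual_positive_part:
  fixes f :: "'a::banach_lattice \<Rightarrow>\<^sub>L real"
  obtains u where "dual_le 0 u" "dual_le f u"
    "\<And>x e. 0 \<le> x \<Longrightarrow> 0 < e \<Longrightarrow> \<exists>z. 0 \<le> z \<and> z \<le> x \<and> blinfun_apply u x - e < blinfun_apply f z"
proof -
  define s where "s x = (SUP z\<in>{0..x}. blinfun_apply f z)" for x
  have bound: "blinfun_apply f z \<le> norm f * norm x" if "0 \<le> z" "z \<le> x" for x z
  proof -
    have "blinfun_apply f z \<le> norm f * norm z" using norm_blinfun[of f z] by simp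
    also have "\<dots> \<le> norm f * norm x"
      using that by (intro mult_left_mono norm_mono_nonneg) auto
    finally show ?thesis .
  qed
  have bdd: "bdd_above (blinfun_apply f ` {0..x})" for x
    using bound by (intro bdd_aboveI[of _ "norm f * norm x"]) auto
  have le: "blinfun_apply f z \<le> s x" if "0 \<le> z" "z \<le> x" for x z
    unfolding s_def using bdd that by (intro cSUP_upper) auto
  have ge: "s x \<le> c" if "0 \<le> x" "\<And>z. 0 \<le> z \<Longrightarrow> z \<le> x \<Longrightarrow> blinfun_apply f z \<le> c" for x c
    unfolding s_def using that by (intro cSUP_least) auto
  have approx: "\<exists>z. 0 \<le> z \<and> z \<le> x \<and> s x - e < blinfun_apply f z" if "0 \<le> x" "0 < e" for x e
  proof (rule ccontr)
    assume "\<not> ?thesis"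
    then have "s x \<le> s x - e" using that by (intro ge) (auto simp: not_less)
    then show False using \<open>0 < e\<close> by simp
  qed
  have nonneg: "0 \<le> s x" if "0 \<le> x" for x using le[of 0 x] that by simp
  have scale_le: "s (r *\<^sub>R x) \<le> r * s x" if "0 < r" "0 \<le> x" for r x
  proof (rule ge)
    show "0 \<le> r *\<^sub>R x" using that by (simp add: scaleR_nonneg_nonneg)
    fix z assume z: "0 \<le> z" "z \<le> r *\<^sub>R x"
    have "blinfun_apply f (inverse r *\<^sub>R z) \<le> s x"
      using z that scaleR_left_mono[OF z(2), of "inverse r"] by (intro le) (auto simp: scaleR_nonneg_nonneg)
    then show "blinfun_apply f z \<le> r * s x" using that by (simp add: blinfun.scaleR_right field_simps)
  qed
  obtain u :: "'a \<Rightarrow>\<^sub>L real" where u: "\<And>x. 0 \<le> x \<Longrightarrow> blinfun_apply u x = s x"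
  proof (rule positive_additive_extension[of s "norm f"])
    show "s (x + y) = s x + s y" if x: "0 \<le> x" and y: "0 \<le> y" for x y
    proof (rule antisym)
      show "s (x + y) \<le> s x + s y"
      proof (rule ge)
        show "0 \<le> x + y" using x y by simp
        fix z assume "0 \<le> z" "z \<le> x + y"
        then obtain a b where "0 \<le> a" "a \<le> x" "0 \<le> b" "b \<le> y" "z = a + b"
          using riesz_decomposition[OF x y] by metis
        then show "blinfun_apply f z \<le> s x + s y"
          using le[of a x] le[of b y] by (simp add: blinfun.add_right)
      qed
      have "s x \<le> s (x + y) - s y"
      proof (rule ge[OF x])
        fix a assume a: "0 \<le> a" "a \<le> x"
        have "s y \<le> s (x + y) - blinfun_apply f a"
        proof (rule ge[OF y])
          fix b assume b: "0 \<le> b" "b \<le> y"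
          have "blinfun_apply f (a + b) \<le> s (x + y)"
            using a b by (intro le add_mono) auto
          then show "blinfun_apply f b \<le> s (x + y) - blinfun_apply f a"
            by (simp add: blinfun.add_right)
        qed
        then show "blinfun_apply f a \<le> s (x + y) - s y" by simp
      qed
      then show "s x + s y \<le> s (x + y)" by simp
    qed
    show "s (r *\<^sub>R x) = r * s x" if "0 \<le> r" "0 \<le> x" for r x
    proof (cases "r = 0")
      case True
      have "blinfun_apply f z \<le> 0" if "0 \<le> z" "z \<le> 0" for z
        using order.antisym[OF that(2,1)] by simp
      then have "s 0 \<le> 0" by (intro ge) simp_all
      then show ?thesis using nonneg[of 0] True by simp
    next
      case False
      then have r: "0 < r" using that by simp
      have "s (inverse r *\<^sub>R (r *\<^sub>R x)) \<le> inverse r * s (r *\<^sub>R x)"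
        using r that by (intro scale_le) (auto simp: scaleR_nonneg_nonneg)
      then have "r * s x \<le> s (r *\<^sub>R x)" using r by (simp add: field_simps)
      then show ?thesis using scale_le[OF r that(2)] by simp
    qed
    show "s x \<le> norm f * norm x" if "0 \<le> x" for x using that bound by (intro ge) auto
  qed (use nonneg in auto)
  show ?thesis
  proof
    show "dual_le 0 u" "dual_le f u" using u nonneg le by (auto simp: dual_le_def)
    show "\<exists>z. 0 \<le> z \<and> z \<le> x \<and> blinfun_apply u x - e < blinfun_apply f z"
      if "0 \<le> x" "0 < e" for x e
      using approx[OF that] u[OF that(1)] by simp
  qed
qed

lemma dual_le_antisym:
  fixes f g :: "'a::banach_lattice \<Rightarrow>\<^sub>L real"
  assumes "dual_le f g" "dual_le g f"
  shows "f = g"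
proof (rule blinfun_eqI)
  fix x :: 'a
  have eq: "blinfun_apply f y = blinfun_apply g y" if "0 \<le> y" for y
    using assms that by (force simp: dual_le_def)
  have "x = pprt x - (- nprt x)" using prts[of x] by simp
  then show "blinfun_apply f x = blinfun_apply g x"
    using eq[of "pprt x"] eq[of "- nprt x"] by (metis blinfun.diff_right neg_0_le_iff_le nprt_le_zero zero_le_pprt)
qed

definition dual_abs :: "('a::banach_lattice \<Rightarrow>\<^sub>L real) \<Rightarrow> ('a \<Rightarrow>\<^sub>L real)" where
  "dual_abs f = (THE u. dual_modulus f u)"

text \<open>The modulus is \<open>(2 f)\<^sup>+ - f\<close>, and the interval \<open>[0, x]\<close> over which the positive part is a
  supremum becomes \<open>[- x, x]\<close> under \<open>z \<mapsto> 2 z - x\<close>.\<close>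

lemma dual_modulus_exists:
  fixes f :: "'a::banach_lattice \<Rightarrow>\<^sub>L real"
  obtains u where "dual_modulus f u"
    "\<And>x e. 0 \<le> x \<Longrightarrow> 0 < e \<Longrightarrow> \<exists>y. \<bar>y\<bar> \<le> x \<and> blinfun_apply u x - e < blinfun_apply f y"
proof -
  obtain w where w: "dual_le 0 w" "dual_le (2 *\<^sub>R f) w" and
    w_approx: "\<And>x e. 0 \<le> x \<Longrightarrow> 0 < e \<Longrightarrow> \<exists>z. 0 \<le> z \<and> z \<le> x \<and> blinfun_apply w x - e < blinfun_apply (2 *\<^sub>R f) z"
    using dual_positive_part[of "2 *\<^sub>R f"] by metis
  define u where "u = w - f"
  have approx: "\<exists>y. \<bar>y\<bar> \<le> x \<and> blinfun_apply u x - e < blinfun_apply f y" if "0 \<le> x" "0 < e" for x e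
  proof -
    obtain z where z: "0 \<le> z" "z \<le> x" "blinfun_apply w x - e < blinfun_apply (2 *\<^sub>R f) z"
      using w_approx \<open>0 \<le> x\<close> \<open>0 < e\<close> by blast
    have "\<bar>2 *\<^sub>R z - x\<bar> \<le> x"
    proof (rule abs_leI)
      have "2 *\<^sub>R z \<le> 2 *\<^sub>R x" using z by (intro scaleR_left_mono) auto
      then show "2 *\<^sub>R z - x \<le> x" by (simp add: scaleR_2 algebra_simps)
      show "- (2 *\<^sub>R z - x) \<le> x" using z by (simp add: scaleR_nonneg_nonneg)
    qed
    moreover have "blinfun_apply u x - e < blinfun_apply f (2 *\<^sub>R z - x)"
      using z(3) by (simp add: u_def blinfun.diff_left blinfun.diff_right blinfun.scaleR_left blinfun.scaleR_right)
    ultimately show ?thesis by blast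
  qed
  have "dual_modulus f u"
    unfolding dual_modulus_def dual_sup_def
  proof (intro conjI allI impI)
    show "dual_le f u" "dual_le (- f) u"
      using w by (auto simp: u_def dual_le_def blinfun.diff_left blinfun.scaleR_left blinfun.minus_left) 
    fix h assume h: "dual_le f h \<and> dual_le (- f) h"
    have hf: "\<bar>blinfun_apply f y\<bar> \<le> blinfun_apply h y" if "0 \<le> y" for y
      using h that by (auto simp: dual_le_def blinfun.minus_left abs_le_iff)
    show "dual_le u h"
      unfolding dual_le_def
    proof (intro allI impI, rule field_le_epsilon)
      fix x :: 'a and e :: real assume x: "0 \<le> x" and "0 < e"
      then obtain y where y: "\<bar>y\<bar> \<le> x" "blinfun_apply u x - e < blinfun_apply f y"
        using approx by blast
      have "blinfun_apply f y = blinfun_apply f (pprt y) - blinfun_apply f (- nprt y)"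
        using prts[of y] by (metis blinfun.diff_right diff_minus_eq_add)
      also have "\<dots> \<le> blinfun_apply h (pprt y) + blinfun_apply h (- nprt y)"
        using hf[of "pprt y"] hf[of "- nprt y"] by simp
      also have "\<dots> = blinfun_apply h \<bar>y\<bar>" by (simp add: abs_prts blinfun.add_right[symmetric])
      also have "\<dots> \<le> blinfun_apply h \<bar>y\<bar> + blinfun_apply h (x - \<bar>y\<bar>)"
        using hf[of "x - \<bar>y\<bar>"] y by simp
      also have "\<dots> = blinfun_apply h x" by (simp add: blinfun.diff_right)
      finally show "blinfun_apply u x \<le> blinfun_apply h x + e" using y by simp
    qed
  qed
  then show ?thesis using approx that by blast
qed

lemma dual_modulus_unique: "dual_modulus f u \<Longrightarrow> dual_modulus f v \<Longrightarrow> u = v"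
  by (rule dual_le_antisym) (auto simp: dual_modulus_def dual_sup_def)

lemma dual_modulus_dual_abs: "dual_modulus f (dual_abs f)"
proof -
  obtain u where "dual_modulus f u" by (rule dual_modulus_exists)
  then show ?thesis unfolding dual_abs_def
    by (rule theI) (rule dual_modulus_unique[OF _ \<open>dual_modulus f u\<close>])
qed

lemma dual_abs_unique: "dual_modulus f u \<Longrightarrow> u = dual_abs f"
  by (rule dual_modulus_unique[OF _ dual_modulus_dual_abs])

lemma dual_abs_approx:
  assumes "0 \<le> x" "0 < e"
  obtains y where "\<bar>y\<bar> \<le> x" "blinfun_apply (dual_abs f) x - e < blinfun_apply f y"
proof -
  obtain u where "dual_modulus f u"
    and "\<And>x e. 0 \<le> x \<Longrightarrow> 0 < e \<Longrightarrow> \<exists>y. \<bar>y\<bar> \<le> x \<and> blinfun_apply u x - e < blinfun_apply f y"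
    using dual_modulus_exists[of f] by blast
  then show ?thesis using that assms dual_abs_unique by blast
qed

lemma dual_abs_ge: "0 \<le> x \<Longrightarrow> \<bar>blinfun_apply f x\<bar> \<le> blinfun_apply (dual_abs f) x"
  using dual_modulus_dual_abs[of f]
  by (auto simp: dual_modulus_def dual_sup_def dual_le_def blinfun.minus_left abs_le_iff)

lemma dual_abs_nonneg: "0 \<le> x \<Longrightarrow> 0 \<le> blinfun_apply (dual_abs f) x"
  using dual_abs_ge[of x f] by simp

lemma dual_abs_mono: "x \<le> y \<Longrightarrow> blinfun_apply (dual_abs f) x \<le> blinfun_apply (dual_abs f) y"
  using dual_abs_nonneg[of "y - x" f] by (simp add: blinfun.diff_right)

lemma abs_le_dual_abs:
  assumes "\<bar>y\<bar> \<le> x"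
  shows "\<bar>blinfun_apply f y\<bar> \<le> blinfun_apply (dual_abs f) x"
proof -
  have "blinfun_apply f y = blinfun_apply f (pprt y) - blinfun_apply f (- nprt y)"
    using prts[of y] by (metis blinfun.diff_right diff_minus_eq_add)
  then have "\<bar>blinfun_apply f y\<bar> \<le> blinfun_apply (dual_abs f) (pprt y) + blinfun_apply (dual_abs f) (- nprt y)"
    using dual_abs_ge[of "pprt y" f] dual_abs_ge[of "- nprt y" f] by simp
  also have "\<dots> = blinfun_apply (dual_abs f) \<bar>y\<bar>" by (simp add: abs_prts blinfun.add_right[symmetric])
  also have "\<dots> \<le> blinfun_apply (dual_abs f) x" by (rule dual_abs_mono[OF assms])
  finally show ?thesis .
qed

lemma dual_abs_le:
  assumes "0 \<le> x" "\<And>y. \<bar>y\<bar> \<le> x \<Longrightarrow> blinfun_apply f y \<le> c"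
  shows "blinfun_apply (dual_abs f) x \<le> c"
proof (rule field_le_epsilon)
  fix e :: real assume "0 < e"
  with \<open>0 \<le> x\<close> obtain y where "\<bar>y\<bar> \<le> x" "blinfun_apply (dual_abs f) x - e < blinfun_apply f y"
    by (rule dual_abs_approx)
  then show "blinfun_apply (dual_abs f) x \<le> c + e" using assms(2)[of y] by simp
qed

lemma dual_abs_scale_le:
  assumes "0 \<le> x"
  shows "blinfun_apply (dual_abs (c *\<^sub>R f)) x \<le> \<bar>c\<bar> * blinfun_apply (dual_abs f) x"
proof (rule dual_abs_le[OF assms])
  fix y assume "\<bar>y\<bar> \<le> x"
  then have "\<bar>c\<bar> * \<bar>blinfun_apply f y\<bar> \<le> \<bar>c\<bar> * blinfun_apply (dual_abs f) x"
    by (intro mult_left_mono abs_le_dual_abs) auto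
  then show "blinfun_apply (c *\<^sub>R f) y \<le> \<bar>c\<bar> * blinfun_apply (dual_abs f) x"
    using abs_ge_self[of "c * blinfun_apply f y"] by (simp add: blinfun.scaleR_left abs_mult)
qed

text \<open>Disjointness made local: on each \<open>x \<ge> 0\<close> the functional \<open>f\<close> nearly lives on a part \<open>z\<close>
  of \<open>x\<close> and \<open>g\<close> on the rest. This is the Riesz--Kantorovich formula for \<open>inf \<bar>f\<bar> \<bar>g\<bar> = 0\<close>,
  obtained from the one for the positive part of \<open>\<bar>f\<bar> - \<bar>g\<bar>\<close>.\<close>

lemma dual_disjoint_iff:
  "dual_disjoint f g \<longleftrightarrow> (\<forall>x e. 0 \<le> x \<longrightarrow> 0 < e \<longrightarrow>
     (\<exists>z. 0 \<le> z \<and> z \<le> x \<and> blinfun_apply (dual_abs f) (x - z) + blinfun_apply (dual_abs g) z < e))"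
    (is "?L \<longleftrightarrow> ?R")
proof
  assume ?L
  then have inf: "dual_inf (dual_abs f) (dual_abs g) 0"
    unfolding dual_disjoint_def using dual_abs_unique by blast
  obtain w where w: "dual_le 0 w" "dual_le (dual_abs f - dual_abs g) w" and
    w_approx: "\<And>x e. 0 \<le> x \<Longrightarrow> 0 < e \<Longrightarrow> \<exists>z. 0 \<le> z \<and> z \<le> x \<and> blinfun_apply w x - e < blinfun_apply (dual_abs f - dual_abs g) z"
    using dual_positive_part[of "dual_abs f - dual_abs g"] by metis
  have "dual_le (dual_abs f - w) (dual_abs f)" "dual_le (dual_abs f - w) (dual_abs g)"
    using w by (auto simp: dual_le_def blinfun.diff_left algebra_simps)
  then have h: "dual_le (dual_abs f - w) 0" using inf by (auto simp: dual_inf_def)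
  show ?R
  proof (intro allI impI)
    fix x :: 'a and e :: real assume "0 \<le> x" "0 < e"
    then obtain z where z: "0 \<le> z" "z \<le> x" "blinfun_apply w x - e < blinfun_apply (dual_abs f - dual_abs g) z"
      using w_approx by blast
    have "blinfun_apply (dual_abs f) x \<le> blinfun_apply w x"
      using h \<open>0 \<le> x\<close> by (simp add: dual_le_def blinfun.diff_left)
    then show "\<exists>z. 0 \<le> z \<and> z \<le> x \<and> blinfun_apply (dual_abs f) (x - z) + blinfun_apply (dual_abs g) z < e"
      using z by (intro exI[of _ z]) (simp add: blinfun.diff_left blinfun.diff_right)
  qed
next
  assume R: ?R
  have "dual_inf (dual_abs f) (dual_abs g) 0"
    unfolding dual_inf_def
  proof (intro conjI allI impI)
    show "dual_le 0 (dual_abs f)" "dual_le 0 (dual_abs g)"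
      by (auto simp: dual_le_def dual_abs_nonneg)
    fix h assume h: "dual_le h (dual_abs f) \<and> dual_le h (dual_abs g)"
    show "dual_le h 0" unfolding dual_le_def
    proof (intro allI impI, rule field_le_epsilon)
      fix x :: 'a and e :: real assume "0 \<le> x" "0 < e"
      then obtain z where z: "0 \<le> z" "z \<le> x" "blinfun_apply (dual_abs f) (x - z) + blinfun_apply (dual_abs g) z < e"
        using R by blast
      have "blinfun_apply h x = blinfun_apply h (x - z) + blinfun_apply h z" by (simp add: blinfun.diff_right)
      also have "\<dots> \<le> blinfun_apply (dual_abs f) (x - z) + blinfun_apply (dual_abs g) z"
        using h z by (intro add_mono) (auto simp: dual_le_def)
      finally show "blinfun_apply h x \<le> blinfun_apply 0 x + e" using z by simp
    qed
  qed
  then show ?L unfolding dual_disjoint_def using dual_modulus_dual_abs by blast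
qed

lemma dual_disjoint_zero [simp]: "dual_disjoint f 0" "dual_disjoint 0 f"
proof -
  have 0: "blinfun_apply (dual_abs 0) x = 0" if "0 \<le> x" for x :: 'a
    using dual_abs_le[of x 0 0] dual_abs_nonneg[of x 0] that by simp
  show "dual_disjoint f 0" unfolding dual_disjoint_iff
    by (intro allI impI exI[of _ "x" for x]) (auto simp: 0)
  show "dual_disjoint 0 f" unfolding dual_disjoint_iff
    by (intro allI impI exI[of _ "0"]) (auto simp: 0)
qed

lemma dual_disjoint_scale:
  assumes "dual_disjoint f g"
  shows "dual_disjoint (c *\<^sub>R f) (d *\<^sub>R g)"
  unfolding dual_disjoint_iff
proof (intro allI impI)
  fix x :: 'a and e :: real assume x: "0 \<le> x" and e: "0 < e"
  define k where "k = \<bar>c\<bar> + \<bar>d\<bar> + 1"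
  have k: "0 < k" by (simp add: k_def add_nonneg_pos)
  obtain z where z: "0 \<le> z" "z \<le> x" "blinfun_apply (dual_abs f) (x - z) + blinfun_apply (dual_abs g) z < e / k"
    using assms x e k unfolding dual_disjoint_iff by (metis divide_pos_pos)
  have "blinfun_apply (dual_abs (c *\<^sub>R f)) (x - z) + blinfun_apply (dual_abs (d *\<^sub>R g)) z
      \<le> \<bar>c\<bar> * blinfun_apply (dual_abs f) (x - z) + \<bar>d\<bar> * blinfun_apply (dual_abs g) z"
    using z by (intro add_mono dual_abs_scale_le) auto
  also have "\<dots> \<le> k * blinfun_apply (dual_abs f) (x - z) + k * blinfun_apply (dual_abs g) z"
    using z by (intro add_mono mult_right_mono dual_abs_nonneg) (auto simp: k_def)
  also have "\<dots> < e" using z(3) k by (simp add: field_simps)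
  finally show "\<exists>z. 0 \<le> z \<and> z \<le> x \<and> blinfun_apply (dual_abs (c *\<^sub>R f)) (x - z) + blinfun_apply (dual_abs (d *\<^sub>R g)) z < e"
    using z by blast
qed

text \<open>The infimum of parts of \<open>x\<close> that separate \<open>g\<close> from the single \<open>f i\<close> separates it from all of them.\<close>

lemma disjoint_from_family:
  assumes "finite I" and "\<And>i. i \<in> I \<Longrightarrow> dual_disjoint g (f i)" and x: "0 \<le> x" and e: "0 < e"
  obtains z where "0 \<le> z" "z \<le> x" "blinfun_apply (dual_abs g) (x - z) < e"
    "\<And>i. i \<in> I \<Longrightarrow> blinfun_apply (dual_abs (f i)) z < e"
proof -
  have "\<exists>z. 0 \<le> z \<and> z \<le> x \<and> blinfun_apply (dual_abs g) (x - z) < e \<and>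
      (\<forall>i\<in>I. blinfun_apply (dual_abs (f i)) z < e)"
    using assms(1,2) e
  proof (induction I arbitrary: e rule: finite_induct)
    case empty
    then show ?case using x by (intro exI[of _ x]) auto
  next
    case (insert j I)
    have "0 < e / 2" using insert.prems by simp
    then obtain z where z: "0 \<le> z" "z \<le> x" "blinfun_apply (dual_abs g) (x - z) < e / 2"
      "\<forall>i\<in>I. blinfun_apply (dual_abs (f i)) z < e / 2"
      using insert.IH[of "e / 2"] insert.prems by blast
    obtain w where w: "0 \<le> w" "w \<le> x"
      "blinfun_apply (dual_abs g) (x - w) + blinfun_apply (dual_abs (f j)) w < e / 2"
      using insert.prems(1)[of j] \<open>0 < e / 2\<close> x unfolding dual_disjoint_iff by blast
    have "x - inf z w \<le> (x - z) + (x - w)"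
    proof -
      have "x - inf z w = sup (x - z) (x - w)" by (simp add: diff_inf_eq_sup add_sup_distrib_left)
      also have "\<dots> \<le> (x - z) + (x - w)"
        using z w by (intro sup_least) (auto simp: add_increasing add_increasing2 le_diff_eq)
      finally show ?thesis .
    qed
    then have "blinfun_apply (dual_abs g) (x - inf z w) \<le> blinfun_apply (dual_abs g) (x - z) + blinfun_apply (dual_abs g) (x - w)"
      using dual_abs_mono[of "x - inf z w" "(x - z) + (x - w)" g] by (simp add: blinfun.add_right)
    also have "\<dots> < e" using z(3) w(3) dual_abs_nonneg[OF w(1), of "f j"] by simp
    finally have 1: "blinfun_apply (dual_abs g) (x - inf z w) < e" .
    have 2: "blinfun_apply (dual_abs (f i)) (inf z w) < e" if "i \<in> insert j I" for i
    proof (cases "i = j")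
      case True
      have "blinfun_apply (dual_abs (f j)) (inf z w) \<le> blinfun_apply (dual_abs (f j)) w"
        by (rule dual_abs_mono) simp
      moreover have "0 \<le> blinfun_apply (dual_abs g) (x - w)" using w by (intro dual_abs_nonneg) simp
      ultimately show ?thesis using w(3) True insert.prems(2) by simp
    next
      case False
      have "blinfun_apply (dual_abs (f i)) (inf z w) \<le> blinfun_apply (dual_abs (f i)) z"
        by (rule dual_abs_mono) simp
      moreover have "blinfun_apply (dual_abs (f i)) z < e / 2" using z(4) that False by blast
      ultimately show ?thesis using insert.prems(2) by simp
    qed
    show ?case using 1 2 z w by (intro exI[of _ "inf z w"]) (auto intro: le_infI1)
  qed
  then show ?thesis using that by blast
qed

text \<open>Finitely many disjoint functionals attain their moduli at \<open>x\<close> almost simultaneously, at one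
  element of \<open>[- x, x]\<close>. In the inductive step the new functional nearly lives on a part \<open>z\<close> of \<open>x\<close>
  that is negligible for the others, so the element \<open>y\<close> found for those may be cut down to
  \<open>[- (x - z), x - z]\<close> and changed on \<open>z\<close>.\<close>

lemma disjoint_simultaneous_approx:
  fixes f :: "'i \<Rightarrow> ('a::banach_lattice \<Rightarrow>\<^sub>L real)"
  assumes "finite I" and disj: "\<And>i j. i \<in> I \<Longrightarrow> j \<in> I \<Longrightarrow> i \<noteq> j \<Longrightarrow> dual_disjoint (f i) (f j)"
    and x: "0 \<le> x" and "0 < e"
  obtains y where "\<bar>y\<bar> \<le> x" "\<And>i. i \<in> I \<Longrightarrow> blinfun_apply (dual_abs (f i)) x - e < blinfun_apply (f i) y"
proof -
  have "\<exists>y. \<bar>y\<bar> \<le> x \<and> (\<forall>i\<in>I. blinfun_apply (dual_abs (f i)) x - e < blinfun_apply (f i) y)"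
    using assms(1,2) \<open>0 < e\<close>
  proof (induction I arbitrary: e rule: finite_induct)
    case empty
    then show ?case using x by (intro exI[of _ 0]) auto
  next
    case (insert k I)
    define d where "d = e / 4"
    have d: "0 < d" "d + d + d + d = e" using insert.prems by (auto simp: d_def)
    obtain y where y: "\<bar>y\<bar> \<le> x" "\<forall>i\<in>I. blinfun_apply (dual_abs (f i)) x - d < blinfun_apply (f i) y"
      using insert.IH[of d] insert.prems d by blast
    have "\<And>i. i \<in> I \<Longrightarrow> dual_disjoint (f k) (f i)" using insert by auto
    then obtain z where z: "0 \<le> z" "z \<le> x" "blinfun_apply (dual_abs (f k)) (x - z) < d"
      "\<And>i. i \<in> I \<Longrightarrow> blinfun_apply (dual_abs (f i)) z < d"
      using disjoint_from_family[OF insert.hyps(1) _ x d(1), of "f k" f] by metis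
    obtain w where w: "\<bar>w\<bar> \<le> z" "blinfun_apply (dual_abs (f k)) z - d < blinfun_apply (f k) w"
      using dual_abs_approx[OF z(1) d(1)] by blast
    define v where "v = sup (- (x - z)) (inf y (x - z))"
    have v: "\<bar>v\<bar> \<le> x - z"
    proof (rule abs_leI)
      have "- (x - z) \<le> x - z" using z(2) by (meson diff_ge_0_iff_ge minus_le_self_iff)
      then show "v \<le> x - z" by (simp add: v_def)
      have "- (x - z) \<le> v" unfolding v_def by (rule sup_ge1)
      then show "- v \<le> x - z" using le_imp_neg_le by fastforce
    qed
    have y_le: "y \<le> x" "- x \<le> y" using y(1) abs_le_D1 abs_le_D2 minus_le_iff by blast+
    have yv: "\<bar>y - v\<bar> \<le> z"
    proof (rule abs_leI)
      have "y - z \<le> inf y (x - z)" using y_le z by (auto intro: diff_right_mono)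
      then have "y - z \<le> v" unfolding v_def by (rule le_supI2)
      then show "y - v \<le> z" by (simp add: algebra_simps)
      have "- (x - z) \<le> y + z" using add_right_mono[OF y_le(2), of z] by simp
      moreover have "inf y (x - z) \<le> y + z" using z(1) by (intro le_infI1) simp
      ultimately have "v \<le> y + z" unfolding v_def by (rule sup_least)
      then show "- (y - v) \<le> z" by (simp add: algebra_simps)
    qed
    have "\<bar>v + w\<bar> \<le> x"
      using abs_triangle_ineq[of v w] add_mono[OF v w(1)] by (simp add: order_trans)
    moreover have "blinfun_apply (dual_abs (f i)) x - e < blinfun_apply (f i) (v + w)" if i: "i \<in> insert k I" for i
    proof (cases "i = k")
      case True
      have "\<bar>blinfun_apply (f k) v\<bar> \<le> blinfun_apply (dual_abs (f k)) (x - z)" by (rule abs_le_dual_abs[OF v])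
      then show ?thesis using w(2) z(3) d True by (simp add: blinfun.add_right blinfun.diff_right)
    next
      case False
      then have i: "i \<in> I" using i by simp
      have "\<bar>blinfun_apply (f i) (y - v)\<bar> \<le> blinfun_apply (dual_abs (f i)) z"
        "\<bar>blinfun_apply (f i) w\<bar> \<le> blinfun_apply (dual_abs (f i)) z"
        by (intro abs_le_dual_abs yv w)+
      moreover have "blinfun_apply (dual_abs (f i)) x - d < blinfun_apply (f i) y" using y(2) i by blast
      ultimately show ?thesis using z(4)[OF i] d by (simp add: blinfun.add_right blinfun.diff_right)
    qed
    ultimately show ?case by blast
  qed
  then show ?thesis using that by blast
qed

section \<open>Order intervals are almost \<open>p\<close>-limited\<close>

lemma abs_diff_powr_le:
  fixes a b :: real
  assumes "1 \<le> p"
  shows "\<bar>a - b\<bar> powr p \<le> 2 powr p * (\<bar>a\<bar> powr p + \<bar>b\<bar> powr p)"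
proof -
  define m where "m = max \<bar>a\<bar> \<bar>b\<bar>"
  have "\<bar>a - b\<bar> powr p \<le> (2 * m) powr p"
    using assms by (intro powr_mono2) (auto simp: m_def)
  also have "\<dots> = 2 powr p * m powr p" by (simp add: powr_mult m_def)
  also have "m powr p \<le> \<bar>a\<bar> powr p + \<bar>b\<bar> powr p" by (auto simp: m_def max_def)
  finally show ?thesis by (simp add: mult_left_mono)
qed

text \<open>Weak* summability controls the values \<open>f n y\<close> at a single \<open>y\<close>, uniformly over the ball by
  uniform boundedness. Simultaneous approximation of finitely many moduli by values at one such
  \<open>y\<close> turns this into control of the moduli.\<close>

lemma weak_star_p_summable_moduli:
  fixes f :: "nat \<Rightarrow> ('a::banach_lattice \<Rightarrow>\<^sub>L real)"
  assumes p: "1 \<le> p" and disj: "disjoint_sequence f" and sum: "weak_star_p_summable p f"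
  obtains M where "\<And>N x. 0 \<le> x \<Longrightarrow> norm x \<le> 1 \<Longrightarrow> (\<Sum>n<N. blinfun_apply (dual_abs (f n)) x powr p) \<le> M"
proof -
  obtain r M where r: "0 < r"
    and M: "\<And>N z. norm z \<le> r \<Longrightarrow> (\<Sum>n<N. \<bar>blinfun_apply (f n) z\<bar> powr p) \<le> M"
  proof (rule uniform_boundedness[where I = UNIV and K = "2 powr p"
        and q = "\<lambda>N z. \<Sum>n<N. \<bar>blinfun_apply (f n) z\<bar> powr p"])
    show "continuous_on UNIV (\<lambda>z. \<Sum>n<N. \<bar>blinfun_apply (f n) z\<bar> powr p)" for N :: nat
      using p by (intro continuous_on_sum continuous_on_powr' continuous_intros) auto
    show "(\<Sum>n<N. \<bar>blinfun_apply (f n) (x - y)\<bar> powr p)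
        \<le> 2 powr p * ((\<Sum>n<N. \<bar>blinfun_apply (f n) x\<bar> powr p) + (\<Sum>n<N. \<bar>blinfun_apply (f n) y\<bar> powr p))"
      for N :: nat and x y
      unfolding sum.distrib[symmetric] sum_distrib_left
      using abs_diff_powr_le[OF p] by (intro sum_mono) (simp add: blinfun.diff_right)
    show "\<exists>M. \<forall>N\<in>UNIV. (\<Sum>n<N. \<bar>blinfun_apply (f n) x\<bar> powr p) \<le> M" for x
    proof -
      have "summable (\<lambda>n. \<bar>blinfun_apply (f n) x\<bar> powr p)"
        using sum by (auto simp: weak_star_p_summable_def in_ell_def)
      then have "(\<Sum>n<N. \<bar>blinfun_apply (f n) x\<bar> powr p) \<le> (\<Sum>n. \<bar>blinfun_apply (f n) x\<bar> powr p)" for N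
        by (intro sum_le_suminf) auto
      then show ?thesis by blast
    qed
  qed auto
  have "(\<Sum>n<N. blinfun_apply (dual_abs (f n)) x powr p) \<le> M / r powr p"
    if x: "0 \<le> x" "norm x \<le> 1" for N x
  proof -
    define c where "c n = blinfun_apply (dual_abs (f n)) x" for n
    have c: "0 \<le> c n" for n using dual_abs_nonneg[OF x(1)] by (simp add: c_def)
    have bound: "(\<Sum>n<N. (max 0 (c n - inverse (real (Suc k)))) powr p) \<le> M / r powr p" for k
    proof -
      obtain y where y: "\<bar>y\<bar> \<le> x"
        "\<And>n. n \<in> {..<N} \<Longrightarrow> c n - inverse (real (Suc k)) < blinfun_apply (f n) y"
        using disjoint_simultaneous_approx[of "{..<N}" f x "inverse (real (Suc k))"] disj x
        by (auto simp: disjoint_sequence_def c_def)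
      have "norm y \<le> 1" using norm_le_of_abs_le[OF y(1)] x by simp
      then have "(\<Sum>n<N. \<bar>blinfun_apply (f n) (r *\<^sub>R y)\<bar> powr p) \<le> M"
        using r by (intro M) simp
      moreover have "(\<Sum>n<N. \<bar>blinfun_apply (f n) (r *\<^sub>R y)\<bar> powr p)
          = r powr p * (\<Sum>n<N. \<bar>blinfun_apply (f n) y\<bar> powr p)"
        using r by (simp add: blinfun.scaleR_right abs_mult powr_mult sum_distrib_left)
      ultimately have "(\<Sum>n<N. \<bar>blinfun_apply (f n) y\<bar> powr p) \<le> M / r powr p"
        using r by (simp add: field_simps)
      moreover have "(\<Sum>n<N. (max 0 (c n - inverse (real (Suc k)))) powr p) \<le> (\<Sum>n<N. \<bar>blinfun_apply (f n) y\<bar> powr p)"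
      proof (intro sum_mono powr_mono2)
        fix n assume "n \<in> {..<N}"
        from y(2)[OF this] show "max 0 (c n - inverse (real (Suc k))) \<le> \<bar>blinfun_apply (f n) y\<bar>" by (intro max.boundedI; linarith)
      qed (use p in auto)
      ultimately show ?thesis by simp
    qed
    have "(\<lambda>k. \<Sum>n<N. (max 0 (c n - inverse (real (Suc k)))) powr p) \<longlonglongrightarrow> (\<Sum>n<N. (max 0 (c n - 0)) powr p)"
      using p by (intro tendsto_sum tendsto_powr' tendsto_intros LIMSEQ_inverse_real_of_nat) auto
    then have "(\<Sum>n<N. (max 0 (c n - 0)) powr p) \<le> M / r powr p"
      using bound by (intro LIMSEQ_le_const2) auto
    then show ?thesis using c by (simp add: c_def)
  qed
  then show ?thesis by (rule that)
qed

text \<open>The bounding sequence is \<open>a k = sup \<bar>f k\<bar> (x n)\<close> over \<open>n\<close>. Since \<open>x\<close> increases, this supremum is a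
  limit and commutes with finite sums over \<open>k\<close>. A constant \<open>x\<close> covers order intervals.\<close>

lemma almost_p_limited_dominated:
  fixes x :: "nat \<Rightarrow> 'a::banach_lattice"
  assumes p: "1 \<le> p" and x: "\<And>n. 0 \<le> x n" "incseq x" "bounded (range x)"
    and dom: "\<And>y. y \<in> A \<Longrightarrow> \<exists>n. \<bar>y\<bar> \<le> x n"
  shows "almost_p_limited p A"
  unfolding almost_p_limited_def
proof (intro allI impI)
  fix f :: "nat \<Rightarrow> ('a \<Rightarrow>\<^sub>L real)"
  assume f: "disjoint_sequence f" "weak_star_p_summable p f"
  obtain M where M: "\<And>N x. 0 \<le> x \<Longrightarrow> norm x \<le> 1 \<Longrightarrow> (\<Sum>n<N. blinfun_apply (dual_abs (f n)) x powr p) \<le> M"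
    using weak_star_p_summable_moduli[OF p f] by blast
  obtain B where B: "0 < B" "\<And>n. norm (x n) \<le> B"
    using x(3) unfolding bounded_pos by auto
  define c where "c k n = blinfun_apply (dual_abs (f k)) (x n)" for k n
  have c: "0 \<le> c k n" for k n using dual_abs_nonneg[OF x(1)] by (simp add: c_def)
  have c_inc: "incseq (c k)" for k
    using x(2) by (auto simp: incseq_def c_def intro: dual_abs_mono)
  have c_sum: "(\<Sum>k<N. c k n powr p) \<le> B powr p * M" for n N
  proof -
    have "(\<Sum>k<N. blinfun_apply (dual_abs (f k)) (inverse B *\<^sub>R x n) powr p) \<le> M"
      using B(1) B(2)[of n] x(1) by (intro M) (auto simp: scaleR_nonneg_nonneg field_simps)
    moreover have "c k n powr p = B powr p * blinfun_apply (dual_abs (f k)) (inverse B *\<^sub>R x n) powr p" for k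
    proof -
      have "c k n = B * blinfun_apply (dual_abs (f k)) (inverse B *\<^sub>R x n)"
        using B(1) by (simp add: c_def blinfun.scaleR_right)
      then show ?thesis
        using B(1) dual_abs_nonneg[of "inverse B *\<^sub>R x n"] x(1) by (simp add: powr_mult scaleR_nonneg_nonneg)
    qed
    ultimately show ?thesis using B(1) by (simp add: sum_distrib_left[symmetric] mult_left_mono)
  qed
  have bdd: "bdd_above (range (c k))" for k
  proof (rule bdd_aboveI2)
    fix n
    have "c k n \<le> norm (dual_abs (f k)) * norm (x n)"
      using norm_blinfun[of "dual_abs (f k)" "x n"] by (simp add: c_def)
    also have "\<dots> \<le> norm (dual_abs (f k)) * B" using B(2) by (intro mult_left_mono) auto
    finally show "c k n \<le> norm (dual_abs (f k)) * B" .
  qed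
  define a where "a k = (SUP n. c k n)" for k
  have le_a: "c k n \<le> a k" for k n unfolding a_def using bdd by (intro cSUP_upper) auto
  have a: "0 \<le> a k" for k using c[of k 0] le_a[of k 0] by simp
  have "(\<Sum>k<N. a k powr p) \<le> B powr p * M" for N
  proof (rule LIMSEQ_le_const2)
    have "c k \<longlonglongrightarrow> a k" for k unfolding a_def by (rule LIMSEQ_incseq_SUP[OF bdd c_inc])
    then show "(\<lambda>n. \<Sum>k<N. c k n powr p) \<longlonglongrightarrow> (\<Sum>k<N. a k powr p)"
      using p c by (intro tendsto_sum tendsto_powr' tendsto_const) auto
    show "\<exists>N'. \<forall>n\<ge>N'. (\<Sum>k<N. c k n powr p) \<le> B powr p * M" using c_sum by blast
  qed
  then have "in_ell p a"
    unfolding in_ell_def using a by (intro summableI_nonneg_bounded[where x = "B powr p * M"]) auto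
  moreover have "\<bar>blinfun_apply (f k) y\<bar> \<le> a k" if y: "y \<in> A" for y k
  proof -
    obtain n where "\<bar>y\<bar> \<le> x n" using dom[OF y] by blast
    then have "\<bar>blinfun_apply (f k) y\<bar> \<le> c k n" unfolding c_def by (rule abs_le_dual_abs)
    then show ?thesis using le_a[of k n] by simp
  qed
  ultimately show "\<exists>a. in_ell p a \<and> (\<forall>x\<in>A. \<forall>n. \<bar>blinfun_apply (f n) x\<bar> \<le> a n)" by blast
qed

lemma strong_p_GP_imp_KB_space:
  assumes "1 \<le> p" and "strong_p_GP p TYPE('a::banach_lattice)"
  shows "KB_space TYPE('a)"
  unfolding KB_space_def
proof (intro allI impI)
  fix x :: "nat \<Rightarrow> 'a" assume x: "\<forall>n. 0 \<le> x n" "incseq x" "bounded (range x)"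
  have "almost_p_limited p (range x)"
    using x by (intro almost_p_limited_dominated[of p x] assms(1)) auto
  then have "compact (closure (range x))"
    using assms(2) by (auto simp: strong_p_GP_def relatively_compact_def)
  then obtain l r where "strict_mono r" "(x \<circ> r) \<longlonglongrightarrow> l"
    unfolding compact_eq_seq_compact_metric seq_compact_def
    by (meson closure_subset range_subsetD)
  then show "convergent x"
    using incseq_convergent_subseq(1)[OF x(2)] by (auto simp: convergent_def)
qed

lemma strong_p_GP_imp_compact_order_interval:
  fixes x :: "'a::banach_lattice"
  assumes "1 \<le> p" and "strong_p_GP p TYPE('a)" and "0 \<le> x"
  shows "compact {0..x}"
proof -
  have "almost_p_limited p {0..x}"
    using assms by (intro almost_p_limited_dominated[of p "\<lambda>_. x"]) (auto simp: incseq_def)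
  then have "compact (closure {0..x})"
    using assms(2) by (auto simp: strong_p_GP_def relatively_compact_def)
  then show ?thesis using closed_order_interval[of 0 x] by (simp add: closure_closed)
qed

section \<open>Compact order intervals force atoms\<close>

text \<open>A functional dominated by \<open>y \<mapsto> norm (pprt y)\<close> is nonpositive at \<open>- y\<close> for each \<open>y \<ge> 0\<close>.\<close>

lemma positive_norming_functional:
  fixes x :: "'a::banach_lattice"
  assumes "0 \<le> x"
  obtains \<phi> :: "'a \<Rightarrow>\<^sub>L real" where "\<And>y. 0 \<le> y \<Longrightarrow> 0 \<le> blinfun_apply \<phi> y" "norm \<phi> \<le> 1"
    "blinfun_apply \<phi> x = norm x"
proof -
  have sub: "sublinear (\<lambda>y::'a. norm (pprt y))"
    unfolding sublinear_def
  proof (intro conjI allI impI)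
    fix y z :: 'a
    have "pprt (y + z) \<le> pprt y + pprt z"
      unfolding pprt_def by (intro sup_least add_mono) (auto simp: add_nonneg_nonneg)
    then have "norm (pprt (y + z)) \<le> norm (pprt y + pprt z)"
      by (intro norm_mono_nonneg) auto
    also have "\<dots> \<le> norm (pprt y) + norm (pprt z)" by (rule norm_triangle_ineq)
    finally show "norm (pprt (y + z)) \<le> norm (pprt y) + norm (pprt z)" .
  next
    fix r :: real and y :: 'a assume r: "0 \<le> r"
    have "pprt (r *\<^sub>R y) = - inf (r *\<^sub>R (- y)) (r *\<^sub>R 0)"
      unfolding pprt_def by (simp add: neg_inf_eq_sup)
    also have "\<dots> = r *\<^sub>R pprt y"
      unfolding inf_scaleR[OF r] pprt_def scaleR_minus_right[symmetric] neg_inf_eq_sup by simp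
    finally show "norm (pprt (r *\<^sub>R y)) = r * norm (pprt y)" using r by simp
  qed
  obtain \<phi> where \<phi>: "linear \<phi>" "\<And>y. \<phi> y \<le> norm (pprt y)" "norm x \<le> \<phi> x"
    using hahn_banach_convex[OF sub, of "{x}" "norm x"] assms by auto
  have pprt_le: "norm (pprt y) \<le> norm y" for y :: 'a
    using norm_mono_nonneg[of "pprt y" "\<bar>y\<bar>"] by (simp add: pprt_def abs_ge_self)
  have "\<phi> y \<le> norm y" for y using \<phi>(2)[of y] pprt_le[of y] by simp
  then obtain f :: "'a \<Rightarrow>\<^sub>L real" where f: "blinfun_apply f = \<phi>" "norm f \<le> 1"
    using linear_le_norm_blinfun[OF \<phi>(1)] by metis
  have "0 \<le> blinfun_apply f y" if "0 \<le> y" for y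
    using \<phi>(2)[of "- y"] that linear_neg[OF \<phi>(1), of y] by (simp add: f)
  moreover have "blinfun_apply f x = norm x"
    using \<phi>(2)[of x] \<phi>(3) pprt_le[of x] by (simp add: f)
  ultimately show ?thesis using f(2) that by blast
qed

lemma norm_functional_le:
  fixes \<phi> :: "'v::real_normed_vector \<Rightarrow>\<^sub>L real"
  shows "norm \<phi> \<le> 1 \<Longrightarrow> blinfun_apply \<phi> y \<le> norm y"
  using norm_blinfun[of \<phi> y] mult_right_mono[of "norm \<phi>" 1 "norm y"] by simp

text \<open>The elements that are finite sums of disjoint positive pieces of \<open>\<phi>\<close>-mass at most \<open>\<eta>\<close>.
  The inductive form admits arguments that treat one piece at a time without indexing the pieces.\<close>

inductive fine_split :: "('a::banach_lattice \<Rightarrow>\<^sub>L real) \<Rightarrow> real \<Rightarrow> 'a \<Rightarrow> bool"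
  for \<phi> :: "'a::banach_lattice \<Rightarrow>\<^sub>L real" and \<eta> :: real where
  small: "0 \<le> y \<Longrightarrow> blinfun_apply \<phi> y \<le> \<eta> \<Longrightarrow> fine_split \<phi> \<eta> y"
| disjoint_sum: "fine_split \<phi> \<eta> y \<Longrightarrow> fine_split \<phi> \<eta> z \<Longrightarrow> inf y z = 0 \<Longrightarrow> fine_split \<phi> \<eta> (y + z)"

lemma fine_split_nonneg: "fine_split \<phi> \<eta> y \<Longrightarrow> 0 \<le> y"
  by (induction rule: fine_split.induct) auto

lemma abs_diff_le_interval:
  fixes a c y :: "'a::banach_lattice"
  assumes "0 \<le> a" "a \<le> y" "0 \<le> c" "c \<le> y"
  shows "\<bar>c - a\<bar> \<le> y"
proof (rule abs_leI)
  have "c - a \<le> c" "a - c \<le> a" using assms by auto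
  then have "c - a \<le> y" "a - c \<le> y" using assms by (blast intro: order_trans)+
  then show "c - a \<le> y" "- (c - a) \<le> y" by simp_all
qed

lemma exp_average_le:
  fixes s t :: real
  assumes "0 \<le> s" "0 \<le> t" "s + t \<le> 1"
  shows "exp (- s) + exp (- t) \<le> 2 * exp (- (s + t) / 4)"
proof -
  have *: "exp (- s) \<le> 1 - s / 2" if "0 \<le> s" "s \<le> 1" for s :: real
  proof -
    have "(1 - s / 2) * (1 + s) = 1 + s * (1 - s) / 2" by (simp add: field_simps)
    then have "1 \<le> (1 - s / 2) * (1 + s)" using that by simp
    also have "\<dots> \<le> (1 - s / 2) * exp s"
      using that exp_ge_add_one_self[of s] by (intro mult_left_mono) auto
    finally show ?thesis by (simp add: exp_minus field_simps)
  qed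
  have "exp (- s) + exp (- t) \<le> (1 - s / 2) + (1 - t / 2)"
    using assms by (intro add_mono *) auto
  also have "\<dots> = 2 * (1 + - (s + t) / 4)" by (simp add: field_simps)
  also have "\<dots> \<le> 2 * exp (- (s + t) / 4)" by (intro mult_left_mono exp_ge_add_one_self) simp
  finally show ?thesis .
qed

text \<open>If \<open>c\<close> is formed by keeping or dropping each piece of \<open>y\<close> with probability one half, then
  \<open>\<phi> \<bar>c - a j\<bar>\<close> has mean at least \<open>\<phi> y / 2\<close> and is concentrated, because the pieces are small. The
  exponential moment, which is multiplicative over disjoint pieces, allows the choice to be made
  deterministically, one piece at a time.\<close>

lemma fine_split_far_point:
  fixes \<phi> :: "'a::banach_lattice \<Rightarrow>\<^sub>L real"
  assumes pos: "\<And>y. 0 \<le> y \<Longrightarrow> 0 \<le> blinfun_apply \<phi> y" and "0 \<le> L" "L * \<eta> \<le> 1" and split: "fine_split \<phi> \<eta> y"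
    and "\<And>j. j \<in> J \<Longrightarrow> 0 \<le> w j" and "\<And>j. j \<in> J \<Longrightarrow> 0 \<le> a j \<and> a j \<le> y"
  shows "\<exists>c. 0 \<le> c \<and> c \<le> y \<and> (\<Sum>j\<in>J. w j * exp (- L * blinfun_apply \<phi> \<bar>c - a j\<bar>))
     \<le> exp (- L * blinfun_apply \<phi> y / 4) * sum w J"
  using split assms(5,6)
proof (induction arbitrary: w a rule: fine_split.induct)
  case (small y)
  define S where "S c = (\<Sum>j\<in>J. w j * exp (- L * blinfun_apply \<phi> \<bar>c - a j\<bar>))" for c
  have "w j * exp (- L * blinfun_apply \<phi> \<bar>0 - a j\<bar>) + w j * exp (- L * blinfun_apply \<phi> \<bar>y - a j\<bar>)
      \<le> w j * (2 * exp (- L * blinfun_apply \<phi> y / 4))" if j: "j \<in> J" for j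
  proof -
    have a: "0 \<le> a j" "0 \<le> y - a j" using small(4)[OF j] by auto
    have eq: "\<bar>0 - a j\<bar> = a j" "\<bar>y - a j\<bar> = y - a j" using a by auto
    have s: "L * blinfun_apply \<phi> (a j) + L * blinfun_apply \<phi> (y - a j) = L * blinfun_apply \<phi> y"
      by (simp add: blinfun.diff_right algebra_simps)
    have "L * blinfun_apply \<phi> y \<le> 1"
      using mult_left_mono[OF small(2) \<open>0 \<le> L\<close>] \<open>L * \<eta> \<le> 1\<close> by simp
    then have "exp (- (L * blinfun_apply \<phi> (a j))) + exp (- (L * blinfun_apply \<phi> (y - a j)))
       \<le> 2 * exp (- (L * blinfun_apply \<phi> y) / 4)"
      using exp_average_le[of "L * blinfun_apply \<phi> (a j)" "L * blinfun_apply \<phi> (y - a j)"] s a pos \<open>0 \<le> L\<close> by simp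
    from mult_left_mono[OF this small(3)[OF j]] show ?thesis
      unfolding eq by (simp add: distrib_left)
  qed
  then have "S 0 + S y \<le> (\<Sum>j\<in>J. w j * (2 * exp (- L * blinfun_apply \<phi> y / 4)))"
    unfolding S_def sum.distrib[symmetric] by (rule sum_mono)
  also have "\<dots> = 2 * (exp (- L * blinfun_apply \<phi> y / 4) * sum w J)"
    by (simp add: sum_distrib_right[symmetric] mult.assoc)
  finally have "S 0 \<le> exp (- L * blinfun_apply \<phi> y / 4) * sum w J \<or> S y \<le> exp (- L * blinfun_apply \<phi> y / 4) * sum w J"
    by linarith
  then show ?case using small(1) unfolding S_def by (meson order_refl)
next
  case (disjoint_sum y z)
  have yz: "0 \<le> y" "0 \<le> z" using disjoint_sum by (auto intro: fine_split_nonneg)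
  have "\<exists>b d. 0 \<le> b \<and> b \<le> y \<and> 0 \<le> d \<and> d \<le> z \<and> a j = b + d" if "j \<in> J" for j
    using riesz_decomposition[OF yz, of "a j"] disjoint_sum.prems(2)[OF that] by metis
  then obtain b d where bd: "\<And>j. j \<in> J \<Longrightarrow> 0 \<le> b j \<and> b j \<le> y" "\<And>j. j \<in> J \<Longrightarrow> 0 \<le> d j \<and> d j \<le> z"
    "\<And>j. j \<in> J \<Longrightarrow> a j = b j + d j" by metis
  obtain c1 where c1: "0 \<le> c1" "c1 \<le> y" "(\<Sum>j\<in>J. w j * exp (- L * blinfun_apply \<phi> \<bar>c1 - b j\<bar>))
     \<le> exp (- L * blinfun_apply \<phi> y / 4) * sum w J"
    using disjoint_sum.IH(1)[of w b] disjoint_sum.prems(1) bd(1) by blast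
  define w' where "w' j = w j * exp (- L * blinfun_apply \<phi> \<bar>c1 - b j\<bar>)" for j
  obtain c2 where c2: "0 \<le> c2" "c2 \<le> z" "(\<Sum>j\<in>J. w' j * exp (- L * blinfun_apply \<phi> \<bar>c2 - d j\<bar>))
     \<le> exp (- L * blinfun_apply \<phi> z / 4) * sum w' J"
    using disjoint_sum.IH(2)[of w' d] disjoint_sum.prems(1) bd(2) by (auto simp: w'_def)
  have eq: "\<bar>(c1 + c2) - a j\<bar> = \<bar>c1 - b j\<bar> + \<bar>c2 - d j\<bar>" if j: "j \<in> J" for j
  proof -
    have "\<bar>c1 - b j\<bar> \<le> y" "\<bar>c2 - d j\<bar> \<le> z"
      using bd(1,2)[OF j] c1 c2 by (auto intro: abs_diff_le_interval)
    then have "inf \<bar>c1 - b j\<bar> \<bar>c2 - d j\<bar> = 0"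
      by (intro inf_mono_zero[OF disjoint_sum.hyps(3)]) auto
    from abs_add_disjoint[OF this] show ?thesis
      unfolding bd(3)[OF j] by (simp add: algebra_simps)
  qed
  have "(\<Sum>j\<in>J. w j * exp (- L * blinfun_apply \<phi> \<bar>(c1 + c2) - a j\<bar>)) = (\<Sum>j\<in>J. w' j * exp (- L * blinfun_apply \<phi> \<bar>c2 - d j\<bar>))"
  proof (rule sum.cong[OF refl])
    fix j assume j: "j \<in> J"
    have "- L * blinfun_apply \<phi> \<bar>(c1 + c2) - a j\<bar> = - L * blinfun_apply \<phi> \<bar>c1 - b j\<bar> + - L * blinfun_apply \<phi> \<bar>c2 - d j\<bar>"
      unfolding eq[OF j] blinfun.add_right by (rule distrib_left)
    then show "w j * exp (- L * blinfun_apply \<phi> \<bar>(c1 + c2) - a j\<bar>) = w' j * exp (- L * blinfun_apply \<phi> \<bar>c2 - d j\<bar>)"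
      by (simp only: w'_def exp_add mult.assoc)
  qed
  also have "\<dots> \<le> exp (- L * blinfun_apply \<phi> z / 4) * (exp (- L * blinfun_apply \<phi> y / 4) * sum w J)"
    using c1(3) by (intro order_trans[OF c2(3)] mult_left_mono) (auto simp: w'_def)
  also have "\<dots> = exp (- L * blinfun_apply \<phi> (y + z) / 4) * sum w J"
  proof -
    have "- L * blinfun_apply \<phi> (y + z) / 4 = - L * blinfun_apply \<phi> z / 4 + - L * blinfun_apply \<phi> y / 4"
      by (simp add: blinfun.add_right distrib_left add_divide_distrib diff_divide_distrib)
    then show ?thesis by (simp only: exp_add mult.assoc)
  qed
  finally show ?case using c1 c2 by (intro exI[of _ "c1 + c2"]) (auto intro: add_mono)
qed

text \<open>Apply the previous lemma to a finite net of \<open>[0, x]\<close>: for fine splittings it produces a point of the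
  interval outside all balls of the net.\<close>

lemma compact_interval_not_fine_split:
  fixes x :: "'a::banach_lattice"
  assumes comp: "compact {0..x}" and "0 \<le> x" and pos: "\<And>y. 0 \<le> y \<Longrightarrow> 0 \<le> blinfun_apply \<phi> y" and "norm \<phi> \<le> 1"
    and "0 < blinfun_apply \<phi> x"
  obtains \<eta> where "0 < \<eta>" "\<not> fine_split \<phi> \<eta> x"
proof (rule ccontr)
  assume "\<not> thesis"
  then have split: "\<And>\<eta>. 0 < \<eta> \<Longrightarrow> fine_split \<phi> \<eta> x" using that by blast
  define \<delta> where "\<delta> = blinfun_apply \<phi> x / 8"
  have \<delta>: "0 < \<delta>" using assms by (simp add: \<delta>_def)
  then obtain k where k: "finite k" "k \<subseteq> {0..x}" "{0..x} \<subseteq> (\<Union>y\<in>k. ball y \<delta>)"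
    using seq_compact_imp_totally_bounded comp unfolding compact_eq_seq_compact_metric by metis
  have "k \<noteq> {}" using k(3) \<open>0 \<le> x\<close> by fastforce
  define N where "N = real (card k)"
  have N: "0 < N" using k(1) \<open>k \<noteq> {}\<close> by (simp add: N_def card_gt_0_iff)
  \<comment> \<open>With \<open>L \<delta> = N\<close> the union bound over the net is \<open>N exp (- 2 N) < exp (- N)\<close>.\<close>
  define L where "L = N / \<delta>"
  have L: "0 < L" "L * \<delta> = N" using N \<delta> by (auto simp: L_def)
  have "\<exists>c. 0 \<le> c \<and> c \<le> x \<and> (\<Sum>y\<in>k. 1 * exp (- L * blinfun_apply \<phi> \<bar>c - y\<bar>))
     \<le> exp (- L * blinfun_apply \<phi> x / 4) * (\<Sum>y\<in>k. 1)"
    using L k(2) by (intro fine_split_far_point[OF pos _ _ split[of "inverse L"]]) auto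
  moreover have "- L * blinfun_apply \<phi> x / 4 = - (2 * N)" using L(2) by (simp add: \<delta>_def)
  ultimately obtain c where c: "0 \<le> c" "c \<le> x" "(\<Sum>y\<in>k. exp (- L * blinfun_apply \<phi> \<bar>c - y\<bar>)) \<le> exp (- (2 * N)) * N"
    by (auto simp: N_def)
  obtain y where y: "y \<in> k" "norm (c - y) < \<delta>"
    using k(3) c by (force simp: dist_norm norm_minus_commute)
  have "exp (- L * blinfun_apply \<phi> \<bar>c - y\<bar>) \<le> exp (- (2 * N)) * N"
    using c(3) member_le_sum[of y k "\<lambda>y. exp (- L * blinfun_apply \<phi> \<bar>c - y\<bar>)"] k(1) y(1) by simp
  also have "\<dots> < exp (- (2 * N)) * exp N"
    using less_le_trans[OF _ exp_ge_add_one_self[of N], of N] by (intro mult_strict_left_mono) auto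
  also have "\<dots> = exp (- N)" by (simp add: exp_add[symmetric])
  finally have "L * \<delta> < L * blinfun_apply \<phi> \<bar>c - y\<bar>" using L(2) by simp
  then have "\<delta> < blinfun_apply \<phi> \<bar>c - y\<bar>" using L(1) by simp
  also have "\<dots> \<le> norm \<bar>c - y\<bar>" by (rule norm_functional_le[OF \<open>norm \<phi> \<le> 1\<close>])
  finally show False using y(2) by simp
qed

text \<open>The projection \<open>w\<close> of \<open>m\<close> onto the band generated by \<open>v\<close>, as the limit of \<open>inf (n v) m\<close>.\<close>

lemma proper_component:
  fixes m v v' :: "'a::banach_lattice"
  assumes comp: "compact {0..m}" and v: "0 \<le> v" "v \<noteq> 0" "v \<le> m" and v': "0 \<le> v'" "v' \<noteq> 0" "v' \<le> m"
    and disj: "inf v v' = 0"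
  obtains w where "0 \<le> w" "w \<le> m" "inf w (m - w) = 0" "w \<noteq> 0" "w \<noteq> m"
proof -
  define s where "s n = inf (real n *\<^sub>R v) m" for n
  have m: "0 \<le> m" using v by simp
  have s: "0 \<le> s n" "s n \<le> m" for n using v m by (auto simp: s_def scaleR_nonneg_nonneg)
  have inc: "incseq s"
    unfolding s_def incseq_def using v(1) by (intro allI impI inf_mono scaleR_right_mono) auto
  obtain w r where wr: "w \<in> {0..m}" "strict_mono r" "(s \<circ> r) \<longlonglongrightarrow> w"
    using comp s unfolding compact_eq_seq_compact_metric seq_compact_def
    by (metis atLeastAtMost_iff)
  have lim: "s \<longlonglongrightarrow> w" and le: "\<And>n. s n \<le> w"
    using incseq_convergent_subseq[OF inc wr(2,3)] by auto
  have w: "0 \<le> w" "w \<le> m" using wr by auto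
  define d where "d = inf (m - w) v"
  have d: "0 \<le> d" "d \<le> m - w" "d \<le> v" using w v by (auto simp: d_def)
  \<comment> \<open>What \<open>v\<close> still meets in \<open>m - w\<close> could be added to every approximant, hence to the limit.\<close>
  have "s n + d \<le> w" for n
  proof -
    have "s n + d \<le> real n *\<^sub>R v + v" using d by (intro add_mono) (auto simp: s_def)
    also have "\<dots> = real (Suc n) *\<^sub>R v" by (simp add: scaleR_add_left)
    finally have "s n + d \<le> real (Suc n) *\<^sub>R v" .
    moreover have "s n + d \<le> w + (m - w)" by (intro add_mono le d)
    ultimately have "s n + d \<le> s (Suc n)" unfolding s_def[of "Suc n"] by simp
    then show ?thesis using le[of "Suc n"] by (rule order_trans)
  qed
  then have "w + d \<le> w"
    by (intro limit_le_lattice[OF tendsto_add[OF lim tendsto_const] tendsto_const] always_eventually allI)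
  then have "inf (m - w) v = 0" using d(1) by (simp add: d_def antisym)
  then have nv: "inf (real n *\<^sub>R v) (m - w) = 0" for n
  proof (induction n)
    case (Suc n)
    have "inf (m - w) (real n *\<^sub>R v + v) = 0"
      using Suc w v by (intro inf_add_zero) (auto simp: inf_commute scaleR_nonneg_nonneg)
    then show ?case by (simp add: scaleR_add_left inf_commute add.commute)
  qed (use w in \<open>simp add: inf_absorb1\<close>)
  have "inf (s n) (m - w) = 0" for n
    using inf_mono_zero[OF nv[of n], of "s n" "m - w"] s(1) w by (simp add: s_def)
  then have "(\<lambda>n. 0) \<longlonglongrightarrow> inf w (m - w)"
    using tendsto_inf_lattice[OF lim tendsto_const, of "m - w"] by simp
  then have 1: "inf w (m - w) = 0" by (simp add: LIMSEQ_const_iff)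
  have "v \<le> w" using le[of 1] v by (simp add: s_def inf_absorb1)
  then have 2: "w \<noteq> 0" using v by (auto simp: antisym)
  have 3: "w \<noteq> m"
  proof
    assume "w = m"
    have nv': "inf v' (real n *\<^sub>R v) = 0" for n
    proof (induction n)
      case (Suc n)
      have "inf v' (real n *\<^sub>R v + v) = 0"
        using Suc disj v by (intro inf_add_zero) (auto simp: inf_commute scaleR_nonneg_nonneg)
      then show ?case by (simp add: scaleR_add_left add.commute)
    qed (use v' in \<open>simp add: inf_absorb2\<close>)
    have "inf v' (s n) = 0" for n
      using inf_mono_zero[OF nv'[of n], of v' "s n"] s(1) v' by (simp add: s_def)
    then have "(\<lambda>n. 0) \<longlonglongrightarrow> inf v' w"
      using tendsto_inf_lattice[OF tendsto_const lim, of v'] by simp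
    then have "inf v' m = 0" using \<open>w = m\<close> by (simp add: LIMSEQ_const_iff)
    then show False using v' by (simp add: inf_absorb1)
  qed
  show ?thesis using that w 1 2 3 by blast
qed

lemma inf_pprt_nprt: "inf (pprt a) (- nprt a) = (0::'a::banach_lattice)"
proof -
  have "pprt a = a + - nprt a" using prts[of a] by (simp add: algebra_simps)
  then have "inf (pprt a) (- nprt a) = inf (a + - nprt a) (0 + - nprt a)" by simp
  also have "\<dots> = inf a 0 + - nprt a" by (rule add_inf_distrib_right[symmetric])
  also have "\<dots> = 0" by (simp only: nprt_def add.right_inverse)
  finally show ?thesis .
qed

text \<open>If every multiple \<open>t m\<close> is comparable with \<open>y\<close>, then \<open>y\<close> is the multiple at the supremum of
  those \<open>t\<close> with \<open>t m \<le> y\<close>.\<close>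

lemma comparable_multiples_imp_multiple:
  fixes m y :: "'a::banach_lattice"
  assumes m: "0 < m" and y: "0 \<le> y" "y \<le> m"
    and cmp: "\<And>t. 0 \<le> t \<Longrightarrow> y \<le> t *\<^sub>R m \<or> t *\<^sub>R m \<le> y"
  obtains t where "y = t *\<^sub>R m"
proof -
  define T where "T = {t. 0 \<le> t \<and> t *\<^sub>R m \<le> y}"
  have T_le: "t \<le> 1" if "t \<in> T" for t
  proof (rule ccontr)
    assume "\<not> t \<le> 1"
    have "t *\<^sub>R m \<le> 1 *\<^sub>R m" using that y by (auto simp: T_def)
    then have "(t - 1) *\<^sub>R m \<le> 0" by (simp add: scaleR_diff_left)
    then have "inverse (t - 1) *\<^sub>R ((t - 1) *\<^sub>R m) \<le> inverse (t - 1) *\<^sub>R 0"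
      using \<open>\<not> t \<le> 1\<close> by (intro scaleR_left_mono) auto
    then show False using \<open>\<not> t \<le> 1\<close> m by simp
  qed
  have bdd: "bdd_above T" using T_le by (meson bdd_above.I)
  have "0 \<in> T" using y by (simp add: T_def)
  define u where "u = Sup T"
  have "0 \<le> u" unfolding u_def using \<open>0 \<in> T\<close> bdd by (rule cSup_upper)
  have lim: "(\<lambda>n. (u + inverse (real (Suc n))) *\<^sub>R m) \<longlonglongrightarrow> (u + 0) *\<^sub>R m"
    "(\<lambda>n. (u - inverse (real (Suc n))) *\<^sub>R m) \<longlonglongrightarrow> (u - 0) *\<^sub>R m"
    by (intro tendsto_intros LIMSEQ_inverse_real_of_nat)+
  have "y \<le> (u + inverse (real (Suc n))) *\<^sub>R m" for n
  proof -
    have "u + inverse (real (Suc n)) \<notin> T"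
      using cSup_upper[OF _ bdd] unfolding u_def by (metis add_le_same_cancel1 inverse_positive_iff_positive of_nat_0_less_iff zero_less_Suc leD)
    then show ?thesis using cmp[of "u + inverse (real (Suc n))"] \<open>0 \<le> u\<close> by (auto simp: T_def)
  qed
  then have "y \<le> (u + 0) *\<^sub>R m"
    by (intro limit_le_lattice[OF tendsto_const lim(1)] always_eventually allI)
  moreover have "(u - inverse (real (Suc n))) *\<^sub>R m \<le> y" for n
  proof -
    have "u - inverse (real (Suc n)) < Sup T" by (simp add: u_def)
    then obtain t where t: "t \<in> T" "u - inverse (real (Suc n)) < t"
      using less_cSup_iff[OF _ bdd] \<open>0 \<in> T\<close> by blast
    then have "(u - inverse (real (Suc n))) *\<^sub>R m \<le> t *\<^sub>R m"
      using m by (intro scaleR_right_mono) auto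
    then show ?thesis using t by (auto simp: T_def)
  qed
  then have "(u - 0) *\<^sub>R m \<le> y"
    by (intro limit_le_lattice[OF lim(2) tendsto_const] always_eventually allI)
  ultimately have "y = u *\<^sub>R m" by (simp add: antisym)
  then show ?thesis by (rule that)
qed

text \<open>Consider the components of \<open>x\<close> that are not finely split. By compactness a chain of them comes
  arbitrarily close to a lower bound \<open>l\<close>; if \<open>l\<close> were finely split, then adding one more piece, the small
  difference to a member of the chain, would split that member. So Zorn's lemma yields a minimal such
  component. It is an atom, since in a proper disjoint decomposition one of the two summands would again
  not be finely split.\<close>

lemma not_fine_split_imp_atom:
  fixes x :: "'a::banach_lattice"
  assumes comp: "compact {0..x}" and "0 \<le> x" and pos: "\<And>y. 0 \<le> y \<Longrightarrow> 0 \<le> blinfun_apply \<phi> y" and "norm \<phi> \<le> 1"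
    and "0 < \<eta>" "\<not> fine_split \<phi> \<eta> x"
  obtains a where "lattice_atom a" "a \<le> x"
proof -
  define K where "K = {c. 0 \<le> c \<and> c \<le> x \<and> inf c (x - c) = 0}"
  define Z where "Z = {c \<in> K. \<not> fine_split \<phi> \<eta> c}"
  have "continuous_on UNIV (\<lambda>c. inf c (x - c))"
    unfolding continuous_on by (auto intro!: tendsto_inf_lattice tendsto_intros)
  then have "closed {c. inf c (x - c) = 0}" by (intro closed_Collect_eq) auto
  moreover have "K = {0..x} \<inter> {c. inf c (x - c) = 0}" by (auto simp: K_def)
  ultimately have "closed K" using closed_order_interval[of 0 x] by auto
  have "\<exists>m\<in>Z. \<forall>a\<in>Z. a \<le> m \<longrightarrow> a = m"
  proof (rule predicate_Zorn)
    show "partial_order_on Z (relation_of (\<lambda>x y. y \<le> x) Z)"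
      by (rule partial_order_on_relation_ofI) auto
    fix C assume "C \<in> Chains (relation_of (\<lambda>x y. y \<le> x) Z)"
    then have CZ: "C \<subseteq> Z" and ch: "\<And>c c'. c \<in> C \<Longrightarrow> c' \<in> C \<Longrightarrow> c \<le> c' \<or> c' \<le> c"
      by (auto simp: Chains_def relation_of_def)
    show "\<exists>u\<in>Z. \<forall>a\<in>C. u \<le> a"
    proof (cases "C = {}")
      case True
      have "x \<in> Z" using assms by (simp add: Z_def K_def inf_absorb2)
      then show ?thesis using True by auto
    next
      case False
      have fin_min: "\<exists>m\<in>D. \<forall>c\<in>D. m \<le> c" if "finite D" "D \<noteq> {}" "D \<subseteq> C" for D
        using that
      proof (induction D rule: finite_ne_induct)
        case (insert c D)
        then obtain m where m: "m \<in> D" "\<forall>c\<in>D. m \<le> c" by blast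
        then have "m \<le> c \<or> c \<le> m" using ch[of m c] insert.prems by auto
        then show ?case
        proof
          assume "m \<le> c"
          then show ?thesis using m by (intro bexI[of _ m]) auto
        next
          assume "c \<le> m"
          then have "c \<le> d" if "d \<in> D" for d using m(2) that order_trans by blast
          then show ?thesis by (intro bexI[of _ c]) auto
        qed
      qed auto
      have closed_le: "closed {..c}" for c :: 'a
      proof -
        have "{..c} = (\<lambda>y. c - y) -` {y. 0 \<le> y}" by auto
        also have "closed \<dots>" by (intro closed_vimage closed_nonneg continuous_intros)
        finally show ?thesis .
      qed
      \<comment> \<open>A lower bound of the chain in its closure, by the finite intersection property.\<close>
      have "closure C \<inter> \<Inter>((\<lambda>c. {..c}) ` C) \<noteq> {}"
      proof (rule compact_imp_fip)
        have "C \<subseteq> {0..x}" using CZ by (auto simp: Z_def K_def)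
        then have "closure C \<subseteq> {0..x}" using closed_order_interval by (rule closure_minimal)
        then show "compact (closure C)" using compact_Int_closed[OF comp, of "closure C"] by (simp add: Int_absorb1)
        show "closed T" if "T \<in> (\<lambda>c. {..c}) ` C" for T using that closed_le by auto
        fix F assume F: "finite F" "F \<subseteq> (\<lambda>c. {..c}) ` C"
        then obtain D where D: "finite D" "D \<subseteq> C" "F = (\<lambda>c. {..c}) ` D"
          by (meson finite_subset_image)
        show "closure C \<inter> \<Inter>F \<noteq> {}"
        proof (cases "D = {}")
          case True
          then show ?thesis using D False by simp
        next
          case False
          then obtain m where "m \<in> D" "\<forall>c\<in>D. m \<le> c" using fin_min D by blast
          then have "m \<in> closure C \<inter> \<Inter>F" using D closure_subset[of C] by auto
          then show ?thesis by blast
        qed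
      qed
      then obtain l where l: "l \<in> closure C" "\<And>c. c \<in> C \<Longrightarrow> l \<le> c" by blast
      have "closure C \<subseteq> K" using CZ \<open>closed K\<close> by (intro closure_minimal) (auto simp: Z_def)
      then have lK: "0 \<le> l" "l \<le> x" "inf l (x - l) = 0" using l(1) by (auto simp: K_def)
      obtain c where c: "c \<in> C" "norm (c - l) < \<eta>"
        using l(1) \<open>0 < \<eta>\<close> unfolding closure_approachable dist_norm by blast
      have "blinfun_apply \<phi> (c - l) \<le> \<eta>"
        using norm_functional_le[OF \<open>norm \<phi> \<le> 1\<close>, of "c - l"] c(2) by simp
      then have "fine_split \<phi> \<eta> (c - l)" using l(2)[OF c(1)] by (intro fine_split.small) auto
      moreover have "inf l (c - l) = 0"
        using c(1) CZ l(2)[OF c(1)] lK by (intro inf_mono_zero[OF lK(3)]) (auto simp: Z_def K_def diff_right_mono)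
      ultimately have "fine_split \<phi> \<eta> l \<Longrightarrow> fine_split \<phi> \<eta> (l + (c - l))"
        by (intro fine_split.disjoint_sum)
      then have "l \<in> Z" using c(1) CZ lK by (auto simp: Z_def K_def)
      then show ?thesis using l(2) by blast
    qed
  qed
  then obtain m where m: "m \<in> Z" "\<And>a. a \<in> Z \<Longrightarrow> a \<le> m \<Longrightarrow> a = m" by blast
  have mK: "0 \<le> m" "m \<le> x" "inf m (x - m) = 0" "\<not> fine_split \<phi> \<eta> m"
    using m(1) by (auto simp: Z_def K_def)
  have "fine_split \<phi> \<eta> 0" using \<open>0 < \<eta>\<close> by (intro fine_split.small) auto
  then have "0 < m" using mK by (metis order_le_less)
  have comp_m: "compact {0..m}"
    using compact_Int_closed[OF comp closed_order_interval[of 0 m]] mK(2)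
    by (metis Int_absorb1 atLeastatMost_subset_iff order_refl)
  have "lattice_atom m"
    unfolding lattice_atom_def
  proof (intro conjI allI impI \<open>0 < m\<close>)
    fix y assume y: "0 \<le> y \<and> y \<le> m"
    show "\<exists>c. y = c *\<^sub>R m"
    proof (rule ccontr)
      assume "\<not> ?thesis"
      then obtain t where t: "0 \<le> t" "\<not> y \<le> t *\<^sub>R m" "\<not> t *\<^sub>R m \<le> y"
        using comparable_multiples_imp_multiple[of m y] \<open>0 < m\<close> y by metis
      have "t \<le> 1"
      proof (rule ccontr)
        assume "\<not> t \<le> 1"
        then have "1 *\<^sub>R m \<le> t *\<^sub>R m" using mK by (intro scaleR_right_mono) auto
        then show False using t y by auto
      qed
      define v where "v = pprt (y - t *\<^sub>R m)"
      define v' where "v' = - nprt (y - t *\<^sub>R m)"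
      have "y - t *\<^sub>R m \<le> y" using t mK by (simp add: scaleR_nonneg_nonneg)
      then have "y - t *\<^sub>R m \<le> m" using y by (blast intro: order_trans)
      then have v: "0 \<le> v" "v \<noteq> 0" "v \<le> m"
        using t mK le_zero_iff_zero_pprt[of "y - t *\<^sub>R m"] by (simp_all add: v_def) (simp add: pprt_def)
      have "t *\<^sub>R m - y \<le> t *\<^sub>R m" "t *\<^sub>R m \<le> 1 *\<^sub>R m"
        using y mK \<open>t \<le> 1\<close> by (auto intro: scaleR_right_mono simp del: scaleR_one)
      then have "t *\<^sub>R m - y \<le> m" by (metis order_trans scaleR_one)
      moreover have "v' = sup (t *\<^sub>R m - y) 0" by (simp add: v'_def nprt_def neg_inf_eq_sup)
      ultimately have v': "0 \<le> v'" "v' \<noteq> 0" "v' \<le> m"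
        using t mK by (auto simp: v'_def zero_le_iff_zero_nprt[symmetric])
      obtain w where w: "0 \<le> w" "w \<le> m" "inf w (m - w) = 0" "w \<noteq> 0" "w \<noteq> m"
        using proper_component[OF comp_m v v'] inf_pprt_nprt[of "y - t *\<^sub>R m"] by (auto simp: v_def v'_def)
      have "inf w (x - m) = 0" "inf (m - w) (x - m) = 0"
        using w mK by (auto intro: inf_mono_zero[OF mK(3)])
      then have "inf w ((x - m) + (m - w)) = 0" "inf (m - w) ((x - m) + w) = 0"
        using w mK by (intro inf_add_zero; simp add: inf_commute[of "m - w" w])+
      then have "inf w (x - w) = 0" "inf (m - w) (x - (m - w)) = 0" by (simp_all add: diff_diff_eq2 diff_add_eq)
      then have "w \<in> K" "m - w \<in> K"
        using w mK order_trans[of w m x] order_trans[of "m - w" m x] by (auto simp: K_def)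
      then have "fine_split \<phi> \<eta> w" "fine_split \<phi> \<eta> (m - w)"
        using m(2)[of w] m(2)[of "m - w"] w by (auto simp: Z_def)
      then have "fine_split \<phi> \<eta> (w + (m - w))" using w(3) by (rule fine_split.disjoint_sum)
      then show False using mK(4) by simp
    qed
  qed
  then show ?thesis using mK(2) by (rule that)
qed

lemma compact_order_intervals_imp_discrete:
  assumes "\<And>x :: 'a::banach_lattice. 0 \<le> x \<Longrightarrow> compact {0..x}"
  shows "discrete_lattice TYPE('a)"
  unfolding discrete_lattice_def
proof (intro allI impI)
  fix x :: 'a assume x: "0 < x"
  obtain \<phi> :: "'a \<Rightarrow>\<^sub>L real" where \<phi>: "\<And>y. 0 \<le> y \<Longrightarrow> 0 \<le> blinfun_apply \<phi> y" "norm \<phi> \<le> 1"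
    "blinfun_apply \<phi> x = norm x"
    using positive_norming_functional[OF less_imp_le[OF x]] by blast
  have "0 < blinfun_apply \<phi> x" using \<phi>(3) x by simp
  then obtain \<eta> where "0 < \<eta>" "\<not> fine_split \<phi> \<eta> x"
    using compact_interval_not_fine_split[OF assms _ \<phi>(1,2)] x by (metis less_imp_le)
  then show "\<exists>a. lattice_atom a \<and> a \<le> x"
    using not_fine_split_imp_atom[of x \<phi> \<eta>] assms[of x] x \<phi> by (metis less_imp_le)
qed

section \<open>Coordinates with respect to the atoms\<close>

definition unit_atoms :: "'a::banach_lattice set" where
  "unit_atoms = {a. lattice_atom a \<and> norm a = 1}"

lemma unit_atomD:
  assumes "a \<in> unit_atoms"
  shows "0 < a" "0 \<le> a" "norm a = 1"
  using assms by (auto simp: unit_atoms_def lattice_atom_def)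

lemma below_unit_atom:
  assumes a: "a \<in> unit_atoms" and "0 \<le> r" "0 \<le> u" "u \<le> r *\<^sub>R a"
  obtains c where "0 \<le> c" "u = c *\<^sub>R a"
proof -
  have "\<exists>c. u = c *\<^sub>R a"
  proof (cases "r = 0")
    case True
    then have "u = 0" using assms by (simp add: antisym)
    then show ?thesis by (intro exI[of _ 0]) simp
  next
    case False
    then have r: "0 < r" using assms by simp
    have "inverse r *\<^sub>R u \<le> inverse r *\<^sub>R (r *\<^sub>R a)"
      using assms r by (intro scaleR_left_mono) auto
    then have "inverse r *\<^sub>R u \<le> a" using r by simp
    moreover have "0 \<le> inverse r *\<^sub>R u" using assms r by (simp add: scaleR_nonneg_nonneg)
    ultimately obtain c where "inverse r *\<^sub>R u = c *\<^sub>R a"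
      using a unfolding unit_atoms_def lattice_atom_def by blast
    then have "r *\<^sub>R (inverse r *\<^sub>R u) = r *\<^sub>R (c *\<^sub>R a)" by simp
    then show ?thesis using r by auto
  qed
  then obtain c where c: "u = c *\<^sub>R a" by blast
  show ?thesis
  proof (cases "0 \<le> c")
    case True
    then show ?thesis using c that by blast
  next
    case False
    then have "c *\<^sub>R a \<le> 0" using unit_atomD(2)[OF a] by (intro scaleR_nonpos_nonneg) auto
    then have "u = 0" using c assms by (simp add: antisym)
    then show ?thesis using that[of 0] by simp
  qed
qed

text \<open>The functional is \<open>x \<mapsto> sup {t. t a \<le> x}\<close>. It is additive because the Riesz decomposition splits a
  multiple of an atom into multiples of the atom.\<close>

lemma coordinate_functional_exists:
  fixes a :: "'a::banach_lattice"
  assumes a: "a \<in> unit_atoms"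
  shows "\<exists>f :: 'a \<Rightarrow>\<^sub>L real. \<forall>x\<ge>0. 0 \<le> blinfun_apply f x \<and> blinfun_apply f x *\<^sub>R a \<le> x \<and>
    (\<forall>t. t *\<^sub>R a \<le> x \<longrightarrow> t \<le> blinfun_apply f x)"
proof -
  note a' = unit_atomD[OF a]
  define T where "T x = {t. 0 \<le> t \<and> t *\<^sub>R a \<le> x}" for x
  define s where "s x = Sup (T x)" for x
  have T_bound: "t \<le> norm x" if "t \<in> T x" for t x
  proof -
    have "norm (t *\<^sub>R a) \<le> norm x"
      using that a' by (intro norm_mono_nonneg) (auto simp: T_def scaleR_nonneg_nonneg)
    then show ?thesis using a' by simp
  qed
  have bdd: "bdd_above (T x)" for x using T_bound by (meson bdd_above.I)
  have T0: "0 \<in> T x" if "0 \<le> x" for x using that by (simp add: T_def)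
  have s0: "0 \<le> s x" if "0 \<le> x" for x unfolding s_def using T0[OF that] bdd by (rule cSup_upper)
  have s_upper: "t \<le> s x" if "0 \<le> x" "t *\<^sub>R a \<le> x" for t x
  proof (cases "0 \<le> t")
    case True
    then show ?thesis unfolding s_def using that bdd by (intro cSup_upper) (auto simp: T_def)
  qed (use s0[OF that(1)] in simp)
  have s_le: "s x *\<^sub>R a \<le> x" if x: "0 \<le> x" for x
  proof -
    have le: "(s x - inverse (real (Suc n))) *\<^sub>R a \<le> x" for n
    proof -
      have "s x - inverse (real (Suc n)) < Sup (T x)" by (simp add: s_def)
      then obtain t where t: "t \<in> T x" "s x - inverse (real (Suc n)) < t"
        using less_cSup_iff[OF _ bdd] T0[OF x] by blast
      then have "(s x - inverse (real (Suc n))) *\<^sub>R a \<le> t *\<^sub>R a"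
        using a' by (intro scaleR_right_mono) auto
      then show ?thesis using t by (auto simp: T_def)
    qed
    have lim: "(\<lambda>n. (s x - inverse (real (Suc n))) *\<^sub>R a) \<longlonglongrightarrow> (s x - 0) *\<^sub>R a"
      by (intro tendsto_intros LIMSEQ_inverse_real_of_nat)
    have "(s x - 0) *\<^sub>R a \<le> x"
      by (intro limit_le_lattice[OF lim tendsto_const] always_eventually allI le)
    then show ?thesis by simp
  qed
  obtain f :: "'a \<Rightarrow>\<^sub>L real" where f: "\<And>x. 0 \<le> x \<Longrightarrow> blinfun_apply f x = s x"
  proof (rule positive_additive_extension[of s 1])
    show "s (x + y) = s x + s y" if x: "0 \<le> x" and y: "0 \<le> y" for x y
    proof (rule antisym)
      have "(s x + s y) *\<^sub>R a \<le> x + y"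
        unfolding scaleR_add_left using s_le[OF x] s_le[OF y] by (rule add_mono)
      then show "s x + s y \<le> s (x + y)" using x y by (intro s_upper) auto
      have "0 \<le> s (x + y) *\<^sub>R a" "s (x + y) *\<^sub>R a \<le> x + y"
        by (intro scaleR_nonneg_nonneg s0 s_le add_nonneg_nonneg x y a')+
      then obtain u v where uv: "0 \<le> u" "u \<le> x" "0 \<le> v" "v \<le> y" "s (x + y) *\<^sub>R a = u + v"
        using riesz_decomposition[OF x y] by metis
      have sxy: "0 \<le> s (x + y)" using x y by (intro s0) simp
      have "u \<le> s (x + y) *\<^sub>R a" "v \<le> s (x + y) *\<^sub>R a" using uv(1,3) by (simp_all add: uv(5))
      then obtain c d where cd: "u = c *\<^sub>R a" "v = d *\<^sub>R a"
        by (metis below_unit_atom[OF a sxy uv(1)] below_unit_atom[OF a sxy uv(3)])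
      have "s (x + y) *\<^sub>R a = (c + d) *\<^sub>R a" using uv(5) unfolding cd scaleR_add_left .
      then have "s (x + y) = c + d" using a'(1) by auto
      moreover have "c \<le> s x" using uv(2) unfolding cd by (rule s_upper[OF x])
      moreover have "d \<le> s y" using uv(4) unfolding cd by (rule s_upper[OF y])
      ultimately show "s (x + y) \<le> s x + s y" by simp
    qed
    have scale_le: "r * s x \<le> s (r *\<^sub>R x)" if "0 < r" "0 \<le> x" for r x
    proof (rule s_upper)
      show "0 \<le> r *\<^sub>R x" using that by (simp add: scaleR_nonneg_nonneg)
      show "(r * s x) *\<^sub>R a \<le> r *\<^sub>R x"
        using scaleR_left_mono[OF s_le[OF that(2)], of r] that by simp
    qed
    show "s (r *\<^sub>R x) = r * s x" if "0 \<le> r" "0 \<le> x" for r x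
    proof (cases "r = 0")
      case True
      then show ?thesis using s0[of 0] T_bound[of _ 0] T0[of 0]
        by (auto simp: s_def intro!: antisym cSup_least)
    next
      case False
      then have r: "0 < r" using that by simp
      have "inverse r * s (r *\<^sub>R x) \<le> s (inverse r *\<^sub>R (r *\<^sub>R x))"
        using r that by (intro scale_le) (auto simp: scaleR_nonneg_nonneg)
      then have "s (r *\<^sub>R x) \<le> r * s x" using r by (simp add: field_simps)
      then show ?thesis using scale_le[OF r that(2)] by simp
    qed
    show "s x \<le> 1 * norm x" if "0 \<le> x" for x
      unfolding s_def using T0[OF that] T_bound by (auto intro!: cSup_least)
  qed (use s0 in auto)
  then show ?thesis using s0 s_upper s_le by (intro exI[of _ f]) auto
qed

definition coord :: "'a::banach_lattice \<Rightarrow> ('a \<Rightarrow>\<^sub>L real)" where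
  "coord a = (SOME f. \<forall>x\<ge>0. 0 \<le> blinfun_apply f x \<and> blinfun_apply f x *\<^sub>R a \<le> x \<and>
    (\<forall>t. t *\<^sub>R a \<le> x \<longrightarrow> t \<le> blinfun_apply f x))"

lemma coord:
  assumes "a \<in> unit_atoms" "0 \<le> x"
  shows coord_nonneg: "0 \<le> blinfun_apply (coord a) x"
    and coord_le: "blinfun_apply (coord a) x *\<^sub>R a \<le> x"
    and coord_greatest: "t *\<^sub>R a \<le> x \<Longrightarrow> t \<le> blinfun_apply (coord a) x"
  using someI_ex[OF coordinate_functional_exists[OF assms(1)]] assms(2) unfolding coord_def by blast+

lemma coord_le_norm: "a \<in> unit_atoms \<Longrightarrow> 0 \<le> x \<Longrightarrow> blinfun_apply (coord a) x \<le> norm x"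
  using norm_mono_nonneg[OF _ coord_le[of a x]] coord_nonneg[of a x] unit_atomD[of a]
  by (simp add: scaleR_nonneg_nonneg)

lemma coord_self: "a \<in> unit_atoms \<Longrightarrow> blinfun_apply (coord a) a = 1"
  using coord_le_norm[of a a] coord_greatest[of a a 1] unit_atomD[of a] by simp

lemma coord_other:
  assumes a: "a \<in> unit_atoms" and b: "b \<in> unit_atoms" and "a \<noteq> b"
  shows "blinfun_apply (coord a) b = 0"
proof -
  define c where "c = blinfun_apply (coord a) b"
  have c: "0 \<le> c" "c *\<^sub>R a \<le> 1 *\<^sub>R b"
    using coord_nonneg[OF a, of b] coord_le[OF a, of b] unit_atomD[OF b] by (auto simp: c_def)
  then obtain d where d: "0 \<le> d" "c *\<^sub>R a = d *\<^sub>R b"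
    using below_unit_atom[OF b, of 1 "c *\<^sub>R a"] unit_atomD[OF a] by (auto simp: scaleR_nonneg_nonneg)
  from d(2) have "norm (c *\<^sub>R a) = norm (d *\<^sub>R b)" by (rule arg_cong)
  then have "c = d" using c(1) d(1) unit_atomD(3)[OF a] unit_atomD(3)[OF b] by simp
  then show ?thesis using d(2) \<open>a \<noteq> b\<close> by (auto simp: c_def)
qed

lemma coord_abs_le:
  assumes "a \<in> unit_atoms" "\<bar>y\<bar> \<le> x"
  shows "\<bar>blinfun_apply (coord a) y\<bar> \<le> blinfun_apply (coord a) x"
proof -
  have "0 \<le> x - y" "0 \<le> x + y"
    using assms(2) abs_le_D1[OF assms(2)] abs_le_D2[OF assms(2)] by (auto simp: minus_le_iff neg_le_iff_le le_diff_eq add.commute diff_le_eq[symmetric])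
  then show ?thesis
    using coord_nonneg[OF assms(1), of "x - y"] coord_nonneg[OF assms(1), of "x + y"]
    by (auto simp: blinfun.diff_right blinfun.add_right)
qed

text \<open>The band projection onto the span of finitely many atoms.\<close>

definition atom_proj :: "'a::banach_lattice set \<Rightarrow> 'a \<Rightarrow> 'a" where
  "atom_proj F x = (\<Sum>a\<in>F. blinfun_apply (coord a) x *\<^sub>R a)"

lemma atom_proj_diff: "atom_proj F (x - y) = atom_proj F x - atom_proj F y"
  by (simp add: atom_proj_def blinfun.diff_right scaleR_diff_left sum_subtractf)

lemma atom_proj_add: "atom_proj F (x + y) = atom_proj F x + atom_proj F y"
  by (simp add: atom_proj_def blinfun.add_right scaleR_add_left sum.distrib)

lemma coord_atom_proj:
  assumes F: "finite F" "F \<subseteq> unit_atoms" and b: "b \<in> unit_atoms"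
  shows "blinfun_apply (coord b) (atom_proj F x) = (if b \<in> F then blinfun_apply (coord b) x else 0)"
proof -
  have "blinfun_apply (coord b) (atom_proj F x) = (\<Sum>a\<in>F. blinfun_apply (coord a) x * blinfun_apply (coord b) a)"
    by (simp add: atom_proj_def blinfun.sum_right blinfun.scaleR_right)
  also have "\<dots> = (\<Sum>a\<in>F. if b = a then blinfun_apply (coord b) x else 0)"
    using F(2) b coord_other[OF b] coord_self[OF b] by (intro sum.cong) auto
  also have "\<dots> = (if b \<in> F then blinfun_apply (coord b) x else 0)"
    using F(1) by (simp add: sum.delta)
  finally show ?thesis .
qed

lemma atom_proj_bounds:
  assumes "finite F" "F \<subseteq> unit_atoms" "0 \<le> x"
  shows "0 \<le> atom_proj F x" "atom_proj F x \<le> x"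
proof -
  show "0 \<le> atom_proj F x"
    unfolding atom_proj_def using assms coord_nonneg unit_atomD(2)
    by (intro sum_nonneg scaleR_nonneg_nonneg) auto
  show "atom_proj F x \<le> x"
    using assms(1,2)
  proof (induction F rule: finite_induct)
    case empty
    then show ?case using assms(3) by (simp add: atom_proj_def)
  next
    case (insert b F)
    then have b: "b \<in> unit_atoms" and "F \<subseteq> unit_atoms" "0 \<le> x - atom_proj F x" by auto
    then have "blinfun_apply (coord b) (x - atom_proj F x) *\<^sub>R b \<le> x - atom_proj F x"
      by (intro coord_le)
    then have "blinfun_apply (coord b) x *\<^sub>R b \<le> x - atom_proj F x"
      using coord_atom_proj[OF insert.hyps(1) \<open>F \<subseteq> unit_atoms\<close> b] insert.hyps(2)
      by (simp add: blinfun.diff_right)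
    then show ?case using insert.hyps by (simp add: atom_proj_def le_diff_eq)
  qed
qed

lemma atom_proj_mono:
  assumes "finite G" "G \<subseteq> unit_atoms" "F \<subseteq> G" "0 \<le> x"
  shows "atom_proj F x \<le> atom_proj G x"
  unfolding atom_proj_def
proof (intro sum_mono2 assms scaleR_nonneg_nonneg)
  fix b assume "b \<in> G - F"
  then have "b \<in> unit_atoms" using assms by auto
  then show "0 \<le> blinfun_apply (coord b) x" "0 \<le> b" using coord_nonneg unit_atomD(2) assms by auto
qed

lemma atom_proj_Diff:
  assumes "finite G" "F \<subseteq> G"
  shows "atom_proj (G - F) x = atom_proj G x - atom_proj F x"
  unfolding atom_proj_def using assms by (simp add: sum_diff)

lemma abs_atom_sum_le:
  assumes "F \<subseteq> unit_atoms"
  shows "\<bar>\<Sum>a\<in>F. c a *\<^sub>R a\<bar> \<le> (\<Sum>a\<in>F. \<bar>c a\<bar> *\<^sub>R a)"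
  using assms
proof (induction F rule: infinite_finite_induct)
  case (insert b F)
  have "\<bar>c b *\<^sub>R b\<bar> = \<bar>c b\<bar> *\<^sub>R b"
    using unit_atomD(2)[of b] insert.prems by (simp add: abs_scaleR_lattice)
  then show ?case
    using insert abs_triangle_ineq[of "c b *\<^sub>R b" "\<Sum>a\<in>F. c a *\<^sub>R a"]
    by (auto intro: order_trans add_left_mono)
qed auto

text \<open>Atoms form a \<open>1\<close>-unconditional system: coefficients that are dominated by coordinates of
  \<open>x\<close> give a sum that is dominated by \<open>x\<close>.\<close>

lemma norm_atom_sum_le:
  assumes "finite F" "F \<subseteq> unit_atoms" "\<And>a. a \<in> F \<Longrightarrow> \<bar>c a\<bar> \<le> blinfun_apply (coord a) \<bar>x\<bar>"
  shows "norm (\<Sum>a\<in>F. c a *\<^sub>R a) \<le> norm x"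
proof (rule lattice_norm)
  have "(\<Sum>a\<in>F. \<bar>c a\<bar> *\<^sub>R a) \<le> atom_proj F \<bar>x\<bar>"
    unfolding atom_proj_def using assms unit_atomD(2) by (intro sum_mono scaleR_right_mono) auto
  also have "\<dots> \<le> \<bar>x\<bar>" using assms by (intro atom_proj_bounds) auto
  finally show "\<bar>\<Sum>a\<in>F. c a *\<^sub>R a\<bar> \<le> \<bar>x\<bar>"
    using abs_atom_sum_le[OF assms(2)] order_trans by blast
qed

lemma discrete_unit_atom_below:
  fixes x :: "'a::banach_lattice"
  assumes "discrete_lattice TYPE('a)" "0 < x"
  obtains b r where "b \<in> unit_atoms" "0 < r" "r *\<^sub>R b \<le> x"
proof -
  obtain a where a: "lattice_atom a" "a \<le> x" using assms by (auto simp: discrete_lattice_def)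
  then have a0: "0 < a" "0 < norm a" by (auto simp: lattice_atom_def)
  define b where "b = inverse (norm a) *\<^sub>R a"
  have "lattice_atom b"
    unfolding lattice_atom_def
  proof (intro conjI allI impI)
    show "0 < b" using a0 by (simp add: b_def less_le scaleR_nonneg_nonneg)
    fix y assume y: "0 \<le> y \<and> y \<le> b"
    then have "norm a *\<^sub>R y \<le> norm a *\<^sub>R b" by (intro scaleR_left_mono) auto
    then have "norm a *\<^sub>R y \<le> a" using a0 by (simp add: b_def)
    moreover have "0 \<le> norm a *\<^sub>R y" using y by (simp add: scaleR_nonneg_nonneg)
    ultimately obtain c where "norm a *\<^sub>R y = c *\<^sub>R a" using a by (auto simp: lattice_atom_def)
    then have "norm a *\<^sub>R y = norm a *\<^sub>R (c *\<^sub>R b)" using a0 by (simp add: b_def)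
    then have "y = c *\<^sub>R b" using a0 by (simp only: scaleR_cancel_left) simp
    then show "\<exists>c. y = c *\<^sub>R b" by blast
  qed
  then have "b \<in> unit_atoms" using a0 by (simp add: unit_atoms_def b_def)
  moreover have "norm a *\<^sub>R b \<le> x" using a a0 by (simp add: b_def)
  ultimately show ?thesis using a0(2) that by blast
qed

section \<open>Approximation by finitely many atoms\<close>

lemma KB_increasing_projections_convergent:
  fixes x :: "'a::banach_lattice"
  assumes KB: "KB_space TYPE('a)" and x: "0 \<le> x"
    and F: "\<And>n. finite (F n)" "\<And>n. F n \<subseteq> unit_atoms" "\<And>n. F n \<subseteq> F (Suc n)"
  shows "convergent (\<lambda>n. atom_proj (F n) x)"
proof -
  have "norm (atom_proj (F n) x) \<le> norm x" for n
    using atom_proj_bounds[OF F(1,2) x] by (intro norm_mono_nonneg)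
  then have "bounded (range (\<lambda>n. atom_proj (F n) x))" by (auto simp: bounded_iff)
  moreover have "incseq (\<lambda>n. atom_proj (F n) x)"
    using F x by (intro incseq_SucI atom_proj_mono) auto
  ultimately show ?thesis
    using KB[unfolded KB_space_def, rule_format, of "\<lambda>n. atom_proj (F n) x"]
      atom_proj_bounds(1)[OF F(1,2) x] by simp
qed

text \<open>A net of projections that is not Cauchy contains an increasing sequence with jumps bounded below,
  which the KB property excludes.\<close>

lemma KB_projections_Cauchy:
  fixes x :: "'a::banach_lattice"
  assumes KB: "KB_space TYPE('a)" and x: "0 \<le> x" and e: "0 < e"
  shows "\<exists>F. finite F \<and> F \<subseteq> unit_atoms \<and>
    (\<forall>G. finite G \<and> G \<subseteq> unit_atoms \<and> F \<subseteq> G \<longrightarrow> norm (atom_proj G x - atom_proj F x) < e)"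
proof (rule ccontr)
  assume "\<not> ?thesis"
  then have "\<forall>F. finite F \<and> F \<subseteq> unit_atoms \<longrightarrow>
    (\<exists>G. (finite G \<and> G \<subseteq> unit_atoms) \<and> F \<subseteq> G \<and> e \<le> norm (atom_proj G x - atom_proj F x))"
    by (metis not_less)
  then have "\<exists>F. \<forall>n. (finite (F n) \<and> F n \<subseteq> unit_atoms) \<and>
     (F n \<subseteq> F (Suc n) \<and> e \<le> norm (atom_proj (F (Suc n)) x - atom_proj (F n) x))"
    by (intro dependent_nat_choice) (auto intro!: exI[of _ "{}"])
  then obtain F where F: "\<And>n. finite (F n)" "\<And>n. F n \<subseteq> unit_atoms" "\<And>n. F n \<subseteq> F (Suc n)"
    "\<And>n. e \<le> norm (atom_proj (F (Suc n)) x - atom_proj (F n) x)" by metis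
  obtain l where l: "(\<lambda>n. atom_proj (F n) x) \<longlonglongrightarrow> l"
    using KB_increasing_projections_convergent[of x F, OF KB x F(1-3)] by (auto simp: convergent_def)
  have "(\<lambda>n. norm (atom_proj (F (Suc n)) x - atom_proj (F n) x)) \<longlonglongrightarrow> norm (l - l)"
    by (intro tendsto_norm tendsto_diff l LIMSEQ_Suc[OF l])
  then have "e \<le> norm (l - l)" using F(4) by (intro LIMSEQ_le_const) auto
  then show False using e by simp
qed

text \<open>The projections along a suitable sequence of finite sets converge to some \<open>y \<le> x\<close>, and \<open>x - y\<close> has
  all coordinates zero; discreteness leaves only \<open>x - y = 0\<close>.\<close>

lemma discrete_KB_positive_approx:
  fixes x :: "'a::banach_lattice"
  assumes disc: "discrete_lattice TYPE('a)" and KB: "KB_space TYPE('a)" and x: "0 \<le> x" and e: "0 < e"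
  shows "\<exists>F. finite F \<and> F \<subseteq> unit_atoms \<and> norm (x - atom_proj F x) < e"
proof -
  have "\<forall>n. \<exists>F. finite F \<and> F \<subseteq> unit_atoms \<and>
    (\<forall>G. finite G \<and> G \<subseteq> unit_atoms \<and> F \<subseteq> G \<longrightarrow> norm (atom_proj G x - atom_proj F x) < inverse (real (Suc n)))"
    by (intro allI KB_projections_Cauchy[OF KB x]) simp
  then obtain F where F: "\<And>n. finite (F n)" "\<And>n. F n \<subseteq> unit_atoms"
    "\<And>n G. finite G \<Longrightarrow> G \<subseteq> unit_atoms \<Longrightarrow> F n \<subseteq> G \<Longrightarrow> norm (atom_proj G x - atom_proj (F n) x) < inverse (real (Suc n))"
    by metis
  define H where "H n = (\<Union>k\<le>n. F k)" for n
  have H: "finite (H n)" "H n \<subseteq> unit_atoms" "H n \<subseteq> H (Suc n)" "F n \<subseteq> H n" for n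
    using F(1,2) by (auto simp: H_def intro: le_SucI)
  obtain y where y: "(\<lambda>n. atom_proj (H n) x) \<longlonglongrightarrow> y"
    using KB_increasing_projections_convergent[of x H, OF KB x H(1-3)] by (auto simp: convergent_def)
  have "y \<le> x"
    using atom_proj_bounds(2)[OF H(1,2) x]
    by (intro limit_le_lattice[OF y tendsto_const] always_eventually allI)
  have coord0: "blinfun_apply (coord b) (x - y) = 0" if b: "b \<in> unit_atoms" for b
  proof -
    \<comment> \<open>The possibly uncountably many atoms are handled one by one: adding \<open>b\<close> to \<open>H n\<close> changes the projection by at most \<open>1 / (n + 1)\<close>.\<close>
    have "norm (blinfun_apply (coord b) (x - atom_proj (H n) x)) \<le> inverse (real (Suc n))" for n
    proof -
      have ins: "finite (insert b (H n))" "insert b (H n) \<subseteq> unit_atoms" "F n \<subseteq> insert b (H n)"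
        using H(1,2,4)[of n] b by auto
      have eq: "blinfun_apply (coord b) (x - atom_proj (H n) x) *\<^sub>R b = atom_proj (insert b (H n)) x - atom_proj (H n) x"
        using coord_atom_proj[OF H(1,2) b] H(1)
        by (auto simp: blinfun.diff_right atom_proj_def insert_absorb)
      have "norm (atom_proj (insert b (H n)) x - atom_proj (H n) x)
          \<le> norm (atom_proj (insert b (H n)) x - atom_proj (F n) x)"
      proof (rule norm_mono_nonneg)
        show "0 \<le> atom_proj (insert b (H n)) x - atom_proj (H n) x"
          using atom_proj_mono[OF ins(1,2) _ x, of "H n"] by auto
        show "atom_proj (insert b (H n)) x - atom_proj (H n) x \<le> atom_proj (insert b (H n)) x - atom_proj (F n) x"
          using atom_proj_mono[OF H(1,2,4) x] by (intro diff_left_mono)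
      qed
      also have "\<dots> < inverse (real (Suc n))" by (rule F(3)[OF ins])
      finally have "norm (blinfun_apply (coord b) (x - atom_proj (H n) x) *\<^sub>R b) < inverse (real (Suc n))"
        by (simp only: eq)
      then show ?thesis using unit_atomD(3)[OF b] by simp
    qed
    then have "(\<lambda>n. blinfun_apply (coord b) (x - atom_proj (H n) x)) \<longlonglongrightarrow> 0"
      by (rule Lim_null_comparison[OF always_eventually[OF allI] LIMSEQ_inverse_real_of_nat])
    moreover have "(\<lambda>n. blinfun_apply (coord b) (x - atom_proj (H n) x)) \<longlonglongrightarrow> blinfun_apply (coord b) (x - y)"
      by (intro tendsto_intros y)
    ultimately show ?thesis using LIMSEQ_unique by blast
  qed
  have "x = y"
  proof (rule ccontr)
    assume "x \<noteq> y"
    then have "0 < x - y" using \<open>y \<le> x\<close> by (simp add: less_le)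
    then obtain b r where b: "b \<in> unit_atoms" "0 < r" "r *\<^sub>R b \<le> x - y"
      by (rule discrete_unit_atom_below[OF disc])
    then have "r \<le> blinfun_apply (coord b) (x - y)" using \<open>0 < x - y\<close> by (intro coord_greatest) auto
    then show False using coord0[OF b(1)] b(2) by simp
  qed
  then obtain n where "norm (atom_proj (H n) x - x) < e" using LIMSEQ_D[OF y e] by blast
  then show ?thesis using H by (intro exI[of _ "H n"]) (auto simp: norm_minus_commute)
qed

lemma discrete_KB_approx:
  fixes x :: "'a::banach_lattice"
  assumes disc: "discrete_lattice TYPE('a)" and KB: "KB_space TYPE('a)" and e: "0 < e"
  obtains F where "finite F" "F \<subseteq> unit_atoms"
    "\<And>G. finite G \<Longrightarrow> G \<subseteq> unit_atoms \<Longrightarrow> F \<subseteq> G \<Longrightarrow> norm (x - atom_proj G x) < e"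
proof -
  obtain F where F: "finite F" "F \<subseteq> unit_atoms" "norm (\<bar>x\<bar> - atom_proj F \<bar>x\<bar>) < e"
    using discrete_KB_positive_approx[OF disc KB _ e, of "\<bar>x\<bar>"] by auto
  have "norm (x - atom_proj G x) < e" if G: "finite G" "G \<subseteq> unit_atoms" "F \<subseteq> G" for G
  proof -
    have "0 \<le> z - atom_proj G z" if "0 \<le> z" for z using atom_proj_bounds(2)[OF G(1,2) that] by simp
    moreover have "0 \<le> \<bar>x\<bar> - x" "0 \<le> \<bar>x\<bar> + x"
      using abs_ge_self[of x] add_right_mono[OF abs_ge_minus_self[of x], of x] by simp_all
    ultimately have "0 \<le> (\<bar>x\<bar> - x) - atom_proj G (\<bar>x\<bar> - x)" "0 \<le> (\<bar>x\<bar> + x) - atom_proj G (\<bar>x\<bar> + x)"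
      by blast+
    then have "0 \<le> (\<bar>x\<bar> - atom_proj G \<bar>x\<bar>) - (x - atom_proj G x)" "0 \<le> (\<bar>x\<bar> - atom_proj G \<bar>x\<bar>) + (x - atom_proj G x)"
      unfolding atom_proj_diff atom_proj_add by (simp_all add: algebra_simps)
    then have "\<bar>x - atom_proj G x\<bar> \<le> \<bar>x\<bar> - atom_proj G \<bar>x\<bar>"
      by (intro abs_leI) (auto simp: algebra_simps)
    also have "\<dots> \<le> \<bar>x\<bar> - atom_proj F \<bar>x\<bar>"
      using atom_proj_mono[OF G, of "\<bar>x\<bar>"] by (intro diff_left_mono) auto
    finally show ?thesis using norm_le_of_abs_le F(3) by (metis le_less_trans)
  qed
  then show ?thesis using F that by blast
qed

lemma compact_box:
  fixes F :: "'v::real_normed_vector set"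
  assumes "finite F"
  shows "\<exists>K. compact K \<and> (\<forall>c. (\<forall>a\<in>F. \<bar>c a\<bar> \<le> M) \<longrightarrow> (\<Sum>a\<in>F. c a *\<^sub>R a) \<in> K)"
  using assms
proof (induction F rule: finite_induct)
  case empty
  then show ?case by (intro exI[of _ "{0}"]) auto
next
  case (insert b F)
  then obtain K where K: "compact K" "\<And>c. (\<forall>a\<in>F. \<bar>c a\<bar> \<le> M) \<Longrightarrow> (\<Sum>a\<in>F. c a *\<^sub>R a) \<in> K" by blast
  have "compact ((\<lambda>t. t *\<^sub>R b) ` {-M..M})"
    by (intro compact_continuous_image continuous_intros) auto
  then have "compact {s + t | s t. s \<in> (\<lambda>t. t *\<^sub>R b) ` {-M..M} \<and> t \<in> K}"
    using K(1) by (rule compact_sums)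
  moreover have "(\<Sum>a\<in>insert b F. c a *\<^sub>R a) \<in> {s + t | s t. s \<in> (\<lambda>t. t *\<^sub>R b) ` {-M..M} \<and> t \<in> K}"
    if "\<forall>a\<in>insert b F. \<bar>c a\<bar> \<le> M" for c
    using that K(2)[of c] insert.hyps by (fastforce simp: abs_le_iff)
  ultimately show ?case by blast
qed

lemma relatively_compact_of_uniform_approx:
  fixes A :: "'a::banach_lattice set"
  assumes "bounded A"
    and approx: "\<And>e. 0 < e \<Longrightarrow> \<exists>F. finite F \<and> F \<subseteq> unit_atoms \<and> (\<forall>x\<in>A. norm (x - atom_proj F x) \<le> e)"
  shows "relatively_compact A"
  unfolding relatively_compact_def compact_eq_totally_bounded
proof (intro conjI allI impI)
  show "complete (closure A)" by (simp add: complete_eq_closed)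
  fix e :: real assume "0 < e"
  then obtain F where F: "finite F" "F \<subseteq> unit_atoms" "\<And>x. x \<in> A \<Longrightarrow> norm (x - atom_proj F x) \<le> e / 3"
    using approx[of "e / 3"] by auto
  obtain M where M: "\<And>x. x \<in> A \<Longrightarrow> norm x \<le> M" using assms(1) by (auto simp: bounded_iff)
  obtain K where K: "compact K" "\<And>c. (\<forall>a\<in>F. \<bar>c a\<bar> \<le> M) \<Longrightarrow> (\<Sum>a\<in>F. c a *\<^sub>R a) \<in> K"
    using compact_box[OF F(1)] by blast
  have in_K: "atom_proj F x \<in> K" if x: "x \<in> A" for x
    unfolding atom_proj_def
  proof (intro K(2) ballI)
    fix a assume "a \<in> F"
    then have a: "a \<in> unit_atoms" using F by auto
    have "\<bar>blinfun_apply (coord a) x\<bar> \<le> blinfun_apply (coord a) \<bar>x\<bar>" by (rule coord_abs_le[OF a order_refl])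
    also have "\<dots> \<le> norm x" using coord_le_norm[OF a, of "\<bar>x\<bar>"] by simp
    finally show "\<bar>blinfun_apply (coord a) x\<bar> \<le> M" using M[OF x] by simp
  qed
  obtain k where k: "finite k" "K \<subseteq> (\<Union>y\<in>k. ball y (e / 3))"
    using K(1) \<open>0 < e\<close> unfolding compact_eq_totally_bounded by (metis zero_less_divide_iff zero_less_numeral)
  have "closed (\<Union>y\<in>k. cball y (2 * e / 3))" using k by (intro closed_UN) auto
  moreover have "A \<subseteq> (\<Union>y\<in>k. cball y (2 * e / 3))"
  proof
    fix x assume x: "x \<in> A"
    obtain y where y: "y \<in> k" "dist y (atom_proj F x) < e / 3" using in_K[OF x] k(2) by auto
    have "dist y x \<le> dist y (atom_proj F x) + dist (atom_proj F x) x" by (rule dist_triangle)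
    also have "\<dots> \<le> 2 * e / 3" using y(2) F(3)[OF x] by (simp add: dist_norm norm_minus_commute)
    finally show "x \<in> (\<Union>y\<in>k. cball y (2 * e / 3))" using y(1) by auto
  qed
  ultimately have "closure A \<subseteq> (\<Union>y\<in>k. cball y (2 * e / 3))" by (intro closure_minimal)
  also have "\<dots> \<subseteq> (\<Union>y\<in>k. ball y e)" using \<open>0 < e\<close> by (intro UN_mono) auto
  finally show "\<exists>k. finite k \<and> closure A \<subseteq> (\<Union>y\<in>k. ball y e)" using k(1) by blast
qed

section \<open>Discrete KB-spaces have the strong relatively compact Dunford--Pettis property\<close>

definition atom_functional :: "'a::banach_lattice set \<Rightarrow> ('a \<Rightarrow> real) \<Rightarrow> ('a \<Rightarrow>\<^sub>L real)" where
  "atom_functional F c = (\<Sum>a\<in>F. c a *\<^sub>R coord a)"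

lemma atom_functional_apply:
  "blinfun_apply (atom_functional F c) x = (\<Sum>a\<in>F. c a * blinfun_apply (coord a) x)"
  by (simp add: atom_functional_def blinfun.sum_left blinfun.scaleR_left)

lemma atom_functional_blinfun:
  "blinfun_apply (atom_functional F (blinfun_apply g)) x = blinfun_apply g (atom_proj F x)"
  by (simp add: atom_functional_apply atom_proj_def blinfun.sum_right blinfun.scaleR_right mult.commute)

lemma dual_abs_atom_functional_le:
  assumes "F \<subseteq> unit_atoms" "0 \<le> x"
  shows "blinfun_apply (dual_abs (atom_functional F c)) x \<le> (\<Sum>a\<in>F. \<bar>c a\<bar> * blinfun_apply (coord a) x)"
proof (rule dual_abs_le[OF assms(2)])
  fix y assume "\<bar>y\<bar> \<le> x"
  then have "c a * blinfun_apply (coord a) y \<le> \<bar>c a\<bar> * blinfun_apply (coord a) x" if "a \<in> F" for a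
    using that assms(1) mult_left_mono[OF coord_abs_le[of a y x], of "\<bar>c a\<bar>"] abs_ge_self[of "c a * blinfun_apply (coord a) y"]
    by (auto simp: abs_mult)
  then show "blinfun_apply (atom_functional F c) y \<le> (\<Sum>a\<in>F. \<bar>c a\<bar> * blinfun_apply (coord a) x)"
    unfolding atom_functional_apply by (rule sum_mono)
qed

lemma atom_functionals_disjoint:
  assumes "finite F" "F \<subseteq> unit_atoms" "G \<subseteq> unit_atoms" "F \<inter> G = {}"
  shows "dual_disjoint (atom_functional F c) (atom_functional G d)"
  unfolding dual_disjoint_iff
proof (intro allI impI)
  fix x :: 'a and e :: real assume x: "0 \<le> x" and "0 < e"
  define z where "z = atom_proj F x"
  have z: "0 \<le> z" "z \<le> x" using atom_proj_bounds[OF assms(1,2) x] by (auto simp: z_def)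
  have "blinfun_apply (dual_abs (atom_functional F c)) (x - z) \<le> (\<Sum>a\<in>F. \<bar>c a\<bar> * blinfun_apply (coord a) (x - z))"
    using z by (intro dual_abs_atom_functional_le assms) simp
  also have "\<dots> = 0"
    using assms(2) coord_atom_proj[OF assms(1,2)]
    by (intro sum.neutral) (auto simp: z_def blinfun.diff_right subset_iff)
  finally have 1: "blinfun_apply (dual_abs (atom_functional F c)) (x - z) \<le> 0" .
  have "blinfun_apply (dual_abs (atom_functional G d)) z \<le> (\<Sum>a\<in>G. \<bar>d a\<bar> * blinfun_apply (coord a) z)"
    using z by (intro dual_abs_atom_functional_le assms)
  also have "\<dots> = 0"
    using assms(3,4) coord_atom_proj[OF assms(1,2)]
    by (intro sum.neutral) (auto simp: z_def subset_iff disjoint_iff)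
  finally have 2: "blinfun_apply (dual_abs (atom_functional G d)) z \<le> 0" .
  show "\<exists>z. 0 \<le> z \<and> z \<le> x \<and> blinfun_apply (dual_abs (atom_functional F c)) (x - z)
      + blinfun_apply (dual_abs (atom_functional G d)) z < e"
    using 1 2 z \<open>0 < e\<close> by (intro exI[of _ z]) auto
qed

text \<open>Move a norming functional \<open>\<psi>\<close> of the sum through \<open>\<Phi>\<close>: the sum is normed by \<open>\<Phi> h\<close>, where \<open>h\<close> is \<open>\<psi>\<close>
  with signs changed on single atoms, and such changes do not increase the norm.\<close>

lemma bidual_atom_sum_bound:
  fixes \<Phi> :: "('a::banach_lattice \<Rightarrow>\<^sub>L real) \<Rightarrow>\<^sub>L real"
  assumes F: "finite F" "F \<subseteq> unit_atoms"
  shows "norm (\<Sum>a\<in>F. \<bar>blinfun_apply \<Phi> (coord a)\<bar> *\<^sub>R a) \<le> norm \<Phi>"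
proof -
  define c where "c a = blinfun_apply \<Phi> (coord a)" for a
  obtain \<psi> :: "'a \<Rightarrow>\<^sub>L real" where \<psi>: "norm \<psi> \<le> 1"
    "blinfun_apply \<psi> (\<Sum>a\<in>F. \<bar>c a\<bar> *\<^sub>R a) = norm (\<Sum>a\<in>F. \<bar>c a\<bar> *\<^sub>R a)"
    by (rule norming_functional)
  define h where "h = atom_functional F (\<lambda>a. sgn (c a) * blinfun_apply \<psi> a)"
  have "norm h \<le> 1"
  proof (rule norm_blinfun_bound)
    fix x
    have hx: "blinfun_apply h x = blinfun_apply \<psi> (\<Sum>a\<in>F. (sgn (c a) * blinfun_apply (coord a) x) *\<^sub>R a)"
      by (simp add: h_def atom_functional_apply blinfun.sum_right blinfun.scaleR_right mult_ac)
    have "\<bar>sgn (c a) * blinfun_apply (coord a) x\<bar> \<le> blinfun_apply (coord a) \<bar>x\<bar>" if "a \<in> F" for a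
      using coord_abs_le[of a x "\<bar>x\<bar>"] coord_nonneg[of a "\<bar>x\<bar>"] that F(2)
      by (auto simp: abs_mult abs_sgn_eq)
    then have "norm (\<Sum>a\<in>F. (sgn (c a) * blinfun_apply (coord a) x) *\<^sub>R a) \<le> norm x"
      by (intro norm_atom_sum_le F)
    moreover have "norm (blinfun_apply h x) \<le> norm \<psi> * norm (\<Sum>a\<in>F. (sgn (c a) * blinfun_apply (coord a) x) *\<^sub>R a)"
      unfolding hx by (rule norm_blinfun)
    ultimately show "norm (blinfun_apply h x) \<le> 1 * norm x"
      using \<psi>(1) by (meson mult_mono norm_ge_zero order_trans zero_le_one)
  qed simp
  have "norm (\<Sum>a\<in>F. \<bar>c a\<bar> *\<^sub>R a) = blinfun_apply \<Phi> h"
    unfolding \<psi>(2)[symmetric]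
    by (simp add: h_def atom_functional_def blinfun.sum_right blinfun.scaleR_right c_def abs_sgn mult_ac)
  also have "\<dots> \<le> norm \<Phi> * norm h" using norm_blinfun[of \<Phi> h] by simp
  also have "\<dots> \<le> norm \<Phi>" using \<open>norm h \<le> 1\<close> by (simp add: mult_left_le)
  finally show ?thesis by (simp add: c_def)
qed

text \<open>The heart of the matter. An element \<open>\<Phi>\<close> of the bidual restricts, on the span of finitely many
  atoms, to an element of the space itself, and the moduli of these elements have bounded increasing
  sums. In a KB-space the sums converge, so the blocks tend to zero in norm.\<close>

lemma KB_atom_blocks_weakly_null:
  fixes G :: "nat \<Rightarrow> 'a::banach_lattice set"
  assumes KB: "KB_space TYPE('a)" and G: "\<And>n. finite (G n)" "\<And>n. G n \<subseteq> unit_atoms"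
    and disj: "disjoint_family G" and g: "\<And>n. norm (g n) \<le> 1"
  shows "weakly_null (\<lambda>n. atom_functional (G n) (blinfun_apply (g n)))"
  unfolding weakly_null_def
proof
  fix \<Phi> :: "('a \<Rightarrow>\<^sub>L real) \<Rightarrow>\<^sub>L real"
  define c where "c a = blinfun_apply \<Phi> (coord a)" for a
  define y where "y n = (\<Sum>a\<in>G n. \<bar>c a\<bar> *\<^sub>R a)" for n
  have y0: "0 \<le> y n" for n
    unfolding y_def using G(2) unit_atomD(2) by (intro sum_nonneg scaleR_nonneg_nonneg) auto
  define s where "s n = (\<Sum>k<n. y k)" for n
  have s_eq: "s n = (\<Sum>a\<in>(\<Union>k<n. G k). \<bar>c a\<bar> *\<^sub>R a)" for n
    unfolding s_def y_def using G disj
    by (intro sum.UNION_disjoint[symmetric]) (auto simp: disjoint_family_on_def)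
  have "norm (s n) \<le> norm \<Phi>" for n
    unfolding s_eq c_def using G by (intro bidual_atom_sum_bound) auto
  then have "bounded (range s)" by (auto simp: bounded_iff)
  moreover have "incseq s" "\<And>n. 0 \<le> s n" using y0 by (auto simp: s_def intro!: incseq_SucI sum_nonneg)
  ultimately obtain l where l: "s \<longlonglongrightarrow> l"
    using KB[unfolded KB_space_def, rule_format, of s] by (auto simp: convergent_def)
  have "(\<lambda>n. norm (s (Suc n) - s n)) \<longlonglongrightarrow> norm (l - l)"
    by (intro tendsto_norm tendsto_diff l LIMSEQ_Suc[OF l])
  then have "(\<lambda>n. norm (y n)) \<longlonglongrightarrow> 0" by (simp add: s_def)
  moreover have "norm (blinfun_apply \<Phi> (atom_functional (G n) (blinfun_apply (g n)))) \<le> norm (y n)" for n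
  proof -
    have "blinfun_apply \<Phi> (atom_functional (G n) (blinfun_apply (g n))) = blinfun_apply (g n) (\<Sum>a\<in>G n. c a *\<^sub>R a)"
      by (simp add: atom_functional_def blinfun.sum_right blinfun.scaleR_right c_def mult.commute)
    also have "norm \<dots> \<le> norm (g n) * norm (\<Sum>a\<in>G n. c a *\<^sub>R a)" by (rule norm_blinfun)
    also have "\<dots> \<le> norm (\<Sum>a\<in>G n. c a *\<^sub>R a)" using g[of n] by (simp add: mult_left_le_one_le)
    also have "\<dots> \<le> norm (y n)" unfolding y_def by (intro norm_le_of_abs_le abs_atom_sum_le G)
    finally show ?thesis .
  qed
  ultimately show "(\<lambda>n. blinfun_apply \<Phi> (atom_functional (G n) (blinfun_apply (g n)))) \<longlonglongrightarrow> 0"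
    by (rule Lim_null_comparison[OF always_eventually, OF allI, rotated])
qed

text \<open>If finitely many atoms never suffice to approximate \<open>A\<close> uniformly, a sliding hump argument
  yields elements of \<open>A\<close> that are large on disjoint finite blocks of atoms.\<close>

lemma discrete_KB_imp_strong_DPrcP:
  assumes disc: "discrete_lattice TYPE('a::banach_lattice)" and KB: "KB_space TYPE('a)"
  shows "strong_DPrcP TYPE('a)"
  unfolding strong_DPrcP_def
proof (intro allI impI)
  fix A :: "'a set" assume A: "almost_Dunford_Pettis A"
  show "relatively_compact A"
  proof (rule relatively_compact_of_uniform_approx)
    show "bounded A" using A by (simp add: almost_Dunford_Pettis_def)
    fix e :: real assume e: "0 < e"
    show "\<exists>F. finite F \<and> F \<subseteq> unit_atoms \<and> (\<forall>x\<in>A. norm (x - atom_proj F x) \<le> e)"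
    proof (rule ccontr)
      assume "\<not> ?thesis"
      then have "\<forall>F. \<exists>x. finite F \<and> F \<subseteq> unit_atoms \<longrightarrow> x \<in> A \<and> e < norm (x - atom_proj F x)"
        by (metis not_le)
      then obtain X where X: "\<And>F. finite F \<Longrightarrow> F \<subseteq> unit_atoms \<Longrightarrow> X F \<in> A"
        "\<And>F. finite F \<Longrightarrow> F \<subseteq> unit_atoms \<Longrightarrow> e < norm (X F - atom_proj F (X F))" by metis
      have "\<exists>F. \<forall>n. (finite (F n) \<and> F n \<subseteq> unit_atoms) \<and>
        (F n \<subseteq> F (Suc n) \<and> norm (X (F n) - atom_proj (F (Suc n)) (X (F n))) < e / 2)"
      proof (rule dependent_nat_choice)
        show "\<exists>F. finite F \<and> F \<subseteq> unit_atoms" by (rule exI[of _ "{}"]) simp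
        fix F :: "'a set" assume F: "finite F \<and> F \<subseteq> unit_atoms"
        obtain F' where F': "finite F'" "F' \<subseteq> unit_atoms"
          "\<And>G. finite G \<Longrightarrow> G \<subseteq> unit_atoms \<Longrightarrow> F' \<subseteq> G \<Longrightarrow> norm (X F - atom_proj G (X F)) < e / 2"
          using discrete_KB_approx[OF disc KB, of "e / 2" "X F"] e by auto
        show "\<exists>G. (finite G \<and> G \<subseteq> unit_atoms) \<and> (F \<subseteq> G \<and> norm (X F - atom_proj G (X F)) < e / 2)"
          using F F' by (intro exI[of _ "F \<union> F'"]) auto
      qed
      then obtain F where F: "\<And>n. finite (F n)" "\<And>n. F n \<subseteq> unit_atoms" "\<And>n. F n \<subseteq> F (Suc n)"
        "\<And>n. norm (X (F n) - atom_proj (F (Suc n)) (X (F n))) < e / 2" by metis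
      define x where "x n = X (F n)" for n
      have x: "x n \<in> A" for n using X(1) F by (simp add: x_def)
      define G where "G n = F (Suc n) - F n" for n
      have G: "finite (G n)" "G n \<subseteq> unit_atoms" for n using F by (auto simp: G_def)
      have mono: "F m \<subseteq> F n" if "m \<le> n" for m n using lift_Suc_mono_le[of F, OF F(3) that] .
      have disj: "disjoint_family G"
        unfolding disjoint_family_on_def
      proof (intro ballI impI)
        fix m n :: nat assume "m \<noteq> n"
        then show "G m \<inter> G n = {}"
          using mono[of "Suc m" n] mono[of "Suc n" m] by (cases "m < n") (auto simp: G_def)
      qed
      have hump: "e / 2 \<le> norm (atom_proj (G n) (x n))" for n
      proof -
        have "atom_proj (G n) (x n) = (x n - atom_proj (F n) (x n)) - (x n - atom_proj (F (Suc n)) (x n))"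
          using F by (simp add: G_def atom_proj_Diff)
        then have "norm (x n - atom_proj (F n) (x n)) - norm (x n - atom_proj (F (Suc n)) (x n)) \<le> norm (atom_proj (G n) (x n))"
          using norm_triangle_ineq2 by metis
        then show ?thesis using X(2)[OF F(1,2), of n] F(4)[of n] by (simp add: x_def)
      qed
      have "\<forall>n. \<exists>g :: 'a \<Rightarrow>\<^sub>L real. norm g \<le> 1 \<and> blinfun_apply g (atom_proj (G n) (x n)) = norm (atom_proj (G n) (x n))"
        by (metis norming_functional)
      then obtain g :: "nat \<Rightarrow> 'a \<Rightarrow>\<^sub>L real" where g: "\<And>n. norm (g n) \<le> 1"
        "\<And>n. blinfun_apply (g n) (atom_proj (G n) (x n)) = norm (atom_proj (G n) (x n))" by metis
      define f where "f n = atom_functional (G n) (blinfun_apply (g n))" for n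
      have "disjoint_sequence f"
        unfolding disjoint_sequence_def f_def
        using G disj by (intro allI impI atom_functionals_disjoint) (auto simp: disjoint_family_on_def)
      moreover have "weakly_null f"
        unfolding f_def by (rule KB_atom_blocks_weakly_null[OF KB G disj g(1)])
      ultimately have "uniform_limit A (\<lambda>n. blinfun_apply (f n)) (\<lambda>_. 0) sequentially"
        using A by (simp add: almost_Dunford_Pettis_def)
      then have "\<forall>\<^sub>F n in sequentially. \<forall>x\<in>A. dist (blinfun_apply (f n) x) 0 < e / 2"
        using e by (intro uniform_limitD) auto
      then obtain n where "\<forall>x\<in>A. dist (blinfun_apply (f n) x) 0 < e / 2"
        by (auto simp: eventually_sequentially)
      then have "\<bar>blinfun_apply (f n) (x n)\<bar> < e / 2" using x[of n] by auto
      moreover have "blinfun_apply (f n) (x n) = norm (atom_proj (G n) (x n))"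
        by (simp add: f_def atom_functional_blinfun g)
      ultimately show False using hump[of n] by simp
    qed
  qed
qed

section \<open>From the Dunford--Pettis property back to the Gelfand--Phillips property\<close>

text \<open>Testing with the sequences \<open>g, 0, 0, \<dots>\<close> shows that \<open>A\<close> is weakly bounded.\<close>

lemma almost_p_limited_imp_bounded:
  fixes A :: "'a::banach_lattice set"
  assumes p: "1 \<le> p" and A: "almost_p_limited p A"
  shows "bounded A"
proof (rule weakly_bounded_imp_bounded)
  fix g :: "'a \<Rightarrow>\<^sub>L real"
  define f where "f n = (if n = 0 then g else 0)" for n :: nat
  have "disjoint_sequence f" by (simp add: disjoint_sequence_def f_def)
  moreover have "weak_star_p_summable p f"
    unfolding weak_star_p_summable_def in_ell_def
  proof
    fix x
    show "summable (\<lambda>n. \<bar>blinfun_apply (f n) x\<bar> powr p)"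
      by (rule summable_finite[of "{0}"]) (auto simp: f_def)
  qed
  ultimately obtain a where "\<And>x n. x \<in> A \<Longrightarrow> \<bar>blinfun_apply (f n) x\<bar> \<le> a n"
    using A unfolding almost_p_limited_def by blast
  from this[where n = 0] have "\<forall>x\<in>A. \<bar>blinfun_apply g x\<bar> \<le> a 0" by (simp add: f_def)
  then show "\<exists>M. \<forall>x\<in>A. \<bar>blinfun_apply g x\<bar> \<le> M" by blast
qed

lemma convex_hull_range_coefficients:
  fixes f :: "nat \<Rightarrow> 'v::real_vector"
  assumes "s \<in> convex hull (range f)"
  obtains I c where "finite I" "\<And>i. 0 \<le> c i" "sum c I = 1" "s = (\<Sum>i\<in>I. c i *\<^sub>R f i)"
proof -
  obtain S u where S: "finite S" "S \<subseteq> range f" "\<forall>x\<in>S. 0 \<le> u x" "sum u S = 1" "(\<Sum>v\<in>S. u v *\<^sub>R v) = s"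
    using assms unfolding convex_hull_explicit by blast
  obtain I where I: "inj_on f I" "S = f ` I"
    using S(2) subset_image_inj[of S f UNIV] by auto
  show ?thesis
  proof (rule that[of I "\<lambda>i. if i \<in> I then u (f i) else 0"])
    show "finite I" using S(1) I finite_imageD by blast
    show "0 \<le> (if i \<in> I then u (f i) else 0)" for i using S(3) I by auto
    show "(\<Sum>i\<in>I. if i \<in> I then u (f i) else 0) = 1" using S(4) I by (simp add: sum.reindex)
    show "s = (\<Sum>i\<in>I. (if i \<in> I then u (f i) else 0) *\<^sub>R f i)" using S(5) I by (simp add: sum.reindex)
  qed
qed

text \<open>For a disjoint sequence a small convex combination of the functionals is small even with the
  moduli in place of the functionals.\<close>

lemma small_convex_combination_of_moduli:
  fixes g :: "nat \<Rightarrow> ('a::banach_lattice \<Rightarrow>\<^sub>L real)"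
  assumes disj: "disjoint_sequence g" and wn: "weakly_null g" and "0 < \<epsilon>"
  obtains I c where "finite I" "\<And>i. 0 \<le> c i" "sum c I = 1"
    "\<And>x. 0 \<le> x \<Longrightarrow> (\<Sum>i\<in>I. c i * blinfun_apply (dual_abs (g i)) x) \<le> \<epsilon> * norm x"
proof -
  obtain s where s: "s \<in> convex hull (range g)" "norm s < \<epsilon>"
    using weakly_null_small_convex_combination[OF wn \<open>0 < \<epsilon>\<close>] by blast
  obtain I c where I: "finite I" "\<And>i. 0 \<le> c i" "sum c I = 1" "s = (\<Sum>i\<in>I. c i *\<^sub>R g i)"
    using convex_hull_range_coefficients[OF s(1)] by metis
  have "(\<Sum>i\<in>I. c i * blinfun_apply (dual_abs (g i)) x) \<le> \<epsilon> * norm x" if x: "0 \<le> x" for x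
  proof (rule field_le_epsilon)
    fix e :: real assume "0 < e"
    obtain y where y: "\<bar>y\<bar> \<le> x" "\<And>i. i \<in> I \<Longrightarrow> blinfun_apply (dual_abs (g i)) x - e < blinfun_apply (g i) y"
      using disjoint_simultaneous_approx[OF I(1) _ x \<open>0 < e\<close>, of g] disj
      by (auto simp: disjoint_sequence_def)
    have "(\<Sum>i\<in>I. c i * blinfun_apply (dual_abs (g i)) x) \<le> (\<Sum>i\<in>I. c i * (blinfun_apply (g i) y + e))"
      using y(2) I(2) by (intro sum_mono mult_left_mono) (auto simp: less_imp_le diff_less_eq)
    also have "\<dots> = blinfun_apply s y + e"
      using I(3) by (simp add: I(4) blinfun.sum_left blinfun.scaleR_left distrib_left sum.distrib sum_distrib_right[symmetric])
    also have "blinfun_apply s y \<le> norm s * norm y" using norm_blinfun[of s y] by simp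
    also have "\<dots> \<le> \<epsilon> * norm x"
      using s(2) \<open>0 < \<epsilon>\<close> norm_le_of_abs_le[OF y(1)] by (intro mult_mono) auto
    finally show "(\<Sum>i\<in>I. c i * blinfun_apply (dual_abs (g i)) x) \<le> \<epsilon> * norm x + e" by simp
  qed
  then show ?thesis using I that by blast
qed

text \<open>Superposing convex combinations of size \<open>(1/2) ^ k\<close> gives coefficients of infinite total mass. As
  no functional vanishes, the superposition converges in each coordinate.\<close>

lemma nonsummable_coefficients:
  fixes g :: "nat \<Rightarrow> ('a::banach_lattice \<Rightarrow>\<^sub>L real)"
  assumes disj: "disjoint_sequence g" and wn: "weakly_null g" and nz: "\<And>n. g n \<noteq> 0"
  obtains \<alpha> where "\<And>i. 0 \<le> \<alpha> i" "\<not> summable \<alpha>"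
    "\<And>N x. 0 \<le> x \<Longrightarrow> (\<Sum>i<N. \<alpha> i * blinfun_apply (dual_abs (g i)) x) \<le> 2 * norm x"
proof -
  define good where "good k I c \<longleftrightarrow> finite I \<and> (\<forall>i. 0 \<le> c i) \<and> sum c I = 1 \<and>
    (\<forall>x\<ge>0. (\<Sum>i\<in>I. c i * blinfun_apply (dual_abs (g i)) x) \<le> (1/2) ^ k * norm x)"
    for k :: nat and I c
  have "\<exists>I c. good k I c" for k :: nat
  proof (rule small_convex_combination_of_moduli[OF disj wn])
    show "0 < (1/2 :: real) ^ k" by simp
  qed (unfold good_def, intro exI conjI allI impI)
  then obtain I c where "\<And>k. good k (I k) (c k)" by metis
  then have I: "\<And>k. finite (I k)" "\<And>k i. 0 \<le> c k i" "\<And>k. sum (c k) (I k) = 1"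
    "\<And>k x. 0 \<le> x \<Longrightarrow> (\<Sum>i\<in>I k. c k i * blinfun_apply (dual_abs (g i)) x) \<le> (1/2) ^ k * norm x"
    unfolding good_def by auto
  define a where "a k i = (if i \<in> I k then c k i else 0)" for k i
  have a0: "0 \<le> a k i" for k i using I(2) by (simp add: a_def)
  have a_sum: "(\<Sum>i\<in>J. a k i * blinfun_apply (dual_abs (g i)) x) \<le> (1/2) ^ k * norm x"
    if "finite J" "0 \<le> x" for J k x
  proof -
    have "(\<Sum>i\<in>J. a k i * blinfun_apply (dual_abs (g i)) x) = (\<Sum>i\<in>J \<inter> I k. c k i * blinfun_apply (dual_abs (g i)) x)"
      using that(1) by (intro sum.mono_neutral_cong_right) (auto simp: a_def)
    also have "\<dots> \<le> (\<Sum>i\<in>I k. c k i * blinfun_apply (dual_abs (g i)) x)"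
      using I(1,2) dual_abs_nonneg[OF that(2)] by (intro sum_mono2) auto
    also have "\<dots> \<le> (1/2) ^ k * norm x" by (rule I(4)[OF that(2)])
    finally show ?thesis .
  qed
  have summable_a: "summable (\<lambda>k. a k i)" for i
  proof -
    obtain z where z: "blinfun_apply (g i) z \<noteq> 0" using nz[of i] by (metis blinfun_eqI blinfun.zero_left)
    define t where "t = blinfun_apply (dual_abs (g i)) \<bar>z\<bar>"
    have t: "0 < t" using z abs_le_dual_abs[OF order_refl, of "g i" z] by (simp add: t_def)
    have "norm (a k i) \<le> (1/2) ^ k * (norm z / t)" for k
      using a_sum[of "{i}" "\<bar>z\<bar>" k] a0[of k i] t by (simp add: t_def[symmetric] field_simps)
    moreover have "summable (\<lambda>k. (1/2) ^ k * (norm z / t))" by (intro summable_mult2 summable_geometric) simp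
    ultimately show ?thesis by (rule summable_comparison_test'[rotated, where N = 0])
  qed
  define \<alpha> where "\<alpha> i = (\<Sum>k. a k i)" for i
  have "0 \<le> \<alpha> i" for i unfolding \<alpha>_def by (rule suminf_nonneg[OF summable_a a0])
  moreover have "(\<Sum>i<N. \<alpha> i * blinfun_apply (dual_abs (g i)) x) \<le> 2 * norm x" if x: "0 \<le> x" for N x
  proof -
    have "(\<Sum>i<N. \<alpha> i * blinfun_apply (dual_abs (g i)) x) = (\<Sum>k. \<Sum>i<N. a k i * blinfun_apply (dual_abs (g i)) x)"
      unfolding \<alpha>_def suminf_mult2[OF summable_a] by (rule suminf_sum[symmetric]) (intro summable_mult2 summable_a)
    also have "\<dots> \<le> (\<Sum>k. (1/2) ^ k * norm x)"
      using a_sum[OF _ x] by (intro suminf_le summable_sum summable_mult2 summable_a summable_geometric) auto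
    also have "\<dots> = 2 * norm x"
      using suminf_mult2[OF summable_geometric[of "1/2 :: real"], of "norm x"] suminf_geometric[of "1/2 :: real"] by simp
    finally show ?thesis .
  qed
  moreover have "\<not> summable \<alpha>"
  proof
    assume sum\<alpha>: "summable \<alpha>"
    obtain K :: nat where K: "suminf \<alpha> < real K" using reals_Archimedean2 by blast
    define J where "J = (\<Union>k<K. I k)"
    have J: "finite J" using I(1) by (simp add: J_def)
    have "real K = (\<Sum>k<K. \<Sum>i\<in>J. a k i)"
    proof -
      have "(\<Sum>i\<in>J. a k i) = 1" if "k < K" for k
        unfolding I(3)[of k, symmetric] using that J
        by (intro sum.mono_neutral_cong_right) (auto simp: a_def J_def)
      then show ?thesis by simp
    qed
    also have "\<dots> = (\<Sum>i\<in>J. \<Sum>k<K. a k i)" by (rule sum.swap)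
    also have "\<dots> \<le> (\<Sum>i\<in>J. \<alpha> i)"
      unfolding \<alpha>_def using summable_a a0 by (intro sum_mono sum_le_suminf) auto
    also have "\<dots> \<le> suminf \<alpha>"
      using sum\<alpha> J \<open>\<And>i. 0 \<le> \<alpha> i\<close> by (intro sum_le_suminf) auto
    finally show False using K by simp
  qed
  ultimately show ?thesis using that by blast
qed

lemma weakly_null_pointwise_bounded:
  fixes g :: "nat \<Rightarrow> ('v::real_normed_vector \<Rightarrow>\<^sub>L real)"
  assumes "weakly_null g"
  obtains C where "0 < C" "\<And>n. \<bar>blinfun_apply (g n) x\<bar> \<le> C"
proof -
  have bl: "bounded_linear (\<lambda>f :: 'v \<Rightarrow>\<^sub>L real. blinfun_apply f x)" by (intro bounded_linear_intros)
  have "(\<lambda>n. blinfun_apply (Blinfun (\<lambda>f. blinfun_apply f x)) (g n)) \<longlonglongrightarrow> 0"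
    using assms by (auto simp: weakly_null_def)
  then have "(\<lambda>n. blinfun_apply (g n) x) \<longlonglongrightarrow> 0" by (simp add: bounded_linear_Blinfun_apply[OF bl])
  then have "Bseq (\<lambda>n. blinfun_apply (g n) x)" by (intro convergent_imp_Bseq) (auto simp: convergent_def)
  then show ?thesis using that by (auto simp: Bseq_def)
qed

text \<open>With \<open>C\<close> a bound for the values \<open>\<bar>g n x\<bar>\<close>, the \<open>p\<close>-th power of such a value is at most \<open>C powr (p - 1)\<close>
  times the value itself, so summability to the power one is enough.\<close>

lemma scaled_powr_sequence_weak_star_summable:
  fixes g :: "nat \<Rightarrow> ('a::banach_lattice \<Rightarrow>\<^sub>L real)"
  assumes p: "1 \<le> p" and wn: "weakly_null g" and \<alpha>: "\<And>i. 0 \<le> \<alpha> i"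
    "\<And>N x. 0 \<le> x \<Longrightarrow> (\<Sum>i<N. \<alpha> i * blinfun_apply (dual_abs (g i)) x) \<le> 2 * norm x"
  shows "weak_star_p_summable p (\<lambda>i. (\<alpha> i powr (1/p)) *\<^sub>R g i)"
  unfolding weak_star_p_summable_def in_ell_def
proof
  fix x
  obtain C where C: "0 < C" "\<And>n. \<bar>blinfun_apply (g n) x\<bar> \<le> C"
    using weakly_null_pointwise_bounded[OF wn] by blast
  have term_le: "\<bar>blinfun_apply ((\<alpha> i powr (1/p)) *\<^sub>R g i) x\<bar> powr p
      \<le> C powr (p - 1) * (\<alpha> i * blinfun_apply (dual_abs (g i)) \<bar>x\<bar>)" for i
  proof -
    define t where "t = \<bar>blinfun_apply (g i) x\<bar>"
    have t: "0 \<le> t" "t \<le> C" "t \<le> blinfun_apply (dual_abs (g i)) \<bar>x\<bar>"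
      using C(2) abs_le_dual_abs[OF order_refl, of "g i" x] by (auto simp: t_def)
    have "\<bar>blinfun_apply ((\<alpha> i powr (1/p)) *\<^sub>R g i) x\<bar> powr p = \<alpha> i * t powr p"
      using p \<alpha>(1)[of i] by (simp add: blinfun.scaleR_left abs_mult powr_mult powr_powr t_def)
    also have "t powr p = t * t powr (p - 1)" using t(1) by (simp add: powr_mult_base)
    also have "\<alpha> i * (t * t powr (p - 1)) \<le> \<alpha> i * (blinfun_apply (dual_abs (g i)) \<bar>x\<bar> * C powr (p - 1))"
      using t p \<alpha>(1) by (intro mult_left_mono mult_mono powr_mono2) auto
    finally show ?thesis by (simp add: mult_ac)
  qed
  show "summable (\<lambda>i. \<bar>blinfun_apply ((\<alpha> i powr (1/p)) *\<^sub>R g i) x\<bar> powr p)"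
  proof (rule summableI_nonneg_bounded)
    fix N
    have "(\<Sum>i<N. \<bar>blinfun_apply ((\<alpha> i powr (1/p)) *\<^sub>R g i) x\<bar> powr p)
        \<le> (\<Sum>i<N. C powr (p - 1) * (\<alpha> i * blinfun_apply (dual_abs (g i)) \<bar>x\<bar>))"
      by (intro sum_mono term_le)
    also have "\<dots> = C powr (p - 1) * (\<Sum>i<N. \<alpha> i * blinfun_apply (dual_abs (g i)) \<bar>x\<bar>)"
      by (rule sum_distrib_left[symmetric])
    also have "\<dots> \<le> C powr (p - 1) * (2 * norm \<bar>x\<bar>)" by (intro mult_left_mono \<alpha>(2)) auto
    finally show "(\<Sum>i<N. \<bar>blinfun_apply ((\<alpha> i powr (1/p)) *\<^sub>R g i) x\<bar> powr p) \<le> C powr (p - 1) * (2 * norm \<bar>x\<bar>)" .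
  qed simp
qed

text \<open>If a disjoint weakly null sequence stayed away from zero on \<open>A\<close>, then its multiples by
  \<open>\<alpha> i powr (1/p)\<close>, with \<open>\<alpha>\<close> not summable as above, would be weak* \<open>p\<close>-summable, whereas their
  suprema over \<open>A\<close> dominate a multiple of \<open>\<alpha> i powr (1/p)\<close> and thus are not \<open>p\<close>-summable.\<close>

lemma almost_p_limited_imp_almost_Dunford_Pettis:
  fixes A :: "'a::banach_lattice set"
  assumes p: "1 \<le> p" and A: "almost_p_limited p A"
  shows "almost_Dunford_Pettis A"
  unfolding almost_Dunford_Pettis_def
proof (intro conjI allI impI)
  show "bounded A" by (rule almost_p_limited_imp_bounded[OF p A])
  fix f :: "nat \<Rightarrow> ('a \<Rightarrow>\<^sub>L real)" assume f: "disjoint_sequence f" "weakly_null f"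
  show "uniform_limit A (\<lambda>n. blinfun_apply (f n)) (\<lambda>_. 0) sequentially"
  proof (rule ccontr)
    assume "\<not> ?thesis"
    then obtain \<epsilon> where \<epsilon>: "0 < \<epsilon>" "\<not> (\<forall>\<^sub>F n in sequentially. \<forall>x\<in>A. dist (blinfun_apply (f n) x) 0 < \<epsilon>)"
      unfolding uniform_limit_iff by blast
    then have "infinite {n. \<exists>x\<in>A. \<epsilon> \<le> \<bar>blinfun_apply (f n) x\<bar>}"
      unfolding eventually_sequentially infinite_nat_iff_unbounded_le by (simp add: not_less)
    then obtain r :: "nat \<Rightarrow> nat" where r: "strict_mono r" "\<And>n. r n \<in> {n. \<exists>x\<in>A. \<epsilon> \<le> \<bar>blinfun_apply (f n) x\<bar>}"
      using infinite_enumerate by blast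
    define g where "g n = f (r n)" for n
    have big: "\<exists>x\<in>A. \<epsilon> \<le> \<bar>blinfun_apply (g n) x\<bar>" for n using r(2)[of n] by (simp add: g_def)
    have g_disj: "disjoint_sequence g"
      using f(1) strict_mono_eq[OF r(1)] by (simp add: disjoint_sequence_def g_def)
    have g_wn: "weakly_null g"
      using f(2) LIMSEQ_subseq_LIMSEQ[OF _ r(1)] unfolding weakly_null_def g_def comp_def by blast
    have "g n \<noteq> 0" for n using big[of n] \<epsilon>(1) by auto
    then obtain \<alpha> where \<alpha>: "\<And>i. 0 \<le> \<alpha> i" "\<not> summable \<alpha>"
      "\<And>N x. 0 \<le> x \<Longrightarrow> (\<Sum>i<N. \<alpha> i * blinfun_apply (dual_abs (g i)) x) \<le> 2 * norm x"
      using nonsummable_coefficients[OF g_disj g_wn] by metis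
    define h where "h i = (\<alpha> i powr (1/p)) *\<^sub>R g i" for i
    have "disjoint_sequence h"
      using g_disj by (auto simp: disjoint_sequence_def h_def intro: dual_disjoint_scale)
    moreover have "weak_star_p_summable p h"
      unfolding h_def by (rule scaled_powr_sequence_weak_star_summable[OF p g_wn \<alpha>(1,3)])
    ultimately obtain a where a: "in_ell p a" "\<And>x n. x \<in> A \<Longrightarrow> \<bar>blinfun_apply (h n) x\<bar> \<le> a n"
      using A unfolding almost_p_limited_def by metis
    have "norm (\<alpha> n) \<le> (\<bar>a n\<bar> powr p) * inverse (\<epsilon> powr p)" for n
    proof -
      obtain x where x: "x \<in> A" "\<epsilon> \<le> \<bar>blinfun_apply (g n) x\<bar>" using big by blast
      have "\<alpha> n powr (1/p) * \<epsilon> \<le> \<alpha> n powr (1/p) * \<bar>blinfun_apply (g n) x\<bar>" using x(2) by (intro mult_left_mono) auto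
      also have "\<dots> = \<bar>blinfun_apply (h n) x\<bar>" by (simp add: h_def blinfun.scaleR_left abs_mult)
      also have "\<dots> \<le> \<bar>a n\<bar>" using a(2)[OF x(1), of n] by simp
      finally have "(\<alpha> n powr (1/p) * \<epsilon>) powr p \<le> \<bar>a n\<bar> powr p"
        using p \<epsilon>(1) by (intro powr_mono2) auto
      then have "\<alpha> n * \<epsilon> powr p \<le> \<bar>a n\<bar> powr p"
        using p \<epsilon>(1) \<alpha>(1)[of n] by (simp add: powr_mult powr_powr)
      then show ?thesis using \<epsilon>(1) \<alpha>(1)[of n] by (simp add: field_simps)
    qed
    moreover have "summable (\<lambda>n. (\<bar>a n\<bar> powr p) * inverse (\<epsilon> powr p))"
      using a(1) unfolding in_ell_def by (rule summable_mult2)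
    ultimately have "summable \<alpha>" by (rule summable_comparison_test'[rotated, where N = 0])
    then show False using \<alpha>(2) by simp
  qed
qed

theorem theorem3p5:
  fixes p :: real
  assumes "1 \<le> p"
  shows "(strong_p_GP p TYPE('a::banach_lattice) \<longrightarrow> discrete_lattice TYPE('a) \<and> KB_space TYPE('a))
    \<and> (discrete_lattice TYPE('a) \<and> KB_space TYPE('a) \<longrightarrow> strong_DPrcP TYPE('a))
    \<and> (2 \<le> p \<longrightarrow> strong_DPrcP TYPE('a) \<longrightarrow> strong_p_GP p TYPE('a))"
proof (intro conjI impI)
  assume GP: "strong_p_GP p TYPE('a)"
  show "discrete_lattice TYPE('a)"
    by (rule compact_order_intervals_imp_discrete) (rule strong_p_GP_imp_compact_order_interval[OF assms GP])
  show "KB_space TYPE('a)" by (rule strong_p_GP_imp_KB_space[OF assms GP])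
next
  assume "discrete_lattice TYPE('a) \<and> KB_space TYPE('a)"
  then show "strong_DPrcP TYPE('a)" using discrete_KB_imp_strong_DPrcP by blast
next
  assume "strong_DPrcP TYPE('a)"
  then show "strong_p_GP p TYPE('a)"
    using almost_p_limited_imp_almost_Dunford_Pettis[OF assms] by (auto simp: strong_DPrcP_def strong_p_GP_def)
qed

end
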